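(* For each $n$, let $p=p_n>q$ and let $\mathbf{y}=\mathbf{X}\boldsymbol{\beta}^\star+\boldsymbol{\epsilon}$, where the rows of $\mathbf{X}\in\mathbb{R}^{n\times p_n}$ are i.i.d. $\mathcal{N}(0,\boldsymbol{\Sigma})$ with $\boldsymbol{\Sigma}\in\mathbb{R}^{p_n\times p_n}$ symmetric positive definite, $\boldsymbol{\epsilon}\sim\mathcal{N}(0,\sigma^2\mathbb{I}_n)$ ($\sigma>0$) is independent of $\mathbf{X}$, and $\boldsymbol{\beta}^\star=(\boldsymbol{\beta}_1^{\star\prime},\mathbf{0}')'$ with $\boldsymbol{\beta}_1^\star\in\mathbb{R}^q$ fixed and having all entries nonzero. Let $\boldsymbol{\beta}_{\min}=\min_{1\le j\le q}|(\boldsymbol{\beta}_1^\star)_j|$. Assume $p_n e^{-n^{\delta}}\to 0$ as $n\to\infty$ for every $\delta>0$. Assume there exist positive constants $M_1,M_2,M_3,\alpha$ with $$M_1<\frac{\boldsymbol{\beta}_{\min}^2}{9\sigma^2},\qquad \frac{\sqrt{2+\sqrt{2}}\sqrt{M_3}\,\sigma}{\alpha}<\frac{\boldsymbol{\beta}_{\min}}{3M_2\sqrt{q}},$$ and that there exist $\lambda=\lambda_n>0$, $\eta=\eta_n>0$ such that for all sufficiently large $n$: $$\frac{\lambda}{n}<\frac{2\boldsymbol{\beta}_{\min}}{3M_2\sqrt{q}},\qquad \frac{\lambda}{n}\ge\frac{2\sqrt{2+\sqrt{2}}\sqrt{M_3}\,\sigma}{\alpha},\qquad \frac{\eta}{n}<\frac{1}{3M_2\lambda_{\max}(\boldsymbol{\Sigma}_{11})}\cdot\frac{\boldsymbol{\beta}_{\min}}{\|\boldsymbol{\beta}_1^\star\|_2},$$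 and the Generalized Irrepresentable Condition holds: there is $\delta_4>0$ such that $$\max_{1\le j\le p_n-q}\mathbb{P}\left(\left|\left(\mathcal{C}_{21}^{n,\boldsymbol{\Sigma}}\left(\mathcal{C}_{11}^{n,\boldsymbol{\Sigma}}\right)^{-1}\left(\mathrm{sign}(\boldsymbol{\beta}_1^\star)+\frac{2\eta}{\lambda}\boldsymbol{\Sigma}_{11}\boldsymbol{\beta}_1^\star\right)-\frac{2\eta}{\lambda}\boldsymbol{\Sigma}_{21}\boldsymbol{\beta}_1^\star\right)_j\right|> 1-\alpha\right)=o\left(e^{-n^{\delta_4}}\right).$$ Suppose also that there exist $\delta_1,\delta_2,\delta_3>0$ such that, as $n\to\infty$, $$\mathbb{P}(\lambda_{\max}(H_AH_A')\le M_1)=1-o(e^{-n^{\delta_1}}),\quad \mathbb{P}\big(\lambda_{\max}((\mathcal{C}_{11}^{n,\boldsymbol{\Sigma}})^{-1})\le M_2\big)=1-o(e^{-n^{\delta_2}}),\quad \mathbb{P}(\lambda_{\max}(H_BH_B')\le M_3)=1-o(e^{-n^{\delta_3}}),$$ where $H_A=n^{-1/2}(\mathcal{C}_{11}^{n,\boldsymbol{\Sigma}})^{-1}\mathbf{X}_1'$ and $H_B=n^{-1/2}\big(\mathcal{C}_{21}^{n,\boldsymbol{\Sigma}}(\mathcal{C}_{11}^{n,\boldsymbol{\Sigma}})^{-1}\mathbf{X}_1'-\mathbf{X}_2'\big)$. Then $$\mathbb{P}\left(\mathrm{sign}(\widehat{\boldsymbol{\beta}})=\mathrm{sign}(\boldsymbol{\beta}^\star)\right)\to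 1\quad\text{as } n\to\infty,$$ where $\widehat{\boldsymbol{\beta}}$ is the generalized Elastic Net estimator with parameters $\lambda_n,\eta_n$.
   Context: Notation: $\boldsymbol{\Sigma}=\boldsymbol{U}\boldsymbol{D}\boldsymbol{U}'$ is the spectral decomposition, $\boldsymbol{\Sigma}^{1/2}=\boldsymbol{U}\boldsymbol{D}^{1/2}\boldsymbol{U}'$, $\boldsymbol{\Sigma}^{-1/2}=\boldsymbol{U}\boldsymbol{D}^{-1/2}\boldsymbol{U}'$, and $\widetilde{\mathbf{X}}=\mathbf{X}\boldsymbol{\Sigma}^{-1/2}$. The generalized Elastic Net (gEN) estimator is $\widehat{\boldsymbol{\beta}}=\boldsymbol{\Sigma}^{-1/2}\widehat{\widetilde{\boldsymbol{\beta}}}$, where $\widehat{\widetilde{\boldsymbol{\beta}}}$ is the (unique) minimizer over $\widetilde{\boldsymbol{\beta}}\in\mathbb{R}^p$ of $$\|\mathbf{y}-\widetilde{\mathbf{X}}\widetilde{\boldsymbol{\beta}}\|_2^2+\lambda\|\boldsymbol{\Sigma}^{-1/2}\widetilde{\boldsymbol{\beta}}\|_1+\eta\|\widetilde{\boldsymbol{\beta}}\|_2^2.$$ $\mathbf{X}_1$ (resp. $\mathbf{X}_2$) denotes the first $q$ (resp. last $p-q$) columns of $\mathbf{X}$; $C_n=n^{-1}\mathbf{X}'\mathbf{X}$ with blocks $C_{ij}^n=n^{-1}\mathbf{X}_i'\mathbf{X}_j$; $\boldsymbol{\Sigma}_{ij}$ are the corresponding blocks of $\boldsymbol{\Sigma}$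 ($\boldsymbol{\Sigma}_{11}$ is $q\times q$). Define $\mathcal{C}_{11}^{n,\boldsymbol{\Sigma}}=C_{11}^n+\frac{\eta}{n}\boldsymbol{\Sigma}_{11}$, $\mathcal{C}_{21}^{n,\boldsymbol{\Sigma}}=C_{21}^n+\frac{\eta}{n}\boldsymbol{\Sigma}_{21}$. $\lambda_{\max}(A)$ is the largest eigenvalue of a symmetric matrix $A$. $\mathrm{sign}(x)=1,-1,0$ for $x>0,x<0,x=0$, applied componentwise. *)

theory Defs
  imports "HOL-Probability.Probability" "HOL-Library.Landau_Symbols"
    "Jordan_Normal_Form.Determinant" "Jordan_Normal_Form.Char_Poly"
begin

definition mat_inv :: "real mat \<Rightarrow> real mat" where
  "mat_inv A = (THE B. B \<in> carrier_mat (dim_row A) (dim_row A) \<and>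
      A * B = 1\<^sub>m (dim_row A) \<and> B * A = 1\<^sub>m (dim_row A))"

definition sym_pos_def_mat :: "real mat \<Rightarrow> bool" where
  "sym_pos_def_mat S \<longleftrightarrow> S \<in> carrier_mat (dim_row S) (dim_row S) \<and> transpose_mat S = S \<and>
     (\<forall>v \<in> carrier_vec (dim_row S). v \<noteq> 0\<^sub>v (dim_row S) \<longrightarrow> v \<bullet> (S *\<^sub>v v) > 0)"

definition lambda_max :: "real mat \<Rightarrow> real" where
  "lambda_max A = Max {k. eigenvalue A k}"

definition inv_sqrt_mat :: "real mat \<Rightarrow> real mat" where
  "inv_sqrt_mat S = (let d = dim_row S in
     case (SOME (U, D). U \<in> carrier_mat d d \<and> D \<in> carrier_mat d d \<and>
              transpose_mat U * U = 1\<^sub>m d \<and> U * transpose_mat U = 1\<^sub>m d \<and>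
              diagonal_mat D \<and> S = U * D * transpose_mat U) of
       (U, D) \<Rightarrow> U * mat_diag d (\<lambda>i. 1 / sqrt (D $$ (i, i))) * transpose_mat U)"

definition sq_norm_v :: "real vec \<Rightarrow> real" where
  "sq_norm_v v = (\<Sum>i<dim_vec v. (v $ i)\<^sup>2)"

definition l1_norm_v :: "real vec \<Rightarrow> real" where
  "l1_norm_v v = (\<Sum>i<dim_vec v. \<bar>v $ i\<bar>)"

definition sgn_vec :: "real vec \<Rightarrow> real vec" where
  "sgn_vec v = map_vec sgn v"

text \<open>Objective of the transformed problem, in the variable bt (= tilde beta).\<close>
definition gEN_obj :: "real mat \<Rightarrow> real vec \<Rightarrow> real mat \<Rightarrow> real \<Rightarrow> real \<Rightarrow> real vec \<Rightarrow> real" where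
  "gEN_obj X y S lam eta bt =
     sq_norm_v (y - (X * inv_sqrt_mat S) *\<^sub>v bt) + lam * l1_norm_v (inv_sqrt_mat S *\<^sub>v bt)
     + eta * sq_norm_v bt"

definition gEN :: "real mat \<Rightarrow> real vec \<Rightarrow> real mat \<Rightarrow> real \<Rightarrow> real \<Rightarrow> real vec" where
  "gEN X y S lam eta = inv_sqrt_mat S *\<^sub>v
     (THE bt. bt \<in> carrier_vec (dim_col X) \<and>
        (\<forall>b \<in> carrier_vec (dim_col X). gEN_obj X y S lam eta bt \<le> gEN_obj X y S lam eta b))"

definition sub_mat :: "real mat \<Rightarrow> nat \<Rightarrow> nat \<Rightarrow> nat \<Rightarrow> nat \<Rightarrow> real mat" where
  "sub_mat A r0 c0 nr nc = mat nr nc (\<lambda>(i, j). A $$ (r0 + i, c0 + j))"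

definition blk11 :: "real mat \<Rightarrow> nat \<Rightarrow> real mat" where
  "blk11 A q = sub_mat A 0 0 q q"
definition blk21 :: "real mat \<Rightarrow> nat \<Rightarrow> real mat" where
  "blk21 A q = sub_mat A q 0 (dim_row A - q) q"

definition cols1 :: "real mat \<Rightarrow> nat \<Rightarrow> real mat" where
  "cols1 X q = sub_mat X 0 0 (dim_row X) q"
definition cols2 :: "real mat \<Rightarrow> nat \<Rightarrow> real mat" where
  "cols2 X q = sub_mat X 0 q (dim_row X) (dim_col X - q)"

definition Cn :: "real mat \<Rightarrow> real mat" where
  "Cn X = (1 / real (dim_row X)) \<cdot>\<^sub>m (transpose_mat X * X)"

definition calC11 :: "real mat \<Rightarrow> real mat \<Rightarrow> nat \<Rightarrow> real \<Rightarrow> real mat" where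
  "calC11 X S q eta = blk11 (Cn X) q + (eta / real (dim_row X)) \<cdot>\<^sub>m blk11 S q"
definition calC21 :: "real mat \<Rightarrow> real mat \<Rightarrow> nat \<Rightarrow> real \<Rightarrow> real mat" where
  "calC21 X S q eta = blk21 (Cn X) q + (eta / real (dim_row X)) \<cdot>\<^sub>m blk21 S q"

definition H_A :: "real mat \<Rightarrow> real mat \<Rightarrow> nat \<Rightarrow> real \<Rightarrow> real mat" where
  "H_A X S q eta = (1 / sqrt (real (dim_row X))) \<cdot>\<^sub>m
     (mat_inv (calC11 X S q eta) * transpose_mat (cols1 X q))"
definition H_B :: "real mat \<Rightarrow> real mat \<Rightarrow> nat \<Rightarrow> real \<Rightarrow> real mat" where
  "H_B X S q eta = (1 / sqrt (real (dim_row X))) \<cdot>\<^sub>m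
     (calC21 X S q eta * mat_inv (calC11 X S q eta) * transpose_mat (cols1 X q)
      - transpose_mat (cols2 X q))"

definition gic_vec :: "real mat \<Rightarrow> real mat \<Rightarrow> nat \<Rightarrow> real vec \<Rightarrow> real \<Rightarrow> real \<Rightarrow> real vec" where
  "gic_vec X S q b1 lam eta =
     (calC21 X S q eta * mat_inv (calC11 X S q eta)) *\<^sub>v
        (sgn_vec b1 + (2 * eta / lam) \<cdot>\<^sub>v (blk11 S q *\<^sub>v b1))
     - (2 * eta / lam) \<cdot>\<^sub>v (blk21 S q *\<^sub>v b1)"

definition mvn_density :: "real mat \<Rightarrow> (nat \<Rightarrow> real) \<Rightarrow> real" where
  "mvn_density S x = (let d = dim_row S; v = vec d x in
     exp (- (v \<bullet> (mat_inv S *\<^sub>v v)) / 2) / sqrt ((2 * pi) ^ d * det S))"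

definition mvn_distributed :: "'a measure \<Rightarrow> real mat \<Rightarrow> ('a \<Rightarrow> nat \<Rightarrow> real) \<Rightarrow> bool" where
  "mvn_distributed M S Z \<longleftrightarrow>
     distributed M (PiM {..<dim_row S} (\<lambda>_. lborel)) Z (\<lambda>x. ennreal (mvn_density S x))"

end

theory Submission
  imports Defs "Jordan_Normal_Form.Spectral_Radius" "HOL-Real_Asymp.Real_Asymp"
begin

text \<open>
  In the variable \<open>\<beta>\<close> the objective is the strictly convex function
  \<open>\<parallel>y - X\<beta>\<parallel>\<^sup>2 + \<lambda>\<parallel>\<beta>\<parallel>\<^sub>1 + \<eta> \<beta>'\<Sigma>\<beta>\<close>, whose unique minimizer is characterized by the subgradient (KKT)
  conditions. Hence the signs are recovered if and only if the solution \<open>\<beta>\<^sub>1 + u\<close> of the linear system on the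
  support has the signs of \<open>\<beta>\<^sub>1\<close> and the subgradient bound holds off the support. Being an equivalence, this also
  yields measurability of the recovery event, without which its \<open>measure\<close> would be the junk value 0.
  The two conditions read
  \<open>u = n\<^sup>-\<^sup>1\<^sup>/\<^sup>2 H\<^sub>A \<epsilon> - C\<^sub>1\<^sub>1\<^sup>-\<^sup>1 (\<eta>/n \<Sigma>\<^sub>1\<^sub>1 \<beta>\<^sub>1 + \<lambda>/(2n) sign \<beta>\<^sub>1)\<close> with \<open>\<bar>u\<^sub>j\<bar>\<close> small, and
  \<open>\<bar>n\<^sup>-\<^sup>1\<^sup>/\<^sup>2 H\<^sub>B \<epsilon> - \<lambda>/(2n) gic\<bar> \<le> \<lambda>/(2n)\<close> componentwise. The deterministic parts of \<open>u\<close> are each below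
  \<open>\<beta>\<^sub>m\<^sub>i\<^sub>n/3\<close> by the eigenvalue bounds; the noise terms are, given \<open>X\<close>, centred Gaussian with variance at most
  \<open>\<sigma>\<^sup>2 M\<^sub>1\<close> and \<open>\<sigma>\<^sup>2 M\<^sub>3\<close>, so a Chernoff and a union bound over the \<open>p\<close> coordinates finish the proof.
\<close>

unbundle no vec_syntax and no inner_syntax

section \<open>Spectral theorem for real symmetric matrices\<close>

text \<open>Two obstacles shape the argument. \<open>H_A\<close> and \<open>H_B\<close> depend on
  the design, so the noise terms are Gaussian only conditionally. In place of conditional
  expectations, the joint law of design and noise is written as a product measure, Fubini integrates
  the noise with the design fixed, and an indicator keeps the conditional variance below a constant.
  Second, \<open>lambda_max\<close> is a \<open>Max\<close> over a spectrum, and its measurability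
  in the design is not established. The tail events are therefore truncated by squared row norms of
  \<open>H_A\<close> and \<open>H_B\<close>, which are measurable and dominated by the eigenvalue;
  if an eigenvalue event is not measurable, its \<open>measure\<close> is 0 and the failure bound is
  at least 1, hence trivial. The constant sqrt(2 + sqrt 2) makes the exponent of each off-support
  tail at least n (1 + sqrt 2 / 2) >= n, and p exp(-n) -> 0 is the growth hypothesis at exponent 1.
  On the support only the fixed number q of tails occurs, so any exponent linear in n
  suffices.\<close>

lemma index_mult_mat_sum:
  assumes "A \<in> carrier_mat n m" "B \<in> carrier_mat m k" "i < n" "j < k"
  shows "(A * B) $$ (i, j) = (\<Sum>l<m. A $$ (i, l) * B $$ (l, j))"
  using assms by (auto simp: scalar_prod_def lessThan_atLeast0)

lemma index_mult_mat_vec_sum: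
  assumes "A \<in> carrier_mat n m" "v \<in> carrier_vec m" "i < n"
  shows "(A *\<^sub>v v) $ i = (\<Sum>l<m. A $$ (i, l) * v $ l)"
  using assms by (auto simp: scalar_prod_def lessThan_atLeast0)

lemma scalar_prod_sum:
  assumes "w \<in> carrier_vec m"
  shows "v \<bullet> w = (\<Sum>l<m. v $ l * w $ l)"
  using assms by (auto simp: scalar_prod_def lessThan_atLeast0)

text \<open>A complex eigenvector z = a + ib always exists. Symmetry gives <b, Aa> = <a, Ab>, and
  comparing real and imaginary parts turns this into Im mu (|a|^2 + |b|^2) = 0. So mu is real, and
  whichever of a and b is nonzero is a real eigenvector.\<close>

lemma symmetric_real_eigenvector:
  fixes A :: "real mat"
  assumes A: "A \<in> carrier_mat n n" and sym: "transpose_mat A = A" and n: "0 < n"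
  obtains v k where "v \<in> carrier_vec n" "v \<noteq> 0\<^sub>v n" "A *\<^sub>v v = k \<cdot>\<^sub>v v"
proof -
  define C where "C = map_mat complex_of_real A"
  have C: "C \<in> carrier_mat n n" using A by (simp add: C_def)
  from spectrum_non_empty[OF C n] obtain mu where "eigenvalue C mu"
    by (auto simp: spectrum_def)
  then obtain z where z: "z \<in> carrier_vec n" "z \<noteq> 0\<^sub>v n" "C *\<^sub>v z = mu \<cdot>\<^sub>v z"
    using C by (auto simp: eigenvalue_def eigenvector_def)
  define a where "a i = Re (z $ i)" for i
  define b where "b i = Im (z $ i)" for i
  have eq: "(\<Sum>l<n. of_real (A $$ (i, l)) * z $ l) = mu * z $ i" if "i < n" for i
  proof -
    have "(C *\<^sub>v z) $ i = mu * z $ i" using z that by simp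
    moreover have "(C *\<^sub>v z) $ i = (\<Sum>l<n. of_real (A $$ (i, l)) * z $ l)"
      unfolding index_mult_mat_vec_sum[OF C z(1) that] using that A by (simp add: C_def)
    ultimately show ?thesis by simp
  qed
  have re: "(\<Sum>l<n. A $$ (i, l) * a l) = Re mu * a i - Im mu * b i" if "i < n" for i
    using arg_cong[OF eq[OF that], of Re] by (simp add: a_def b_def)
  have im: "(\<Sum>l<n. A $$ (i, l) * b l) = Re mu * b i + Im mu * a i" if "i < n" for i
    using arg_cong[OF eq[OF that], of Im] by (simp add: a_def b_def)
  have symA: "A $$ (i, j) = A $$ (j, i)" if "i < n" "j < n" for i j
    using arg_cong[OF sym, of "\<lambda>M. M $$ (i, j)"] that A by auto
  have "(\<Sum>i<n. b i * (\<Sum>l<n. A $$ (i, l) * a l)) = (\<Sum>i<n. \<Sum>l<n. b i * (A $$ (i, l) * a l))"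
    by (simp add: sum_distrib_left)
  also have "\<dots> = (\<Sum>l<n. \<Sum>i<n. b i * (A $$ (i, l) * a l))" by (rule sum.swap)
  also have "\<dots> = (\<Sum>l<n. \<Sum>i<n. a l * (A $$ (l, i) * b i))"
    by (intro sum.cong) (auto simp: symA)
  also have "\<dots> = (\<Sum>l<n. a l * (\<Sum>i<n. A $$ (l, i) * b i))"
    by (simp add: sum_distrib_left)
  finally have "(\<Sum>i<n. b i * (Re mu * a i - Im mu * b i)) = (\<Sum>i<n. a i * (Re mu * b i + Im mu * a i))"
    by (simp add: re im cong: sum.cong_simp)
  then have "(\<Sum>i<n. a i * (Re mu * b i + Im mu * a i) - b i * (Re mu * a i - Im mu * b i)) = 0"
    by (simp add: sum_subtractf)
  moreover have "a i * (Re mu * b i + Im mu * a i) - b i * (Re mu * a i - Im mu * b i)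
      = Im mu * ((a i)\<^sup>2 + (b i)\<^sup>2)" for i
    by (simp add: algebra_simps power2_eq_square)
  ultimately have "Im mu * (\<Sum>i<n. (a i)\<^sup>2 + (b i)\<^sup>2) = 0"
    by (simp only: sum_distrib_left)
  obtain i0 where i0: "i0 < n" "z $ i0 \<noteq> 0" using z by (metis eq_vecI carrier_vecD index_zero_vec)
  have "(\<Sum>i<n. (a i)\<^sup>2 + (b i)\<^sup>2) > 0"
  proof (rule sum_pos2[of _ i0])
    show "0 < (a i0)\<^sup>2 + (b i0)\<^sup>2"
      using i0(2) by (simp add: a_def b_def sum_power2_gt_zero_iff complex_eq_iff)
  qed (use i0 in auto)
  with \<open>Im mu * _ = 0\<close> have im0: "Im mu = 0" by auto
  have *: "A *\<^sub>v vec n f = Re mu \<cdot>\<^sub>v vec n f"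
    if "\<And>i. i < n \<Longrightarrow> (\<Sum>l<n. A $$ (i, l) * f l) = Re mu * f i" for f
    by (rule eq_vecI) (use A that in \<open>auto simp: index_mult_mat_vec_sum[OF A] simp del: index_mult_mat_vec\<close>)
  consider "a i0 \<noteq> 0" | "b i0 \<noteq> 0" using i0(2) by (auto simp: a_def b_def complex_eq_iff)
  then show ?thesis
  proof cases
    case 1
    have "vec n a \<noteq> 0\<^sub>v n" using 1 i0(1) by (metis index_vec index_zero_vec(1))
    then show ?thesis using that[of "vec n a"] *[of a] re im0 by auto
  next
    case 2
    have "vec n b \<noteq> 0\<^sub>v n" using 2 i0(1) by (metis index_vec index_zero_vec(1))
    then show ?thesis using that[of "vec n b"] *[of b] im im0 by auto
  qed
qed

text \<open>A Householder reflection exchanging \<open>v\<close> and the first basis vector.\<close>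

lemma orthogonal_mat_with_first_column:
  fixes v :: "real vec"
  assumes v: "v \<in> carrier_vec n" and n: "0 < n" and unit: "(\<Sum>i<n. (v $ i)\<^sup>2) = 1"
  obtains H where "H \<in> carrier_mat n n" "transpose_mat H * H = 1\<^sub>m n" "H * transpose_mat H = 1\<^sub>m n"
    "col H 0 = v"
\<comment> \<open>If v is already the first basis vector, the normal of the mirror would be
  zero.\<close>
proof (cases "v = unit_vec n 0")
  case True
  show ?thesis using that[of "1\<^sub>m n"] n True by simp
next
  case False
  define w where "w i = v $ i - (if i = 0 then 1 else 0)" for i
  define W where "W = (\<Sum>i<n. (w i)\<^sup>2)"
  obtain m where m: "n = Suc m" using n by (cases n) auto
  \<comment> \<open>Here |v| = 1 enters; it ties the normalization c = 2 / W to the entry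
    \<open>v $ 0\<close>.\<close>
  have W: "W = 2 - 2 * v $ 0"
    using unit unfolding W_def m sum.lessThan_Suc_shift by (simp add: w_def power2_eq_square algebra_simps)
  obtain i where i: "i < n" "w i \<noteq> 0"
  proof -
    have "\<exists>i<n. w i \<noteq> 0"
    proof (rule ccontr)
      assume "\<not> ?thesis"
      then have "v = unit_vec n 0" using v by (intro eq_vecI) (auto simp: w_def unit_vec_def)
      with False show False by simp
    qed
    then show ?thesis using that by auto
  qed
  have Wpos: "W > 0" unfolding W_def by (rule sum_pos2[of _ i]) (use i in auto)
  define c where "c = 2 / W"
  have cW: "c * W = 2" using Wpos by (simp add: c_def)
  define H where "H = mat n n (\<lambda>(i, j). (if i = j then 1 else 0) - c * w i * w j)"
  have H: "H \<in> carrier_mat n n" by (simp add: H_def)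
  have HT: "transpose_mat H = H" by (rule eq_matI) (auto simp: H_def)
  have HH: "H * H = 1\<^sub>m n"
  proof (rule eq_matI)
    fix i j assume "i < dim_row (1\<^sub>m n :: real mat)" "j < dim_col (1\<^sub>m n :: real mat)"
    then have ij: "i < n" "j < n" by auto
    have "(H * H) $$ (i, j) = (\<Sum>l<n. ((if i = l then 1 else 0) - c * w i * w l) *
        ((if l = j then 1 else 0) - c * w l * w j))"
      unfolding index_mult_mat_sum[OF H H ij] using ij by (simp add: H_def)
    also have "\<dots> = (\<Sum>l<n. (if l = i then (if i = j then 1 else 0) - c * w i * w j else 0)
        - (if l = j then c * w i * w j else 0) + c * c * w i * w j * (w l)\<^sup>2)"
      by (intro sum.cong) (auto simp: algebra_simps power2_eq_square)
    also have "\<dots> = (if i = j then 1 else 0) - c * w i * w j - c * w i * w j + c * c * w i * w j * W"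
      using ij by (simp add: sum.distrib sum_subtractf W_def sum_distrib_left)
    also have "\<dots> = (if i = j then 1 else 0) - 2 * c * w i * w j + (c * W) * c * w i * w j"
      by (simp add: algebra_simps)
    also have "\<dots> = 1\<^sub>m n $$ (i, j)" using ij by (simp add: cW)
    finally show "(H * H) $$ (i, j) = 1\<^sub>m n $$ (i, j)" .
  qed (auto simp: H_def)
  have v0: "v $ 0 \<noteq> 1" using W Wpos by auto
  \<comment> \<open>Column 0 of H is e_0 - c w_0 w with w_0 = v_0 - 1, so this identity makes it e_0
    + w = v.\<close>
  then have c: "c * (v $ 0 - 1) = -1" using W by (auto simp: c_def field_simps)
  have "col H 0 = v"
  proof (rule eq_vecI)
    fix i assume "i < dim_vec v"
    then have i: "i < n" using v by simp
    then have "col H 0 $ i = (if i = 0 then 1 else 0) - w i * (c * (v $ 0 - 1))"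
      using n by (simp add: H_def w_def)
    also have "\<dots> = v $ i" by (simp add: c w_def)
    finally show "col H 0 $ i = v $ i" .
  qed (use v in \<open>auto simp: H_def\<close>)
  then show ?thesis using that[of H] H HT HH by simp
qed

lemma mat_diag_Suc:
  "mat_diag (Suc m) d = four_block_mat (mat 1 1 (\<lambda>_. d 0)) (0\<^sub>m 1 m) (0\<^sub>m m 1) (mat_diag m (\<lambda>i. d (Suc i)))"
  by (rule eq_matI) (auto simp: mat_diag_def)

text \<open>Deflation: a unit eigenvector is completed to an orthogonal H, conjugation by H splits
  off a 1 x 1 block, and the induction hypothesis diagonalizes the symmetric remainder.\<close>

lemma spectral_decomposition:
  fixes A :: "real mat"
  assumes "A \<in> carrier_mat n n" "transpose_mat A = A"
  shows "\<exists>U d. U \<in> carrier_mat n n \<and> transpose_mat U * U = 1\<^sub>m n \<and> U * transpose_mat U = 1\<^sub>m n \<and>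
    A = U * mat_diag n d * transpose_mat U"
  using assms
proof (induction n arbitrary: A)
  case 0
  then show ?case by (intro exI[of _ "1\<^sub>m 0"] exI[of _ "\<lambda>_. 0"]) (auto intro!: eq_matI)
next
  case (Suc m)
  let ?n = "Suc m"
  note A = Suc.prems(1) and sym = Suc.prems(2)
  obtain v0 k where v0: "v0 \<in> carrier_vec ?n" "v0 \<noteq> 0\<^sub>v ?n" "A *\<^sub>v v0 = k \<cdot>\<^sub>v v0"
    using symmetric_real_eigenvector[OF A sym] by blast
  define N where "N = (\<Sum>i<?n. (v0 $ i)\<^sup>2)"
  obtain i0 where "i0 < ?n" "v0 $ i0 \<noteq> 0" using v0 by (metis eq_vecI carrier_vecD index_zero_vec)
  then have N: "N > 0" unfolding N_def by (intro sum_pos2[of _ i0]) auto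
  define v where "v = (1 / sqrt N) \<cdot>\<^sub>v v0"
  have v: "v \<in> carrier_vec ?n" "A *\<^sub>v v = k \<cdot>\<^sub>v v"
    using v0 A by (auto simp: v_def mult_mat_vec smult_smult_assoc mult.commute)
  have "(\<Sum>i<?n. (v $ i)\<^sup>2) = (\<Sum>i<?n. (v0 $ i)\<^sup>2 / N)"
    using v0 N by (intro sum.cong) (auto simp: v_def power_divide)
  also have "\<dots> = 1" using N by (simp add: sum_divide_distrib[symmetric] N_def)
  finally obtain H where H: "H \<in> carrier_mat ?n ?n" "transpose_mat H * H = 1\<^sub>m ?n"
    "H * transpose_mat H = 1\<^sub>m ?n" "col H 0 = v"
    using orthogonal_mat_with_first_column[OF v(1)] by blast
  let ?HT = "transpose_mat H"
  have HT: "?HT \<in> carrier_mat ?n ?n" using H(1) by simp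
  define B where "B = ?HT * A * H"
  have B: "B \<in> carrier_mat ?n ?n" using H A by (simp add: B_def)
  have BT: "transpose_mat B = B"
  proof -
    have "transpose_mat B = ?HT * transpose_mat (?HT * A)"
      unfolding B_def by (rule transpose_mult[of _ ?n ?n _ ?n]) (use H A in auto)
    also have "transpose_mat (?HT * A) = A * H"
      using transpose_mult[OF HT A] sym by simp
    finally show ?thesis unfolding B_def using assoc_mult_mat[OF HT A H(1)] by simp
  qed
  have AB: "A = H * B * ?HT"
  proof -
    have "H * B = (H * ?HT) * (A * H)"
      unfolding B_def assoc_mult_mat[OF HT A H(1)]
      by (rule assoc_mult_mat[symmetric, of _ ?n ?n _ ?n _ ?n]) (use H A in auto)
    also have "\<dots> = A * H" using H A by simp
    finally have "H * B * ?HT = A * (H * ?HT)"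
      using assoc_mult_mat[OF A H(1) HT] by simp
    then show ?thesis using H A by simp
  qed
  \<comment> \<open>The first column is H'Av = k H'v = k e_0; symmetry of B then clears the first
    row as well.\<close>
  have colB: "col B 0 = k \<cdot>\<^sub>v unit_vec ?n 0"
  proof -
    have "col B 0 = (?HT * A) *\<^sub>v v"
      unfolding B_def using H by (subst col_mult2[of _ ?n ?n _ ?n]) (auto simp: A)
    also have "\<dots> = ?HT *\<^sub>v (k \<cdot>\<^sub>v v)" using HT A v by (simp add: assoc_mult_mat_vec)
    also have "\<dots> = k \<cdot>\<^sub>v (?HT *\<^sub>v col H 0)" using HT v H(4) by (simp add: mult_mat_vec)
    also have "?HT *\<^sub>v col H 0 = col (?HT * H) 0" using H by (subst col_mult2[of _ ?n ?n _ ?n]) auto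
    also have "\<dots> = unit_vec ?n 0" using H(2) by simp
    finally show ?thesis .
  qed
  have B0: "B $$ (i, 0) = (if i = 0 then k else 0)" if "i < ?n" for i
    using arg_cong[OF colB, of "\<lambda>x. x $ i"] that B by (auto simp: unit_vec_def)
  have B0': "B $$ (0, i) = (if i = 0 then k else 0)" if "i < ?n" for i
    using B0[OF that] arg_cong[OF BT, of "\<lambda>M. M $$ (i, 0)"] that B by auto
  define B1 where "B1 = mat m m (\<lambda>(i, j). B $$ (Suc i, Suc j))"
  have B1: "B1 \<in> carrier_mat m m" by (simp add: B1_def)
  have B1T: "transpose_mat B1 = B1"
  proof (rule eq_matI)
    fix i j assume "i < dim_row B1" "j < dim_col B1"
    then have "i < m" "j < m" by (auto simp: B1_def)
    then show "transpose_mat B1 $$ (i, j) = B1 $$ (i, j)"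
      using arg_cong[OF BT, of "\<lambda>M. M $$ (Suc i, Suc j)"] B by (auto simp: B1_def)
  qed (auto simp: B1_def)
  have Bb: "B = four_block_mat (mat 1 1 (\<lambda>_. k)) (0\<^sub>m 1 m) (0\<^sub>m m 1) B1"
    by (rule eq_matI) (use B B0 B0' in \<open>auto simp: B1_def\<close>)
  from Suc.IH[OF B1 B1T] obtain U1 d1 where U1: "U1 \<in> carrier_mat m m"
    "transpose_mat U1 * U1 = 1\<^sub>m m" "U1 * transpose_mat U1 = 1\<^sub>m m"
    "B1 = U1 * mat_diag m d1 * transpose_mat U1" by blast
  \<comment> \<open>Block diagonal matrices diag(a, M) multiply and transpose blockwise, so the
    decomposition of \<open>B1\<close> lifts to \<open>B\<close>.\<close>
  define blk where "blk a M = four_block_mat (mat 1 1 (\<lambda>_. a :: real)) (0\<^sub>m 1 m) (0\<^sub>m m 1) M" for a M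
  have blk_mult: "blk a M * blk b M' = blk (a * b) (M * M')"
    if "M \<in> carrier_mat m m" "M' \<in> carrier_mat m m" for a b M M'
  proof -
    have "mat 1 1 (\<lambda>_. a) * mat 1 1 (\<lambda>_. b) + 0\<^sub>m 1 m * 0\<^sub>m m 1 = mat 1 1 (\<lambda>_. a * b)"
      by (rule eq_matI) (auto simp: scalar_prod_def)
    then show ?thesis using that unfolding blk_def
      by (subst mult_four_block_mat[of _ 1 1 _ m _ m _ _ 1 _ m]) auto
  qed
  have blk_T: "transpose_mat (blk a M) = blk a (transpose_mat M)" if "M \<in> carrier_mat m m" for a M
  proof -
    have "transpose_mat (mat 1 1 (\<lambda>_. a)) = mat 1 1 (\<lambda>_. a)" by (rule eq_matI) auto
    then show ?thesis using that unfolding blk_def by (subst transpose_four_block_mat[of _ 1 1 _ m _ m]) auto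
  qed
  have blk_1: "blk 1 (1\<^sub>m m) = 1\<^sub>m ?n" unfolding blk_def
    by (rule eq_matI) auto
  define d where "d i = (case i of 0 \<Rightarrow> k | Suc j \<Rightarrow> d1 j)" for i
  have Bdec: "B = blk 1 U1 * mat_diag ?n d * transpose_mat (blk 1 U1)"
  proof -
    have "mat_diag ?n d = blk k (mat_diag m d1)"
      unfolding mat_diag_Suc blk_def by (simp add: d_def)
    then have "blk 1 U1 * mat_diag ?n d * transpose_mat (blk 1 U1) =
        blk 1 U1 * blk k (mat_diag m d1) * blk 1 (transpose_mat U1)"
      using blk_T[OF U1(1), of 1] by simp
    also have "\<dots> = blk k B1"
      using U1 by (simp add: blk_mult)
    finally show ?thesis using Bb by (simp add: blk_def)
  qed
  let ?V = "blk 1 U1"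
  have V: "?V \<in> carrier_mat ?n ?n" using U1 by (intro carrier_matI) (auto simp: blk_def)
  have VV: "transpose_mat ?V * ?V = 1\<^sub>m ?n" "?V * transpose_mat ?V = 1\<^sub>m ?n"
    using U1 blk_1 by (auto simp: blk_T blk_mult)
  define U where "U = H * ?V"
  have U: "U \<in> carrier_mat ?n ?n" using H V by (auto simp: U_def)
  have UT: "transpose_mat U = transpose_mat ?V * ?HT"
    unfolding U_def by (rule transpose_mult[OF H(1) V])
  have VT: "transpose_mat ?V \<in> carrier_mat ?n ?n" using V by simp
  have D: "mat_diag ?n d \<in> carrier_mat ?n ?n" by simp
  have "transpose_mat U * U = transpose_mat ?V * (?HT * (H * ?V))"
    unfolding UT unfolding U_def by (rule assoc_mult_mat[OF VT HT]) (use H V in auto)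
  also have "?HT * (H * ?V) = ?V" using assoc_mult_mat[OF HT H(1) V] H(2) V by simp
  finally have 1: "transpose_mat U * U = 1\<^sub>m ?n" using VV by simp
  have "U * transpose_mat U = H * (?V * (transpose_mat ?V * ?HT))"
    unfolding UT unfolding U_def by (rule assoc_mult_mat[OF H(1) V]) (use HT VT in auto)
  also have "?V * (transpose_mat ?V * ?HT) = ?HT" using assoc_mult_mat[OF V VT HT] VV HT by simp
  finally have 2: "U * transpose_mat U = 1\<^sub>m ?n" using H by simp
  have "A = H * (?V * mat_diag ?n d * transpose_mat ?V) * ?HT"
    using AB Bdec by simp
  also have "\<dots> = H * (?V * mat_diag ?n d) * transpose_mat ?V * ?HT"
    using assoc_mult_mat[OF H(1) mult_carrier_mat[OF V D] VT] by simp
  also have "\<dots> = U * mat_diag ?n d * transpose_mat ?V * ?HT"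
    unfolding U_def using assoc_mult_mat[OF H(1) V D] by simp
  also have "\<dots> = U * mat_diag ?n d * transpose_mat U"
    unfolding UT using assoc_mult_mat[OF mult_carrier_mat[OF U D] VT HT] by simp
  finally show ?case using U 1 2 by blast
qed

lemma symmetric_orthonormal_expansion:
  fixes A :: "real mat"
  assumes A: "A \<in> carrier_mat n n" and sym: "transpose_mat A = A"
  obtains u d where
    "\<And>i j. i < n \<Longrightarrow> j < n \<Longrightarrow> A $$ (i, j) = (\<Sum>k<n. u i k * d k * u j k)"
    "\<And>k l. k < n \<Longrightarrow> l < n \<Longrightarrow> (\<Sum>i<n. u i k * u i l) = (if k = l then 1 else 0)"
    "\<And>i j. i < n \<Longrightarrow> j < n \<Longrightarrow> (\<Sum>k<n. u i k * u j k) = (if i = j then 1 else (0::real))"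
proof -
  obtain U d where U: "U \<in> carrier_mat n n" "transpose_mat U * U = 1\<^sub>m n"
    "U * transpose_mat U = 1\<^sub>m n" "A = U * mat_diag n d * transpose_mat U"
    using spectral_decomposition[OF A sym] by blast
  have UT: "transpose_mat U \<in> carrier_mat n n" using U by simp
  have UD: "U * mat_diag n d \<in> carrier_mat n n" using U by simp
  show ?thesis
  proof (rule that[of "\<lambda>i k. U $$ (i, k)" d])
    fix i j assume ij: "i < n" "j < n"
    have "A $$ (i, j) = (\<Sum>k<n. (U * mat_diag n d) $$ (i, k) * transpose_mat U $$ (k, j))"
      unfolding U(4) by (rule index_mult_mat_sum[OF UD UT ij])
    also have "\<dots> = (\<Sum>k<n. U $$ (i, k) * d k * U $$ (j, k))"
      using U(1) ij by (intro sum.cong) (auto simp: mat_diag_mult_right[OF U(1)])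
    finally show "A $$ (i, j) = \<dots>" .
  next
    fix k l assume kl: "k < n" "l < n"
    have "(\<Sum>i<n. U $$ (i, k) * U $$ (i, l)) = (transpose_mat U * U) $$ (k, l)"
      unfolding index_mult_mat_sum[OF UT U(1) kl] using U(1) kl by (intro sum.cong) auto
    then show "(\<Sum>i<n. U $$ (i, k) * U $$ (i, l)) = (if k = l then 1 else 0)"
      using U kl by simp
  next
    fix i j assume ij: "i < n" "j < n"
    have "(\<Sum>k<n. U $$ (i, k) * U $$ (j, k)) = (U * transpose_mat U) $$ (i, j)"
      unfolding index_mult_mat_sum[OF U(1) UT ij] using U(1) ij by (intro sum.cong) auto
    then show "(\<Sum>k<n. U $$ (i, k) * U $$ (j, k)) = (if i = j then 1 else 0)"
      using U ij by simp
  qed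
qed

section \<open>Bounds by the largest eigenvalue\<close>

lemma eigenvalue_le_lambda_max:
  assumes "A \<in> carrier_mat n n" "eigenvalue A k"
  shows "k \<le> lambda_max A"
  unfolding lambda_max_def using assms card_finite_spectrum(1)[OF assms(1)]
  by (intro Max_ge) (auto simp: spectrum_def)

text \<open>The third fact is Parseval's identity for the eigenbasis, the fourth is the action of A
  in its coordinates. Together they reduce estimates by \<open>lambda_max\<close> to the scalar
  inequality \<open>d k \<le> lambda_max A\<close>.\<close>

lemma symmetric_lambda_max_expansion:
  fixes A :: "real mat"
  assumes A: "A \<in> carrier_mat n n" and sym: "transpose_mat A = A"
  obtains u d where
    "\<And>i j. i < n \<Longrightarrow> j < n \<Longrightarrow> A $$ (i, j) = (\<Sum>k<n. u i k * d k * u j k)"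
    "\<And>k l. k < n \<Longrightarrow> l < n \<Longrightarrow> (\<Sum>i<n. u i k * u i l) = (if k = l then 1 else 0)"
    "\<And>v. (\<Sum>k<n. (\<Sum>i<n. u i k * v i)\<^sup>2) = (\<Sum>i<n. (v i)\<^sup>2 :: real)"
    "\<And>i v. i < n \<Longrightarrow> (\<Sum>j<n. A $$ (i, j) * v j) = (\<Sum>k<n. u i k * (d k * (\<Sum>j<n. u j k * v j)))"
    "\<And>k. k < n \<Longrightarrow> d k \<le> lambda_max A"
proof -
  obtain u d where ud: "\<And>i j. i < n \<Longrightarrow> j < n \<Longrightarrow> A $$ (i, j) = (\<Sum>k<n. u i k * d k * u j k)"
    "\<And>k l. k < n \<Longrightarrow> l < n \<Longrightarrow> (\<Sum>i<n. u i k * u i l) = (if k = l then 1 else 0)"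
    "\<And>i j. i < n \<Longrightarrow> j < n \<Longrightarrow> (\<Sum>k<n. u i k * u j k) = (if i = j then 1 else (0::real))"
    by (rule symmetric_orthonormal_expansion[OF A sym]) blast
  have norm: "(\<Sum>k<n. (\<Sum>i<n. u i k * v i)\<^sup>2) = (\<Sum>i<n. (v i)\<^sup>2)" for v
  proof -
    have "(\<Sum>k<n. (\<Sum>i<n. u i k * v i)\<^sup>2) = (\<Sum>k<n. \<Sum>i<n. \<Sum>j<n. v i * v j * (u i k * u j k))"
      by (simp add: power2_eq_square sum_product mult_ac)
    also have "\<dots> = (\<Sum>i<n. \<Sum>k<n. \<Sum>j<n. v i * v j * (u i k * u j k))" by (rule sum.swap)
    also have "\<dots> = (\<Sum>i<n. \<Sum>j<n. \<Sum>k<n. v i * v j * (u i k * u j k))"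
      by (intro sum.cong refl sum.swap)
    also have "\<dots> = (\<Sum>i<n. \<Sum>j<n. if j = i then (v i)\<^sup>2 else 0)"
      by (intro sum.cong refl) (auto simp: sum_distrib_left[symmetric] ud(3) power2_eq_square)
    also have "\<dots> = (\<Sum>i<n. (v i)\<^sup>2)" by simp
    finally show ?thesis .
  qed
  have mv: "(\<Sum>j<n. A $$ (i, j) * v j) = (\<Sum>k<n. u i k * (d k * (\<Sum>j<n. u j k * v j)))" if "i < n" for i v
  proof -
    have "(\<Sum>j<n. A $$ (i, j) * v j) = (\<Sum>j<n. \<Sum>k<n. u i k * (d k * (u j k * v j)))"
      using that by (simp add: ud(1) sum_distrib_left sum_distrib_right mult_ac)
    also have "\<dots> = (\<Sum>k<n. \<Sum>j<n. u i k * (d k * (u j k * v j)))" by (rule sum.swap)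
    finally show ?thesis by (simp add: sum_distrib_left)
  qed
  have "d k \<le> lambda_max A" if k: "k < n" for k
  proof (rule eigenvalue_le_lambda_max[OF A])
    \<comment> \<open>Column k of the orthogonal matrix is an eigenvector for \<open>d k\<close>; it
      is nonzero because its norm is one.\<close>
    let ?v = "vec n (\<lambda>i. u i k)"
    have "A *\<^sub>v ?v = d k \<cdot>\<^sub>v ?v"
    proof (rule eq_vecI)
      fix i assume "i < dim_vec (d k \<cdot>\<^sub>v ?v)"
      then have i: "i < n" by simp
      have "(A *\<^sub>v ?v) $ i = (\<Sum>j<n. A $$ (i, j) * u j k)"
        unfolding index_mult_mat_vec_sum[OF A vec_carrier i] by simp
      also have "\<dots> = (\<Sum>l<n. if l = k then u i k * d k else 0)"
        unfolding mv[OF i] using k by (intro sum.cong) (auto simp: ud(2))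
      finally show "(A *\<^sub>v ?v) $ i = (d k \<cdot>\<^sub>v ?v) $ i" using k i by simp
    qed (use A in auto)
    moreover have "?v \<noteq> 0\<^sub>v n"
    proof
      assume "?v = 0\<^sub>v n"
      then have "u i k = 0" if "i < n" for i using that by (metis index_vec index_zero_vec(1))
      then show False using ud(2)[OF k k] by simp
    qed
    ultimately show "eigenvalue A (d k)"
      using A by (auto simp: eigenvalue_def eigenvector_def intro!: exI[of _ ?v])
  qed
  note le = this
  show ?thesis by (rule that[of u d]) (fact ud norm mv le)+
qed

text \<open>A diagonal entry is an average of the eigenvalues with the weights
  \<open>(u i k)\<^sup>2\<close>, which sum to one by Parseval at the i-th basis vector.\<close>

lemma symmetric_diag_le_lambda_max:
  assumes A: "A \<in> carrier_mat n n" and sym: "transpose_mat A = A" and i: "i < n"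
  shows "A $$ (i, i) \<le> lambda_max A"
proof -
  obtain u d where ud: "\<And>i j. i < n \<Longrightarrow> j < n \<Longrightarrow> A $$ (i, j) = (\<Sum>k<n. u i k * d k * u j k)"
    "\<And>v. (\<Sum>k<n. (\<Sum>i<n. u i k * v i)\<^sup>2) = (\<Sum>i<n. (v i)\<^sup>2 :: real)"
    "\<And>k. k < n \<Longrightarrow> d k \<le> lambda_max A"
    by (rule symmetric_lambda_max_expansion[OF A sym]) blast
  have "(\<Sum>k<n. (u i k)\<^sup>2) = 1"
    using ud(2)[of "\<lambda>j. if j = i then 1 else 0"] i by (simp add: if_distrib[of "\<lambda>x. _ * x"] if_distrib[of "\<lambda>x. x\<^sup>2"] cong: if_cong)
  then have "lambda_max A = (\<Sum>k<n. (u i k)\<^sup>2 * lambda_max A)"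
    by (simp add: sum_distrib_right[symmetric])
  also have "\<dots> \<ge> (\<Sum>k<n. (u i k)\<^sup>2 * d k)"
    by (intro sum_mono mult_left_mono ud) auto
  finally show ?thesis using i by (simp add: ud(1) power2_eq_square mult_ac)
qed

text \<open>Translates definiteness into double sums over plain functions, the form in which the
  objective and its perturbations are handled.\<close>

lemma sym_pos_def_mat_iff:
  assumes A: "A \<in> carrier_mat n n"
  shows "sym_pos_def_mat A \<longleftrightarrow> (\<forall>i<n. \<forall>j<n. A $$ (i, j) = A $$ (j, i)) \<and>
    (\<forall>v. (\<exists>i<n. v i \<noteq> 0) \<longrightarrow> 0 < (\<Sum>i<n. v i * (\<Sum>j<n. A $$ (i, j) * v j)))"
proof -
  have sym: "transpose_mat A = A \<longleftrightarrow> (\<forall>i<n. \<forall>j<n. A $$ (i, j) = A $$ (j, i))"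
  proof
    assume *: "transpose_mat A = A"
    show "\<forall>i<n. \<forall>j<n. A $$ (i, j) = A $$ (j, i)"
    proof (intro allI impI)
      fix i j assume "i < n" "j < n"
      then show "A $$ (i, j) = A $$ (j, i)" using arg_cong[OF *, of "\<lambda>M. M $$ (i, j)"] A by auto
    qed
  qed (use A in \<open>auto intro!: eq_matI\<close>)
  have form: "v \<bullet> (A *\<^sub>v v) = (\<Sum>i<n. v $ i * (\<Sum>j<n. A $$ (i, j) * v $ j))" if "v \<in> carrier_vec n" for v
    using that A by (simp add: scalar_prod_sum[of _ n] index_mult_mat_vec_sum[OF A] del: index_mult_mat_vec)
  have "(\<forall>v \<in> carrier_vec n. v \<noteq> 0\<^sub>v n \<longrightarrow> 0 < v \<bullet> (A *\<^sub>v v)) \<longleftrightarrow>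
    (\<forall>v. (\<exists>i<n. v i \<noteq> 0) \<longrightarrow> 0 < (\<Sum>i<n. v i * (\<Sum>j<n. A $$ (i, j) * v j)))" (is "?L \<longleftrightarrow> ?R")
  proof
    assume L: ?L
    show ?R
    proof (intro allI impI)
      fix v :: "nat \<Rightarrow> real" assume "\<exists>i<n. v i \<noteq> 0"
      then have "vec n v \<noteq> 0\<^sub>v n" by (metis index_vec index_zero_vec(1))
      then have "0 < vec n v \<bullet> (A *\<^sub>v vec n v)" using L by simp
      then show "0 < (\<Sum>i<n. v i * (\<Sum>j<n. A $$ (i, j) * v j))" by (simp add: form)
    qed
  next
    assume R: ?R
    show ?L
    proof (intro ballI impI)
      fix v :: "real vec" assume v: "v \<in> carrier_vec n" "v \<noteq> 0\<^sub>v n"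
      then have "\<exists>i<n. v $ i \<noteq> 0" by (metis eq_vecI carrier_vecD index_zero_vec)
      then show "0 < v \<bullet> (A *\<^sub>v v)" using R v by (simp add: form)
    qed
  qed
  then show ?thesis unfolding sym_pos_def_mat_def using A sym by auto
qed

text \<open>Definiteness places every eigenvalue in the interval from 0 to
  \<open>lambda_max A\<close>, so the squared eigenvalues are bounded too; a very negative
  eigenvalue would break the second estimate.\<close>

lemma sym_pos_def_mat_lambda_max:
  assumes A: "A \<in> carrier_mat n n" and pd: "sym_pos_def_mat A" and n: "0 < n"
  shows "0 < lambda_max A"
    and "(\<Sum>i<n. (\<Sum>j<n. A $$ (i, j) * v j)\<^sup>2) \<le> (lambda_max A)\<^sup>2 * (\<Sum>i<n. (v i)\<^sup>2)"
proof -
  have sym: "transpose_mat A = A" using pd by (simp add: sym_pos_def_mat_def)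
  obtain u d where ud: "\<And>i j. i < n \<Longrightarrow> j < n \<Longrightarrow> A $$ (i, j) = (\<Sum>k<n. u i k * d k * u j k)"
    "\<And>k l. k < n \<Longrightarrow> l < n \<Longrightarrow> (\<Sum>i<n. u i k * u i l) = (if k = l then 1 else 0)"
    "\<And>v. (\<Sum>k<n. (\<Sum>i<n. u i k * v i)\<^sup>2) = (\<Sum>i<n. (v i)\<^sup>2 :: real)"
    "\<And>i v. i < n \<Longrightarrow> (\<Sum>j<n. A $$ (i, j) * v j) = (\<Sum>k<n. u i k * (d k * (\<Sum>j<n. u j k * v j)))"
    "\<And>k. k < n \<Longrightarrow> d k \<le> lambda_max A"
    by (rule symmetric_lambda_max_expansion[OF A sym]) blast
  have orth: "(\<Sum>k<n. w k * (\<Sum>i<n. u i l * u i k)) = w l" if "l < n" for w l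
    using that by (subst sum.cong[OF refl, of _ _ "\<lambda>k. if k = l then w l else 0"]) (auto simp: ud(2))
  \<comment> \<open>The quadratic form at the k-th eigenvector equals \<open>d k\<close>.\<close>
  have d_pos: "0 < d k" if k: "k < n" for k
  proof -
    have "\<exists>i<n. u i k \<noteq> 0"
    proof (rule ccontr)
      assume "\<not> ?thesis"
      then show False using ud(2)[OF k k] by simp
    qed
    then have "0 < (\<Sum>i<n. u i k * (\<Sum>j<n. A $$ (i, j) * u j k))"
      by (rule mp[OF spec[OF conjunct2[OF iffD1[OF sym_pos_def_mat_iff[OF A] pd]], of "\<lambda>i. u i k"]])
    also have "\<dots> = (\<Sum>i<n. u i k * (u i k * d k))"
    proof (intro sum.cong refl arg_cong2[of _ _ _ _ "(*)"])
      fix i assume "i \<in> {..<n}"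
      then have "(\<Sum>j<n. A $$ (i, j) * u j k) = (\<Sum>l<n. u i l * (d l * (\<Sum>j<n. u j l * u j k)))"
        by (intro ud(4)) simp
      also have "\<dots> = (\<Sum>l<n. if l = k then u i k * d k else 0)"
        using k by (intro sum.cong) (auto simp: ud(2))
      finally show "(\<Sum>j<n. A $$ (i, j) * u j k) = u i k * d k" using k by simp
    qed
    also have "\<dots> = d k * (\<Sum>i<n. u i k * u i k)" by (simp add: sum_distrib_left mult_ac)
    finally show ?thesis using ud(2)[OF k k] by simp
  qed
  from d_pos[OF n] ud(5)[OF n] show "0 < lambda_max A" by simp
  define c where "c k = d k * (\<Sum>j<n. u j k * v j)" for k
  have "(\<Sum>i<n. (\<Sum>j<n. A $$ (i, j) * v j)\<^sup>2) = (\<Sum>i<n. (\<Sum>k<n. u i k * c k)\<^sup>2)"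
    by (simp add: ud(4) c_def)
  also have "\<dots> = (\<Sum>i<n. \<Sum>k<n. \<Sum>l<n. c k * (c l * (u i k * u i l)))"
    by (simp add: power2_eq_square sum_product mult_ac)
  also have "\<dots> = (\<Sum>k<n. \<Sum>i<n. \<Sum>l<n. c k * (c l * (u i k * u i l)))" by (rule sum.swap)
  also have "\<dots> = (\<Sum>k<n. \<Sum>l<n. \<Sum>i<n. c k * (c l * (u i k * u i l)))"
    by (intro sum.cong refl sum.swap)
  also have "\<dots> = (\<Sum>k<n. c k * (\<Sum>l<n. c l * (\<Sum>i<n. u i k * u i l)))"
    by (simp add: sum_distrib_left)
  also have "\<dots> = (\<Sum>k<n. c k * c k)" by (simp add: orth)
  also have "\<dots> = (\<Sum>k<n. (d k)\<^sup>2 * (\<Sum>j<n. u j k * v j)\<^sup>2)"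
    by (simp add: c_def power2_eq_square mult_ac)
  also have "\<dots> \<le> (\<Sum>k<n. (lambda_max A)\<^sup>2 * (\<Sum>j<n. u j k * v j)\<^sup>2)"
    by (intro sum_mono mult_right_mono power_mono ud(5)) (auto intro: less_imp_le d_pos)
  also have "\<dots> = (lambda_max A)\<^sup>2 * (\<Sum>i<n. (v i)\<^sup>2)"
    by (simp add: sum_distrib_left[symmetric] ud(3))
  finally show "(\<Sum>i<n. (\<Sum>j<n. A $$ (i, j) * v j)\<^sup>2) \<le> (lambda_max A)\<^sup>2 * (\<Sum>i<n. (v i)\<^sup>2)" .
qed

section \<open>Inverses of positive definite matrices\<close>

lemma mat_inv_eq:
  assumes A: "A \<in> carrier_mat n n" and B: "B \<in> carrier_mat n n" and "A * B = 1\<^sub>m n" "B * A = 1\<^sub>m n"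
  shows "mat_inv A = B"
  unfolding mat_inv_def
proof (rule the_equality)
  fix C assume C: "C \<in> carrier_mat (dim_row A) (dim_row A) \<and> A * C = 1\<^sub>m (dim_row A) \<and> C * A = 1\<^sub>m (dim_row A)"
  then have Cc: "C \<in> carrier_mat n n" using A by simp
  have "B = B * (A * C)" using C A B by simp
  also have "\<dots> = (B * A) * C" using assoc_mult_mat[OF B A Cc] by simp
  also have "\<dots> = C" using assms Cc by simp
  finally show "C = B" ..
qed (use assms in auto)

text \<open>The adjugate gives more than existence: it exhibits the entries of the inverse as
  quotients of polynomials in the entries of A, which later makes them measurable.\<close>

lemma mat_inv_adj_mat:
  assumes A: "A \<in> carrier_mat n n" and det: "det A \<noteq> 0"
  shows "mat_inv A = (1 / det A) \<cdot>\<^sub>m adj_mat A"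
    and "mat_inv A \<in> carrier_mat n n" "A * mat_inv A = 1\<^sub>m n" "mat_inv A * A = 1\<^sub>m n"
proof -
  let ?B = "(1 / det A) \<cdot>\<^sub>m adj_mat A"
  note adj = adj_mat[OF A]
  have B: "?B \<in> carrier_mat n n" using adj(1) by simp
  have AB: "A * ?B = 1\<^sub>m n" using mult_smult_distrib[OF A adj(1)] adj(2) det by (auto intro!: eq_matI)
  have BA: "?B * A = 1\<^sub>m n" using mult_smult_assoc_mat[OF adj(1) A] adj(3) det by (auto intro!: eq_matI)
  show eq: "mat_inv A = ?B" by (rule mat_inv_eq[OF A B AB BA])
  show "mat_inv A \<in> carrier_mat n n" "A * mat_inv A = 1\<^sub>m n" "mat_inv A * A = 1\<^sub>m n"
    unfolding eq by (fact B AB BA)+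
qed

lemma sym_pos_def_mat_det:
  assumes A: "A \<in> carrier_mat n n" and pd: "sym_pos_def_mat A"
  shows "det A \<noteq> 0"
proof
  assume "det A = 0"
  then obtain v where v: "v \<in> carrier_vec n" "v \<noteq> 0\<^sub>v n" "A *\<^sub>v v = 0\<^sub>v n"
    using det_0_iff_vec_prod_zero[OF A] by blast
  then have "0 < v \<bullet> (A *\<^sub>v v)" using pd A by (auto simp: sym_pos_def_mat_def)
  then show False using v by simp
qed

lemmas sym_pos_def_mat_inv = mat_inv_adj_mat[OF _ sym_pos_def_mat_det]

text \<open>With w the inverse applied to v, the form of the inverse at v is that of A at w. This
  lets a bound on the top eigenvalue of an inverse act as an operator norm bound.\<close>

lemma sym_pos_def_mat_mat_inv:
  assumes A: "A \<in> carrier_mat n n" and pd: "sym_pos_def_mat A"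
  shows "sym_pos_def_mat (mat_inv A)"
proof -
  note inv = sym_pos_def_mat_inv(2-4)[OF A A pd]
  let ?B = "mat_inv A"
  have sym: "transpose_mat A = A" using pd by (simp add: sym_pos_def_mat_def)
  have "A * transpose_mat ?B = 1\<^sub>m n"
    using transpose_mult[OF inv(1) A] inv(3) sym by simp
  moreover have "transpose_mat ?B * A = 1\<^sub>m n"
    using transpose_mult[OF A inv(1)] inv(2) sym by simp
  ultimately have symB: "transpose_mat ?B = ?B" using mat_inv_eq[OF A _ , of "transpose_mat ?B"] inv(1) by simp
  have "0 < v \<bullet> (?B *\<^sub>v v)" if v: "v \<in> carrier_vec n" "v \<noteq> 0\<^sub>v n" for v
  proof -
    define w where "w = ?B *\<^sub>v v"
    have w: "w \<in> carrier_vec n" using inv(1) v by (simp add: w_def)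
    have Aw: "A *\<^sub>v w = v" unfolding w_def using assoc_mult_mat_vec[OF A inv(1) v(1)] inv(2) v by simp
    have "w \<noteq> 0\<^sub>v n" using Aw v A by auto
    then have "0 < w \<bullet> (A *\<^sub>v w)" using pd A w by (auto simp: sym_pos_def_mat_def)
    also have "\<dots> = v \<bullet> w" unfolding Aw using v w comm_scalar_prod by blast
    finally show ?thesis by (simp add: w_def)
  qed
  then show ?thesis unfolding sym_pos_def_mat_def using inv(1) symB by auto
qed

section \<open>Stationarity conditions of the elastic net\<close>

text \<open>R^p is modelled by functions on all naturals with the product topology. Freezing the
  coordinates from p on at 0 gives a box that is compact by Tychonoff, and \<open>restr\<close>
  moves any competitor to such a function without changing f.\<close>

lemma exists_minimum_coercive:
  fixes f :: "(nat \<Rightarrow> real) \<Rightarrow> real"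
  assumes cont: "continuous_on UNIV f" and e: "0 < e"
    and coercive: "\<And>b. e * (\<Sum>i<p. (b i)\<^sup>2) \<le> f b"
    and restr: "\<And>b. f (\<lambda>i. if i < p then b i else 0) = f b"
  obtains b where "\<And>c. f b \<le> f c"
proof -
  \<comment> \<open>Coercivity puts every point with value at most f(0) into the box of half-width
    R.\<close>
  define R where "R = sqrt (f (\<lambda>_. 0) / e)"
  have f0: "0 \<le> f (\<lambda>_. 0)" using coercive[of "\<lambda>_. 0"] by simp
  define K where "K = PiE UNIV (\<lambda>i. if i < p then {- R..R} else {0::real})"
  have "compactin (product_topology (\<lambda>_. euclidean) UNIV) K"
    unfolding K_def compactin_PiE by auto
  then have K: "compact K" by (simp add: euclidean_product_topology)
  have "0 \<le> R" using f0 e by (simp add: R_def)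
  then have zero: "(\<lambda>_. 0) \<in> K" by (auto simp: K_def)
  obtain b where b: "b \<in> K" "\<And>c. c \<in> K \<Longrightarrow> f b \<le> f c"
    using continuous_attains_inf[OF K _ continuous_on_subset[OF cont]] zero by blast
  have "f b \<le> f c" for c
  proof (cases "f c \<le> f (\<lambda>_. 0)")
    case True
    have "\<bar>c i\<bar> \<le> R" if "i < p" for i
    proof -
      have "e * (c i)\<^sup>2 \<le> e * (\<Sum>i<p. (c i)\<^sup>2)"
        using e that by (intro mult_left_mono member_le_sum) auto
      also have "\<dots> \<le> f (\<lambda>_. 0)" using coercive[of c] True by simp
      finally have "(c i)\<^sup>2 \<le> f (\<lambda>_. 0) / e" using e by (simp add: field_simps)
      then show ?thesis unfolding R_def by (metis real_sqrt_abs real_sqrt_le_mono)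
    qed
    then have "(\<lambda>i. if i < p then c i else 0) \<in> K" by (auto simp: K_def abs_le_iff minus_le_iff)
    then show ?thesis using b(2) restr[of c] by metis
  next
    case False
    then show ?thesis using b(2)[OF zero] by simp
  qed
  then show ?thesis using that by blast
qed

text \<open>The quadratic term is of smaller order near 0, so a negative slope would make the
  expression negative for small t.\<close>

lemma nonneg_slope:
  fixes c K e :: real
  assumes "0 < e" "\<And>t. 0 < t \<Longrightarrow> t < e \<Longrightarrow> 0 \<le> t * c + t\<^sup>2 * K"
  shows "0 \<le> c"
proof (rule ccontr)
  assume "\<not> 0 \<le> c"
  \<comment> \<open>Chosen so that t |K| is at most -c / 2; the summand 1 keeps the denominator
    positive when K = 0.\<close>
  define t where "t = min (e / 2) (- c / (2 * (\<bar>K\<bar> + 1)))"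
  have t: "0 < t" "t < e" using \<open>0 < e\<close> \<open>\<not> 0 \<le> c\<close> by (auto simp: t_def field_simps)
  have "t * \<bar>K\<bar> \<le> - c / (2 * (\<bar>K\<bar> + 1)) * (\<bar>K\<bar> + 1)"
    using t(1) \<open>\<not> 0 \<le> c\<close> by (intro mult_mono) (auto simp: t_def)
  also have "\<dots> = - c / 2" by (simp add: field_simps)
  finally have "c + t * \<bar>K\<bar> < 0" using \<open>\<not> 0 \<le> c\<close> by simp
  moreover have "c + t * K \<le> c + t * \<bar>K\<bar>" using t by (intro add_left_mono mult_left_mono) auto
  ultimately have "c + t * K < 0" by linarith
  with t have "t * (c + t * K) < 0" by (intro mult_pos_neg)
  then show False using assms(2)[OF t] by (simp add: algebra_simps power2_eq_square)
qed

text \<open>Away from the kink, |b + t| is linear for |t| < |b|, so the slopes in both directions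
  are nonnegative and cancel. At b = 0 the two one-sided slopes are 2g + l and -2g + l, which gives
  the interval.\<close>

lemma abs_perturbation_stationary:
  fixes b g l K :: real
  assumes min: "\<And>t. 0 \<le> 2 * t * g + t\<^sup>2 * K + l * (\<bar>b + t\<bar> - \<bar>b\<bar>)" and l: "0 < l"
  shows "(b \<noteq> 0 \<longrightarrow> 2 * g + l * sgn b = 0) \<and> \<bar>2 * g\<bar> \<le> l"
proof (cases "b = 0")
  case True
  have "0 \<le> 2 * g + l"
  proof (rule nonneg_slope[of 1 _ K])
    fix t :: real assume "0 < t"
    then show "0 \<le> t * (2 * g + l) + t\<^sup>2 * K" using min[of t] True by (simp add: algebra_simps)
  qed simp
  moreover have "0 \<le> - 2 * g + l"
  proof (rule nonneg_slope[of 1 _ K])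
    fix t :: real assume "0 < t"
    then show "0 \<le> t * (- 2 * g + l) + t\<^sup>2 * K" using min[of "- t"] True by (simp add: algebra_simps)
  qed simp
  ultimately show ?thesis using True by auto
next
  case False
  have "0 \<le> 2 * g + l * sgn b"
  proof (rule nonneg_slope[of "\<bar>b\<bar>" _ K])
    fix t :: real assume "0 < t" "t < \<bar>b\<bar>"
    then have "\<bar>b + t\<bar> - \<bar>b\<bar> = t * sgn b" by (auto simp: sgn_if)
    then show "0 \<le> t * (2 * g + l * sgn b) + t\<^sup>2 * K" using min[of t] by (simp add: algebra_simps)
  qed (use False in simp)
  moreover have "0 \<le> - (2 * g + l * sgn b)"
  proof (rule nonneg_slope[of "\<bar>b\<bar>" _ K])
    fix t :: real assume "0 < t" "t < \<bar>b\<bar>"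
    then have eq: "\<bar>b + (- t)\<bar> - \<bar>b\<bar> = - (t * sgn b)" by (auto simp: sgn_if)
    show "0 \<le> t * - (2 * g + l * sgn b) + t\<^sup>2 * K"
      using min[of "- t", unfolded eq] by (simp add: algebra_simps)
  qed (use False in simp)
  ultimately have "2 * g + l * sgn b = 0" by simp
  then have "2 * g = - (l * sgn b)" by simp
  then show ?thesis using l by (simp add: abs_mult abs_sgn_eq)
qed

section \<open>The elastic net objective and its optimality conditions\<close>

definition elastic_net_obj ::
  "nat \<Rightarrow> nat \<Rightarrow> (nat \<Rightarrow> nat \<Rightarrow> real) \<Rightarrow> (nat \<Rightarrow> real) \<Rightarrow> (nat \<Rightarrow> nat \<Rightarrow> real) \<Rightarrow> real \<Rightarrow> real \<Rightarrow> (nat \<Rightarrow> real) \<Rightarrow> real"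
  where "elastic_net_obj n p x y s l e b = (\<Sum>k<n. (y k - (\<Sum>j<p. x k j * b j))\<^sup>2)
    + l * (\<Sum>j<p. \<bar>b j\<bar>) + e * (\<Sum>i<p. b i * (\<Sum>j<p. s i j * b j))"

text \<open>Half the derivative of the smooth part of the objective.\<close>

definition elastic_net_grad ::
  "nat \<Rightarrow> nat \<Rightarrow> (nat \<Rightarrow> nat \<Rightarrow> real) \<Rightarrow> (nat \<Rightarrow> real) \<Rightarrow> (nat \<Rightarrow> nat \<Rightarrow> real) \<Rightarrow> real \<Rightarrow> (nat \<Rightarrow> real) \<Rightarrow> nat \<Rightarrow> real"
  where "elastic_net_grad n p x y s e b j =
    e * (\<Sum>i<p. s j i * b i) - (\<Sum>k<n. x k j * (y k - (\<Sum>i<p. x k i * b i)))"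

text \<open>The subgradient of l|b_j| is the point l sgn(b_j) on the support and the interval from
  -l to l at zero. The interval bound is imposed for all j because, for positive l, the equation on
  the support satisfies it with equality.\<close>

definition elastic_net_stationary ::
  "nat \<Rightarrow> nat \<Rightarrow> (nat \<Rightarrow> nat \<Rightarrow> real) \<Rightarrow> (nat \<Rightarrow> real) \<Rightarrow> (nat \<Rightarrow> nat \<Rightarrow> real) \<Rightarrow> real \<Rightarrow> real \<Rightarrow> (nat \<Rightarrow> real) \<Rightarrow> bool"
  where "elastic_net_stationary n p x y s l e b \<longleftrightarrow> (\<forall>j<p.
    (b j \<noteq> 0 \<longrightarrow> 2 * elastic_net_grad n p x y s e b j + l * sgn (b j) = 0) \<and>
    \<bar>2 * elastic_net_grad n p x y s e b j\<bar> \<le> l)"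

text \<open>The smooth part is quadratic, so its second-order expansion is exact. It serves both
  directions of the optimality criterion: arbitrary h for sufficiency, a multiple of one basis
  vector for necessity.\<close>

lemma elastic_net_obj_add:
  assumes sym: "\<And>i j. i < p \<Longrightarrow> j < p \<Longrightarrow> s i j = s j i"
  shows "elastic_net_obj n p x y s l e (\<lambda>j. b j + h j) = elastic_net_obj n p x y s l e b
    + (\<Sum>j<p. 2 * h j * elastic_net_grad n p x y s e b j + l * (\<bar>b j + h j\<bar> - \<bar>b j\<bar>))
    + (\<Sum>k<n. (\<Sum>j<p. x k j * h j)\<^sup>2) + e * (\<Sum>i<p. h i * (\<Sum>j<p. s i j * h j))"
proof -
  define r where "r k = y k - (\<Sum>j<p. x k j * b j)" for k
  define d where "d k = (\<Sum>j<p. x k j * h j)" for k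
  have "(y k - (\<Sum>j<p. x k j * (b j + h j)))\<^sup>2 = (r k)\<^sup>2 - 2 * (d k * r k) + (d k)\<^sup>2" for k
    by (simp add: r_def d_def algebra_simps sum.distrib power2_eq_square)
  then have 1: "(\<Sum>k<n. (y k - (\<Sum>j<p. x k j * (b j + h j)))\<^sup>2)
      = (\<Sum>k<n. (r k)\<^sup>2) - 2 * (\<Sum>k<n. d k * r k) + (\<Sum>k<n. (d k)\<^sup>2)"
    by (simp add: sum.distrib sum_subtractf sum_distrib_left)
  have "(\<Sum>k<n. d k * r k) = (\<Sum>k<n. \<Sum>j<p. h j * (x k j * r k))"
    by (simp add: d_def sum_distrib_left sum_distrib_right mult_ac)
  also have "\<dots> = (\<Sum>j<p. \<Sum>k<n. h j * (x k j * r k))" by (rule sum.swap)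
  finally have 2: "(\<Sum>k<n. d k * r k) = (\<Sum>j<p. h j * (\<Sum>k<n. x k j * r k))"
    by (simp add: sum_distrib_left)
  have "(\<Sum>i<p. b i * (\<Sum>j<p. s i j * h j)) = (\<Sum>i<p. \<Sum>j<p. b i * (s i j * h j))"
    by (simp add: sum_distrib_left)
  also have "\<dots> = (\<Sum>j<p. \<Sum>i<p. b i * (s i j * h j))" by (rule sum.swap)
  also have "\<dots> = (\<Sum>j<p. \<Sum>i<p. h j * (s j i * b i))"
    by (intro sum.cong refl) (simp add: sym)
  finally have 3: "(\<Sum>i<p. b i * (\<Sum>j<p. s i j * h j)) = (\<Sum>j<p. h j * (\<Sum>i<p. s j i * b i))"
    by (simp add: sum_distrib_left)
  have "(\<Sum>i<p. (b i + h i) * (\<Sum>j<p. s i j * (b j + h j))) =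
     (\<Sum>i<p. b i * (\<Sum>j<p. s i j * b j)) + (\<Sum>i<p. b i * (\<Sum>j<p. s i j * h j))
     + (\<Sum>i<p. h i * (\<Sum>j<p. s i j * b j)) + (\<Sum>i<p. h i * (\<Sum>j<p. s i j * h j))"
    by (simp add: ring_distribs sum.distrib)
  with 3 have 4: "(\<Sum>i<p. (b i + h i) * (\<Sum>j<p. s i j * (b j + h j))) =
     (\<Sum>i<p. b i * (\<Sum>j<p. s i j * b j)) + 2 * (\<Sum>j<p. h j * (\<Sum>i<p. s j i * b i))
     + (\<Sum>i<p. h i * (\<Sum>j<p. s i j * h j))"
    by simp
  have 5: "(\<Sum>j<p. 2 * h j * elastic_net_grad n p x y s e b j + l * (\<bar>b j + h j\<bar> - \<bar>b j\<bar>))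
    = 2 * e * (\<Sum>j<p. h j * (\<Sum>i<p. s j i * b i)) - 2 * (\<Sum>j<p. h j * (\<Sum>k<n. x k j * r k))
      + l * (\<Sum>j<p. \<bar>b j + h j\<bar>) - l * (\<Sum>j<p. \<bar>b j\<bar>)"
    unfolding elastic_net_grad_def r_def[symmetric]
    by (simp add: sum.distrib sum_subtractf right_diff_distrib sum_distrib_left mult_ac)
  show ?thesis
    unfolding elastic_net_obj_def 5 1 2 4 r_def[symmetric] d_def[symmetric]
    by (simp add: algebra_simps)
qed

text \<open>Stationarity makes each coordinate's linear and l1 contribution nonnegative, and the
  Gram form is nonnegative. Strictness comes from the ridge form alone, so p may exceed n.\<close>

lemma elastic_net_stationary_strict_min:
  assumes sym: "\<And>i j. i < p \<Longrightarrow> j < p \<Longrightarrow> s i j = s j i"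
    and pos: "\<And>v. \<exists>i<p. v i \<noteq> 0 \<Longrightarrow> 0 < (\<Sum>i<p. v i * (\<Sum>j<p. s i j * v j))"
    and l: "0 < l" and e: "0 < e"
    and st: "elastic_net_stationary n p x y s l e b"
    and c: "\<exists>j<p. c j \<noteq> b j"
  shows "elastic_net_obj n p x y s l e b < elastic_net_obj n p x y s l e c"
proof -
  define h where "h j = c j - b j" for j
  let ?g = "elastic_net_grad n p x y s e b"
  have "0 \<le> 2 * h j * ?g j + l * (\<bar>b j + h j\<bar> - \<bar>b j\<bar>)" if "j < p" for j
  proof (cases "b j = 0")
    case True
    have "\<bar>2 * ?g j * h j\<bar> \<le> l * \<bar>h j\<bar>"
      using st that by (simp add: elastic_net_stationary_def abs_mult mult_right_mono)
    then show ?thesis using True by (simp add: abs_le_iff algebra_simps)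
  next
    case False
    then have "2 * ?g j = - (l * sgn (b j))" using st that by (simp add: elastic_net_stationary_def eq_neg_iff_add_eq_0)
    then have "2 * h j * ?g j = - (l * (sgn (b j) * h j))" by (metis mult.assoc mult.commute mult_minus_left)
    \<comment> \<open>The supporting line of the absolute value at \<open>b j\<close>.\<close>
    moreover have "sgn (b j) * h j \<le> \<bar>b j + h j\<bar> - \<bar>b j\<bar>" using False by (auto simp: sgn_if)
    then have "l * (sgn (b j) * h j) \<le> l * (\<bar>b j + h j\<bar> - \<bar>b j\<bar>)" using l by (intro mult_left_mono) auto
    ultimately show ?thesis by simp
  qed
  then have "0 \<le> (\<Sum>j<p. 2 * h j * ?g j + l * (\<bar>b j + h j\<bar> - \<bar>b j\<bar>))" by (intro sum_nonneg) auto
  moreover have "0 \<le> (\<Sum>k<n. (\<Sum>j<p. x k j * h j)\<^sup>2)" by (intro sum_nonneg) auto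
  moreover have "0 < e * (\<Sum>i<p. h i * (\<Sum>j<p. s i j * h j))"
    using e c by (intro mult_pos_pos pos) (auto simp: h_def)
  ultimately have "elastic_net_obj n p x y s l e b < elastic_net_obj n p x y s l e (\<lambda>j. b j + h j)"
    by (subst elastic_net_obj_add[OF sym]) auto
  then show ?thesis by (simp add: h_def)
qed

lemma elastic_net_min_stationary:
  assumes sym: "\<And>i j. i < p \<Longrightarrow> j < p \<Longrightarrow> s i j = s j i"
    and l: "0 < l"
    and min: "\<And>c. elastic_net_obj n p x y s l e b \<le> elastic_net_obj n p x y s l e c"
  shows "elastic_net_stationary n p x y s l e b"
  unfolding elastic_net_stationary_def
proof (intro allI impI)
  fix j assume j: "j < p"
  show "(b j \<noteq> 0 \<longrightarrow> 2 * elastic_net_grad n p x y s e b j + l * sgn (b j) = 0) \<and>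
    \<bar>2 * elastic_net_grad n p x y s e b j\<bar> \<le> l"
  \<comment> \<open>K is the second-order coefficient of the objective along the j-th basis
    vector.\<close>
  proof (rule abs_perturbation_stationary[where K = "(\<Sum>k<n. (x k j)\<^sup>2) + e * s j j"])
    fix t :: real
    define h where "h i = (if i = j then t else 0)" for i
    have pick: "(\<Sum>i<p. f i * h i) = f j * t" for f
      using j by (simp add: h_def if_distrib[of "\<lambda>x. _ * x"] cong: if_cong)
    have pick': "(\<Sum>i<p. h i * f i) = t * f j" for f
      using pick[of f] by (simp add: mult.commute)
    have "(\<Sum>i<p. 2 * h i * elastic_net_grad n p x y s e b i + l * (\<bar>b i + h i\<bar> - \<bar>b i\<bar>))
      = (\<Sum>i<p. if i = j then 2 * t * elastic_net_grad n p x y s e b j + l * (\<bar>b j + t\<bar> - \<bar>b j\<bar>) else 0)"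
      by (intro sum.cong) (auto simp: h_def)
    also have "\<dots> = 2 * t * elastic_net_grad n p x y s e b j + l * (\<bar>b j + t\<bar> - \<bar>b j\<bar>)" using j by simp
    finally have "elastic_net_obj n p x y s l e (\<lambda>j. b j + h j) = elastic_net_obj n p x y s l e b
      + (2 * t * elastic_net_grad n p x y s e b j + l * (\<bar>b j + t\<bar> - \<bar>b j\<bar>))
      + (\<Sum>k<n. (x k j * t)\<^sup>2) + e * (t * (s j j * t))"
      by (subst elastic_net_obj_add[OF sym]) (simp_all add: pick pick')
    then have "0 \<le> 2 * t * elastic_net_grad n p x y s e b j + l * (\<bar>b j + t\<bar> - \<bar>b j\<bar>)
      + (\<Sum>k<n. (x k j * t)\<^sup>2) + e * (t * (s j j * t))"
      using min[of "\<lambda>j. b j + h j"] by linarith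
    then show "0 \<le> 2 * t * elastic_net_grad n p x y s e b j + t\<^sup>2 * ((\<Sum>k<n. (x k j)\<^sup>2) + e * s j j)
        + l * (\<bar>b j + t\<bar> - \<bar>b j\<bar>)"
      by (simp add: power_mult_distrib sum_distrib_left sum_distrib_right algebra_simps power2_eq_square)
  qed (rule l)
qed

section \<open>The generalized elastic net minimizer\<close>

lemma mat_diag_conj_mult:
  fixes U :: "real mat"
  assumes U: "U \<in> carrier_mat n n" and UTU: "transpose_mat U * U = 1\<^sub>m n"
  shows "(U * mat_diag n f * transpose_mat U) * (U * mat_diag n g * transpose_mat U)
    = U * mat_diag n (\<lambda>i. f i * g i) * transpose_mat U"
proof -
  let ?F = "mat_diag n f" and ?G = "mat_diag n g" and ?T = "transpose_mat U"
  have c: "?F \<in> carrier_mat n n" "?G \<in> carrier_mat n n" "?T \<in> carrier_mat n n" using U by auto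
  note [simp] = assoc_mult_mat[of _ n n _ n _ n] mult_carrier_mat[of _ n n _ n]
  have "(U * ?F * ?T) * (U * ?G * ?T) = U * (?F * ((?T * U) * (?G * ?T)))"
    using U c by simp
  also have "\<dots> = U * (?F * ?G * ?T)" unfolding UTU
    using U c left_mult_one_mat[OF mult_carrier_mat[OF c(2,3)]] by (simp del: mat_diag_diag)
  also have "\<dots> = U * (?F * ?G) * ?T" using U c by (simp del: mat_diag_diag)
  finally show ?thesis by simp
qed

lemma mat_diag_cong: "(\<And>i. i < n \<Longrightarrow> f i = g i) \<Longrightarrow> mat_diag n f = mat_diag n g"
  by (auto simp: mat_diag_def intro!: eq_matI)

lemma transpose_mat_diag_conj:
  fixes U :: "real mat"
  assumes U: "U \<in> carrier_mat n n"
  shows "transpose_mat (U * mat_diag n f * transpose_mat U) = U * mat_diag n f * transpose_mat U"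
proof -
  have D: "transpose_mat (mat_diag n f) = mat_diag n f" by (auto simp: mat_diag_def intro!: eq_matI)
  have UT: "transpose_mat U \<in> carrier_mat n n" using U by simp
  have Dc: "mat_diag n f \<in> carrier_mat n n" by simp
  show ?thesis
    using transpose_mult[OF mult_carrier_mat[OF U Dc] UT] transpose_mult[OF U Dc] D
      assoc_mult_mat[OF U Dc UT] by simp
qed

text \<open>T is the square root U D^(1/2) U' for the decomposition that \<open>SOME\<close> picks;
  the spectral theorem guarantees that there is one to pick. Later arguments rely only on T
  inverting \<open>inv_sqrt_mat S\<close> and on T'T = S, so they hold for every choice.\<close>

lemma inv_sqrt_mat_factor:
  assumes S: "S \<in> carrier_mat n n" and pd: "sym_pos_def_mat S"
  obtains T where "T \<in> carrier_mat n n" "inv_sqrt_mat S \<in> carrier_mat n n"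
    "inv_sqrt_mat S * T = 1\<^sub>m n" "T * inv_sqrt_mat S = 1\<^sub>m n" "transpose_mat T * T = S"
proof -
  let ?P = "\<lambda>(U, D). U \<in> carrier_mat n n \<and> D \<in> carrier_mat n n \<and>
    transpose_mat U * U = 1\<^sub>m n \<and> U * transpose_mat U = 1\<^sub>m n \<and>
    diagonal_mat D \<and> S = U * D * transpose_mat U"
  have sym: "transpose_mat S = S" using pd by (simp add: sym_pos_def_mat_def)
  obtain U' d' where "U' \<in> carrier_mat n n" "transpose_mat U' * U' = 1\<^sub>m n" "U' * transpose_mat U' = 1\<^sub>m n"
    "S = U' * mat_diag n d' * transpose_mat U'"
    using spectral_decomposition[OF S sym] by blast
  then have ex: "?P (U', mat_diag n d')" by (auto simp: diagonal_mat_def mat_diag_def)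
  obtain U D where UD: "(SOME UD. ?P UD) = (U, D)" by (cases "SOME UD. ?P UD")
  have U: "U \<in> carrier_mat n n" "D \<in> carrier_mat n n" "transpose_mat U * U = 1\<^sub>m n"
    "U * transpose_mat U = 1\<^sub>m n" "diagonal_mat D" "S = U * D * transpose_mat U"
    using someI[of ?P, OF ex] unfolding UD by auto
  define d where "d i = D $$ (i, i)" for i
  have D: "D = mat_diag n d"
    using U(2,5) by (auto intro!: eq_matI simp: mat_diag_def diagonal_mat_def d_def)
  have UT: "transpose_mat U \<in> carrier_mat n n" using U by simp
  \<comment> \<open>Column i of U is a unit eigenvector for \<open>d i\<close>, so the form of S
    there equals \<open>d i\<close>. Positivity makes the square roots and their reciprocals
    genuine.\<close>
  have d_pos: "0 < d i" if i: "i < n" for i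
  proof -
    let ?v = "col U i"
    have v: "?v \<in> carrier_vec n" using U(1) i by simp
    have vv: "?v \<bullet> ?v = 1"
      using U(1) i arg_cong[OF U(3), of "\<lambda>M. M $$ (i, i)"] by simp
    have "S * U = U * D * (transpose_mat U * U)"
      unfolding U(6) by (rule assoc_mult_mat[OF mult_carrier_mat[OF U(1,2)] UT U(1)])
    then have "S * U = U * D" using U by simp
    moreover have "col (S * U) i = S *\<^sub>v ?v" using S U(1) i by (rule col_mult2)
    moreover have "col (U * D) i = d i \<cdot>\<^sub>v ?v"
      unfolding D mat_diag_mult_right[OF U(1)] using U(1) i by (auto intro!: eq_vecI)
    ultimately have Sv: "S *\<^sub>v ?v = d i \<cdot>\<^sub>v ?v" by simp
    have "?v \<noteq> 0\<^sub>v n" using vv by auto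
    then have "0 < ?v \<bullet> (S *\<^sub>v ?v)" using pd S v by (auto simp: sym_pos_def_mat_def)
    then show ?thesis unfolding Sv using vv v by simp
  qed
  define T where "T = U * mat_diag n (\<lambda>i. sqrt (d i)) * transpose_mat U"
  have R: "inv_sqrt_mat S = U * mat_diag n (\<lambda>i. 1 / sqrt (d i)) * transpose_mat U"
    using S unfolding inv_sqrt_mat_def by (simp add: UD Let_def d_def)
  have one: "U * mat_diag n (\<lambda>i. 1) * transpose_mat U = 1\<^sub>m n"
    unfolding mat_diag_one using U by simp
  show ?thesis
  proof
    show "T \<in> carrier_mat n n" unfolding T_def using U UT by auto
    show "inv_sqrt_mat S \<in> carrier_mat n n" unfolding R using U UT by auto
    have "mat_diag n (\<lambda>i. 1 / sqrt (d i) * sqrt (d i)) = mat_diag n (\<lambda>i. 1)"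
      by (rule mat_diag_cong) (use d_pos in fastforce)
    then show "inv_sqrt_mat S * T = 1\<^sub>m n"
      unfolding R T_def mat_diag_conj_mult[OF U(1,3)] using one by simp
    have "mat_diag n (\<lambda>i. sqrt (d i) * (1 / sqrt (d i))) = mat_diag n (\<lambda>i. 1)"
      by (rule mat_diag_cong) (use d_pos in fastforce)
    then show "T * inv_sqrt_mat S = 1\<^sub>m n"
      unfolding R T_def mat_diag_conj_mult[OF U(1,3)] using one by simp
    have "mat_diag n (\<lambda>i. sqrt (d i) * sqrt (d i)) = D"
      unfolding D by (rule mat_diag_cong) (use d_pos in \<open>simp add: less_imp_le\<close>)
    then show "transpose_mat T * T = S"
      unfolding T_def transpose_mat_diag_conj[OF U(1)] mat_diag_conj_mult[OF U(1,3)] using U by simp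
  qed
qed

lemma elastic_net_obj_cong:
  assumes "\<And>j. j < p \<Longrightarrow> b j = c j"
  shows "elastic_net_obj n p x y s l e b = elastic_net_obj n p x y s l e c"
  unfolding elastic_net_obj_def using assms by (simp cong: sum.cong_simp)

lemma elastic_net_stationary_cong:
  assumes "\<And>j. j < p \<Longrightarrow> b j = c j"
  shows "elastic_net_stationary n p x y s l e b = elastic_net_stationary n p x y s l e c"
  unfolding elastic_net_stationary_def elastic_net_grad_def using assms by (simp cong: sum.cong_simp)

text \<open>Existence is obtained in the transformed variable, where the ridge term gives
  coercivity; stationarity and uniqueness in the original one, where the l1 term is coordinatewise.
  The bijection by \<open>inv_sqrt_mat S\<close> carries results across and resolves the
  \<open>THE\<close> in \<open>gEN\<close>. The last conclusion identifies the estimator by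
  exhibiting a stationary point.\<close>

lemma gEN_stationary:
  assumes X: "X \<in> carrier_mat n p" and y: "y \<in> carrier_vec n"
    and S: "S \<in> carrier_mat p p" and pd: "sym_pos_def_mat S" and l: "0 < l" and e: "0 < e"
  defines "st \<equiv> elastic_net_stationary n p (\<lambda>k j. X $$ (k, j)) (\<lambda>k. y $ k) (\<lambda>i j. S $$ (i, j)) l e"
  shows "gEN X y S l e \<in> carrier_vec p" "st (\<lambda>j. gEN X y S l e $ j)"
    "b \<in> carrier_vec p \<Longrightarrow> st (\<lambda>j. b $ j) \<Longrightarrow> gEN X y S l e = b"
proof -
  define F where "F = elastic_net_obj n p (\<lambda>k j. X $$ (k, j)) (\<lambda>k. y $ k) (\<lambda>i j. S $$ (i, j)) l e"
  let ?R = "inv_sqrt_mat S"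
  obtain T where T: "T \<in> carrier_mat p p" and R: "?R \<in> carrier_mat p p"
    and RT: "?R * T = 1\<^sub>m p" and TR: "T * ?R = 1\<^sub>m p" and TT: "transpose_mat T * T = S"
    by (rule inv_sqrt_mat_factor[OF S pd])
  note spd = sym_pos_def_mat_iff[OF S, THEN iffD1, OF pd]
  have sym: "S $$ (i, j) = S $$ (j, i)" if "i < p" "j < p" for i j using spd that by blast
  have pos: "0 < (\<Sum>i<p. v i * (\<Sum>j<p. S $$ (i, j) * v j))" if "\<exists>i<p. v i \<noteq> 0" for v
    by (rule mp[OF spec[OF conjunct2[OF spd], of v] that])
  have TRb: "T *\<^sub>v (?R *\<^sub>v b) = b" if "b \<in> carrier_vec p" for b
    using assoc_mult_mat_vec[OF T R that] TR that by simp
  have RTb: "?R *\<^sub>v (T *\<^sub>v b) = b" if "b \<in> carrier_vec p" for b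
    using assoc_mult_mat_vec[OF R T that] RT that by simp
  have obj: "gEN_obj X y S l e b = F (\<lambda>j. (?R *\<^sub>v b) $ j)" if b: "b \<in> carrier_vec p" for b
  proof -
    define c where "c = ?R *\<^sub>v b"
    have c: "c \<in> carrier_vec p" using R b by (simp add: c_def)
    have "(X * ?R) *\<^sub>v b = X *\<^sub>v c" unfolding c_def by (rule assoc_mult_mat_vec[OF X R b])
    then have 1: "sq_norm_v (y - (X * ?R) *\<^sub>v b) = (\<Sum>k<n. (y $ k - (\<Sum>j<p. X $$ (k, j) * c $ j))\<^sup>2)"
      using X y unfolding sq_norm_v_def
      by (auto simp: index_mult_mat_vec_sum[OF X c] simp del: index_mult_mat_vec intro!: sum.cong)
    \<comment> \<open>The ridge term: |b|^2 = |Tc|^2 = c'T'Tc = c'Sc.\<close>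
    have bT: "b = T *\<^sub>v c" using TRb[OF b] by (simp add: c_def)
    have "sq_norm_v b = b \<bullet> b" using b by (simp add: sq_norm_v_def scalar_prod_sum power2_eq_square)
    also have "\<dots> = (\<Sum>i<p. (\<Sum>j<p. T $$ (i, j) * c $ j) * b $ i)"
      using b T c by (subst bT, subst scalar_prod_sum[OF b])
        (auto simp: index_mult_mat_vec_sum[OF T c] simp del: index_mult_mat_vec)
    also have "\<dots> = (\<Sum>i<p. \<Sum>j<p. c $ j * (T $$ (i, j) * b $ i))"
      by (simp add: sum_distrib_left sum_distrib_right mult_ac)
    also have "\<dots> = (\<Sum>j<p. \<Sum>i<p. c $ j * (T $$ (i, j) * b $ i))" by (rule sum.swap)
    also have "\<dots> = (\<Sum>j<p. c $ j * (transpose_mat T *\<^sub>v b) $ j)"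
    proof (intro sum.cong refl)
      fix j assume "j \<in> {..<p}"
      then have j: "j < p" by simp
      have TTc: "transpose_mat T \<in> carrier_mat p p" using T by simp
      show "(\<Sum>i<p. c $ j * (T $$ (i, j) * b $ i)) = c $ j * (transpose_mat T *\<^sub>v b) $ j"
        unfolding index_mult_mat_vec_sum[OF TTc b j] using T j by (auto simp: sum_distrib_left intro!: sum.cong)
    qed
    also have "transpose_mat T *\<^sub>v b = S *\<^sub>v c"
      unfolding bT TT[symmetric] using T c by (intro assoc_mult_mat_vec[symmetric]) auto
    finally have 2: "sq_norm_v b = (\<Sum>i<p. c $ i * (\<Sum>j<p. S $$ (i, j) * c $ j))"
      by (simp add: index_mult_mat_vec_sum[OF S c] del: index_mult_mat_vec)
    show ?thesis
      unfolding gEN_obj_def 1 2 F_def elastic_net_obj_def c_def[symmetric] l1_norm_v_def using c by simp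
  qed
  define f where "f c = F (\<lambda>j. \<Sum>i<p. ?R $$ (j, i) * c i)" for c
  have f: "f c = gEN_obj X y S l e (vec p c)" for c
    unfolding f_def obj[OF vec_carrier] F_def
    by (intro elastic_net_obj_cong) (simp add: index_mult_mat_vec_sum[OF R vec_carrier] del: index_mult_mat_vec)
  obtain c0 where c0: "\<And>c. f c0 \<le> f c"
  proof (rule exists_minimum_coercive[of f e p])
    show "continuous_on UNIV f"
      unfolding f_def F_def elastic_net_obj_def
      by (intro continuous_intros continuous_on_product_coordinates)
    fix b
    have "0 \<le> sq_norm_v v" "0 \<le> l1_norm_v v" for v
      by (auto simp: sq_norm_v_def l1_norm_v_def intro!: sum_nonneg)
    then have "e * sq_norm_v (vec p b) \<le> f b" unfolding f gEN_obj_def using l by simp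
    then show "e * (\<Sum>i<p. (b i)\<^sup>2) \<le> f b" by (simp add: sq_norm_v_def)
    show "f (\<lambda>i. if i < p then b i else 0) = f b"
      unfolding f_def by (simp cong: sum.cong_simp)
  qed (use e in auto)
  define bt where "bt = vec p c0"
  have bt: "bt \<in> carrier_vec p" by (simp add: bt_def)
  have min: "gEN_obj X y S l e bt \<le> gEN_obj X y S l e b" if "b \<in> carrier_vec p" for b
    using c0[of "\<lambda>j. b $ j"] that unfolding f bt_def by (metis carrier_vecD eq_vecI index_vec dim_vec)
  have Rc: "?R *\<^sub>v b \<in> carrier_vec p" if "b \<in> carrier_vec p" for b using R that by simp
  have Fmin: "F (\<lambda>j. (?R *\<^sub>v bt) $ j) \<le> F c" for c
  proof -
    let ?b = "T *\<^sub>v vec p c"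
    have b: "?b \<in> carrier_vec p" using T by simp
    have "F (\<lambda>j. (?R *\<^sub>v bt) $ j) \<le> F (\<lambda>j. (?R *\<^sub>v ?b) $ j)"
      using min[OF b] by (simp add: obj[OF bt] obj[OF b])
    also have "\<dots> = F c" unfolding RTb[OF vec_carrier] F_def by (rule elastic_net_obj_cong) simp
    finally show ?thesis .
  qed
  have st: "st (\<lambda>j. (?R *\<^sub>v bt) $ j)"
    unfolding st_def by (rule elastic_net_min_stationary[OF sym l Fmin[unfolded F_def]])
  have strict: "F (\<lambda>j. (?R *\<^sub>v bt) $ j) < F c" if "\<exists>j<p. c j \<noteq> (?R *\<^sub>v bt) $ j" for c
    unfolding F_def
    by (rule elastic_net_stationary_strict_min[OF sym pos l e st[unfolded st_def] that])
  have uniq: "b = bt" if b: "b \<in> carrier_vec p"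
    and bmin: "\<forall>c\<in>carrier_vec p. gEN_obj X y S l e b \<le> gEN_obj X y S l e c" for b
  proof (rule ccontr)
    assume ne: "b \<noteq> bt"
    \<comment> \<open>The change of variables is injective, so two minimizers would give distinct
      points in the original variable, against strictness.\<close>
    have "?R *\<^sub>v b \<noteq> ?R *\<^sub>v bt" using ne TRb[OF b] TRb[OF bt] by metis
    then have "\<exists>j<p. (?R *\<^sub>v b) $ j \<noteq> (?R *\<^sub>v bt) $ j"
      using Rc[OF b] Rc[OF bt] by (metis eq_vecI carrier_vecD)
    then have "F (\<lambda>j. (?R *\<^sub>v bt) $ j) < F (\<lambda>j. (?R *\<^sub>v b) $ j)" by (rule strict)
    moreover have "gEN_obj X y S l e b \<le> gEN_obj X y S l e bt" using bmin bt by blast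
    ultimately show False by (simp add: obj[OF bt] obj[OF b])
  qed
  have "(THE bt. bt \<in> carrier_vec (dim_col X) \<and>
        (\<forall>b \<in> carrier_vec (dim_col X). gEN_obj X y S l e bt \<le> gEN_obj X y S l e b)) = bt"
    unfolding carrier_matD(2)[OF X]
  proof (rule the_equality)
    show "bt \<in> carrier_vec p \<and> (\<forall>b\<in>carrier_vec p. gEN_obj X y S l e bt \<le> gEN_obj X y S l e b)"
      using bt min by simp
    fix b assume "b \<in> carrier_vec p \<and> (\<forall>c\<in>carrier_vec p. gEN_obj X y S l e b \<le> gEN_obj X y S l e c)"
    then show "b = bt" using uniq[of b] by (elim conjE)
  qed
  then have gEN: "gEN X y S l e = ?R *\<^sub>v bt" by (simp add: gEN_def)
  show "gEN X y S l e \<in> carrier_vec p" "st (\<lambda>j. gEN X y S l e $ j)"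
    unfolding gEN by (fact Rc[OF bt] st)+
  assume b: "b \<in> carrier_vec p" and stb: "st (\<lambda>j. b $ j)"
  show "gEN X y S l e = b"
  proof (rule ccontr)
    assume "gEN X y S l e \<noteq> b"
    then have ex: "\<exists>j<p. (?R *\<^sub>v bt) $ j \<noteq> b $ j"
      unfolding gEN using Rc[OF bt] b by (metis eq_vecI carrier_vecD)
    have "F (\<lambda>j. b $ j) < F (\<lambda>j. (?R *\<^sub>v bt) $ j)"
      unfolding F_def
      by (rule elastic_net_stationary_strict_min[OF sym pos l e stb[unfolded st_def] ex])
    with Fmin[of "\<lambda>j. b $ j"] show False by simp
  qed
qed

section \<open>Sign recovery as an explicit event\<close>

lemma dim_sub_mat [simp]: "dim_row (sub_mat A r c nr nc) = nr" "dim_col (sub_mat A r c nr nc) = nc"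
  by (simp_all add: sub_mat_def)

lemma index_sub_mat [simp]:
  "i < nr \<Longrightarrow> j < nc \<Longrightarrow> sub_mat A r c nr nc $$ (i, j) = A $$ (r + i, c + j)"
  by (simp add: sub_mat_def)

lemma index_Cn:
  assumes "X \<in> carrier_mat n p" "i < p" "j < p"
  shows "Cn X $$ (i, j) = (1 / real n) * (\<Sum>k<n. X $$ (k, i) * X $$ (k, j))"
  using assms by (auto simp: Cn_def scalar_prod_def lessThan_atLeast0)

lemma calC11_carrier: "calC11 X S q e \<in> carrier_mat q q"
  by (rule carrier_matI) (simp_all add: calC11_def blk11_def)

lemma calC21_carrier: "X \<in> carrier_mat n p \<Longrightarrow> S \<in> carrier_mat p p \<Longrightarrow> calC21 X S q e \<in> carrier_mat (p - q) q"
  by (rule carrier_matI) (simp_all add: calC21_def blk21_def)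

lemma index_calC11:
  assumes "X \<in> carrier_mat n p" "S \<in> carrier_mat p p" "q \<le> p" "i < q" "j < q"
  shows "calC11 X S q e $$ (i, j) =
    (1 / real n) * (\<Sum>k<n. X $$ (k, i) * X $$ (k, j)) + e / real n * S $$ (i, j)"
  using assms by (simp add: calC11_def blk11_def index_Cn)

lemma index_calC21:
  assumes "X \<in> carrier_mat n p" "S \<in> carrier_mat p p" "q \<le> p" "i < p - q" "j < q"
  shows "calC21 X S q e $$ (i, j) =
    (1 / real n) * (\<Sum>k<n. X $$ (k, q + i) * X $$ (k, j)) + e / real n * S $$ (q + i, j)"
proof -
  have "Cn X \<in> carrier_mat p p" using assms by (auto simp: Cn_def)
  then show ?thesis using assms by (simp add: calC21_def blk21_def index_Cn)
qed

text \<open>Extending a vector by zeros turns the form of the block into the form of S.\<close>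

lemma sym_pos_def_blk11:
  assumes S: "S \<in> carrier_mat p p" and pd: "sym_pos_def_mat S" and q: "q \<le> p"
  shows "sym_pos_def_mat (blk11 S q)"
proof -
  have c: "blk11 S q \<in> carrier_mat q q" by (rule carrier_matI) (simp_all add: blk11_def)
  have ext: "(\<Sum>i<p. if i < q then f i else (0::real)) = (\<Sum>i<q. f i)" for f
    using q by (intro sum.mono_neutral_cong_right) auto
  have "0 < (\<Sum>i<q. v i * (\<Sum>j<q. S $$ (i, j) * v j))" if "\<exists>i<q. v i \<noteq> 0" for v
  proof -
    let ?v = "\<lambda>i. if i < q then v i else 0"
    have ex: "\<exists>i<p. ?v i \<noteq> 0" using that q by auto
    have "0 < (\<Sum>i<p. ?v i * (\<Sum>j<p. S $$ (i, j) * ?v j))"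
      by (rule mp[OF spec[OF conjunct2[OF iffD1[OF sym_pos_def_mat_iff[OF S] pd]], of ?v] ex])
    also have "\<dots> = (\<Sum>i<p. if i < q then v i * (\<Sum>j<q. S $$ (i, j) * v j) else 0)"
      by (intro sum.cong) (auto simp: ext if_distrib[of "\<lambda>x. _ * x"] cong: if_cong)
    finally show ?thesis unfolding ext .
  qed
  moreover have "S $$ (i, j) = S $$ (j, i)" if "i < q" "j < q" for i j
    using iffD1[OF sym_pos_def_mat_iff[OF S] pd] that q by simp
  ultimately show ?thesis unfolding sym_pos_def_mat_iff[OF c] by (simp add: blk11_def cong: sum.cong_simp)
qed

text \<open>The Gram part contributes a sum of squares, possibly zero; the ridge part makes the form
  strictly positive. Hence the inverse exists for every design and not merely almost surely.\<close>

lemma sym_pos_def_calC11: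
  assumes X: "X \<in> carrier_mat n p" and S: "S \<in> carrier_mat p p" and pd: "sym_pos_def_mat S"
    and q: "q \<le> p" and n: "0 < n" and e: "0 < e"
  shows "sym_pos_def_mat (calC11 X S q e)"
  unfolding sym_pos_def_mat_iff[OF calC11_carrier]
proof (intro conjI allI impI)
  have c: "blk11 S q \<in> carrier_mat q q" by (rule carrier_matI) (simp_all add: blk11_def)
  note B = iffD1[OF sym_pos_def_mat_iff[OF c] sym_pos_def_blk11[OF S pd q]]
  have sym: "S $$ (i, j) = S $$ (j, i)" if "i < q" "j < q" for i j
    using iffD1[OF sym_pos_def_mat_iff[OF S] pd] that q by simp
  show "calC11 X S q e $$ (i, j) = calC11 X S q e $$ (j, i)" if "i < q" "j < q" for i j
    using that sym by (simp add: index_calC11[OF X S q] mult.commute)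
  fix v :: "nat \<Rightarrow> real" assume v: "\<exists>i<q. v i \<noteq> 0"
  have "0 < (\<Sum>i<q. v i * (\<Sum>j<q. blk11 S q $$ (i, j) * v j))"
    by (rule mp[OF spec[OF conjunct2[OF B], of v] v])
  then have pos: "0 < (\<Sum>i<q. v i * (\<Sum>j<q. S $$ (i, j) * v j))"
    by (simp add: blk11_def cong: sum.cong_simp)
  have "(\<Sum>i<q. v i * (\<Sum>j<q. \<Sum>k<n. X $$ (k, i) * X $$ (k, j) * v j))
    = (\<Sum>i<q. \<Sum>j<q. \<Sum>k<n. X $$ (k, i) * v i * (X $$ (k, j) * v j))"
    by (simp add: sum_distrib_left mult_ac)
  also have "\<dots> = (\<Sum>i<q. \<Sum>k<n. \<Sum>j<q. X $$ (k, i) * v i * (X $$ (k, j) * v j))"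
    by (intro sum.cong refl sum.swap)
  also have "\<dots> = (\<Sum>k<n. \<Sum>i<q. \<Sum>j<q. X $$ (k, i) * v i * (X $$ (k, j) * v j))" by (rule sum.swap)
  also have "\<dots> = (\<Sum>k<n. (\<Sum>i<q. X $$ (k, i) * v i)\<^sup>2)"
    by (simp add: power2_eq_square sum_product)
  finally have gram: "(\<Sum>i<q. v i * (\<Sum>j<q. \<Sum>k<n. X $$ (k, i) * X $$ (k, j) * v j))
    = (\<Sum>k<n. (\<Sum>i<q. X $$ (k, i) * v i)\<^sup>2)" .
  have "(\<Sum>i<q. v i * (\<Sum>j<q. calC11 X S q e $$ (i, j) * v j))
    = (1 / real n) * (\<Sum>i<q. v i * (\<Sum>j<q. \<Sum>k<n. X $$ (k, i) * X $$ (k, j) * v j))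
      + e / real n * (\<Sum>i<q. v i * (\<Sum>j<q. S $$ (i, j) * v j))"
    by (simp add: index_calC11[OF X S q] ring_distribs sum.distrib sum_distrib_left sum_distrib_right
        mult_ac sum_divide_distrib cong: sum.cong_simp)
  also have "\<dots> > 0" unfolding gram using n e pos
    by (intro add_nonneg_pos mult_nonneg_nonneg mult_pos_pos sum_nonneg) auto
  finally show "0 < (\<Sum>i<q. v i * (\<Sum>j<q. calC11 X S q e $$ (i, j) * v j))" .
qed

text \<open>An equivalence, since the recovery criterion uses both directions: a stationary point
  must equal the solution, and the solution satisfies the equations.\<close>

lemma mat_inv_solve:
  assumes A: "A \<in> carrier_mat n n" and det: "det A \<noteq> 0"
  shows "(\<forall>j<n. (\<Sum>i<n. A $$ (j, i) * v i) = r j) \<longleftrightarrow> (\<forall>i<n. v i = (\<Sum>l<n. mat_inv A $$ (i, l) * r l))"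
proof -
  note inv = mat_inv_adj_mat(2-4)[OF A det]
  have "(\<forall>j<n. (\<Sum>i<n. A $$ (j, i) * v i) = r j) \<longleftrightarrow> A *\<^sub>v vec n v = vec n r"
    using A by (auto simp: vec_eq_iff index_mult_mat_vec_sum[OF A] simp del: index_mult_mat_vec)
  also have "\<dots> \<longleftrightarrow> vec n v = mat_inv A *\<^sub>v vec n r"
  proof
    assume "A *\<^sub>v vec n v = vec n r"
    then have "mat_inv A *\<^sub>v vec n r = (mat_inv A * A) *\<^sub>v vec n v"
      using assoc_mult_mat_vec[OF inv(1) A, of "vec n v"] by simp
    then show "vec n v = mat_inv A *\<^sub>v vec n r" using inv(3) by simp
  next
    assume "vec n v = mat_inv A *\<^sub>v vec n r"
    then have "A *\<^sub>v vec n v = (A * mat_inv A) *\<^sub>v vec n r"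
      using assoc_mult_mat_vec[OF A inv(1), of "vec n r"] by simp
    then show "A *\<^sub>v vec n v = vec n r" using inv(2) by simp
  qed
  also have "\<dots> \<longleftrightarrow> (\<forall>i<n. v i = (\<Sum>l<n. mat_inv A $$ (i, l) * r l))"
    using inv(1) by (auto simp: vec_eq_iff index_mult_mat_vec_sum[OF inv(1)] simp del: index_mult_mat_vec)
  finally show ?thesis .
qed

definition noise_corr :: "real mat \<Rightarrow> (nat \<Rightarrow> real) \<Rightarrow> nat \<Rightarrow> real" where
  "noise_corr X w j = (1 / real (dim_row X)) * (\<Sum>k<dim_row X. X $$ (k, j) * w k)"

text \<open>Estimation error on the support of an estimator that recovers the signs.\<close>

definition oracle_error ::
  "real mat \<Rightarrow> real mat \<Rightarrow> nat \<Rightarrow> real vec \<Rightarrow> real \<Rightarrow> real \<Rightarrow> (nat \<Rightarrow> real) \<Rightarrow> nat \<Rightarrow> real" where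
  "oracle_error X S q b1 l e w i = (\<Sum>m<q. mat_inv (calC11 X S q e) $$ (i, m) *
     (noise_corr X w m - e / real (dim_row X) * (\<Sum>r<q. S $$ (m, r) * b1 $ r)
       - l / (2 * real (dim_row X)) * sgn (b1 $ m)))"

text \<open>The KKT conditions for a minimizer with the signs of \<open>b1\<close>, divided by \<open>2n\<close>.\<close>

definition sign_recovery ::
  "real mat \<Rightarrow> real mat \<Rightarrow> nat \<Rightarrow> real vec \<Rightarrow> real \<Rightarrow> real \<Rightarrow> (nat \<Rightarrow> real) \<Rightarrow> bool" where
  "sign_recovery X S q b1 l e w \<longleftrightarrow>
    (\<forall>i<q. sgn (b1 $ i + oracle_error X S q b1 l e w i) = sgn (b1 $ i)) \<and>
    (\<forall>j<dim_col X - q. \<bar>(\<Sum>i<q. calC21 X S q e $$ (j, i) * oracle_error X S q b1 l e w i)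
      - noise_corr X w (q + j) + e / real (dim_row X) * (\<Sum>i<q. S $$ (q + j, i) * b1 $ i)\<bar>
      \<le> l / (2 * real (dim_row X)))"

text \<open>For b supported on the first q coordinates with error u, the residual is w - X_1 u. The
  formula covers all rows j < p: those below q give the system with \<open>calC11\<close>, the
  others the dual condition with \<open>calC21\<close>.\<close>

lemma grad_supported:
  assumes X: "X \<in> carrier_mat n p" and S: "S \<in> carrier_mat p p" and q: "q \<le> p" and n: "0 < n"
    and b1: "b1 \<in> carrier_vec q"
    and y: "y = X *\<^sub>v vec p (\<lambda>j. if j < q then b1 $ j else 0) + vec n w"
    and b: "\<And>i. i < p \<Longrightarrow> b i = (if i < q then b1 $ i + u i else 0)"
    and j: "j < p"
  shows "elastic_net_grad n p (\<lambda>k j. X $$ (k, j)) (\<lambda>k. y $ k) (\<lambda>i j. S $$ (i, j)) e b j =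
    real n * ((\<Sum>i<q. ((1 / real n) * (\<Sum>k<n. X $$ (k, j) * X $$ (k, i)) + e / real n * S $$ (j, i)) * u i)
      - noise_corr X w j + e / real n * (\<Sum>i<q. S $$ (j, i) * b1 $ i))"
proof -
  have ext: "(\<Sum>i<p. g i * (if i < q then f i else 0)) = (\<Sum>i<q. g i * f i :: real)" for f g
    using q by (intro sum.mono_neutral_cong_right) auto
  have sb: "(\<Sum>i<p. g i * b i) = (\<Sum>i<q. g i * (b1 $ i + u i))" for g
    using ext[of g "\<lambda>i. b1 $ i + u i"] by (simp add: b cong: sum.cong_simp)
  have yk: "y $ k = (\<Sum>i<q. X $$ (k, i) * b1 $ i) + w k" if "k < n" for k
  proof -
    have "y $ k = (\<Sum>i<p. X $$ (k, i) * (if i < q then b1 $ i else 0)) + w k"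
      using that X unfolding y
      by (simp add: index_mult_mat_vec_sum[OF X vec_carrier] del: index_mult_mat_vec)
    then show ?thesis by (simp add: ext)
  qed
  have res: "y $ k - (\<Sum>i<p. X $$ (k, i) * b i) = w k - (\<Sum>i<q. X $$ (k, i) * u i)" if "k < n" for k
    unfolding sb yk[OF that] by (simp add: ring_distribs sum.distrib)
  have sw: "(\<Sum>i<q. (\<Sum>k<n. X $$ (k, j) * X $$ (k, i)) * u i) = (\<Sum>k<n. X $$ (k, j) * (\<Sum>i<q. X $$ (k, i) * u i))"
  proof -
    have "(\<Sum>i<q. (\<Sum>k<n. X $$ (k, j) * X $$ (k, i)) * u i) = (\<Sum>i<q. \<Sum>k<n. X $$ (k, j) * (X $$ (k, i) * u i))"
      by (simp add: sum_distrib_left sum_distrib_right mult_ac)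
    also have "\<dots> = (\<Sum>k<n. \<Sum>i<q. X $$ (k, j) * (X $$ (k, i) * u i))" by (rule sum.swap)
    finally show ?thesis by (simp add: sum_distrib_left)
  qed
  have "elastic_net_grad n p (\<lambda>k j. X $$ (k, j)) (\<lambda>k. y $ k) (\<lambda>i j. S $$ (i, j)) e b j =
    e * (\<Sum>i<q. S $$ (j, i) * (b1 $ i + u i)) - (\<Sum>k<n. X $$ (k, j) * (w k - (\<Sum>i<q. X $$ (k, i) * u i)))"
    unfolding elastic_net_grad_def sb using res by (simp add: sb cong: sum.cong_simp)
  also have "\<dots> = e * (\<Sum>i<q. S $$ (j, i) * b1 $ i) + e * (\<Sum>i<q. S $$ (j, i) * u i)
     - (\<Sum>k<n. X $$ (k, j) * w k) + (\<Sum>i<q. (\<Sum>k<n. X $$ (k, j) * X $$ (k, i)) * u i)"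
    unfolding sw by (simp add: ring_distribs sum.distrib sum_subtractf)
  finally have grad: "elastic_net_grad n p (\<lambda>k j. X $$ (k, j)) (\<lambda>k. y $ k) (\<lambda>i j. S $$ (i, j)) e b j = \<dots>" .
  have sums: "(\<Sum>i<q. ((1 / real n) * (\<Sum>k<n. X $$ (k, j) * X $$ (k, i)) + e / real n * S $$ (j, i)) * u i)
    = (1 / real n) * (\<Sum>i<q. (\<Sum>k<n. X $$ (k, j) * X $$ (k, i)) * u i) + e / real n * (\<Sum>i<q. S $$ (j, i) * u i)"
    by (simp only: distrib_right sum.distrib sum_distrib_left[of "1 / real n" _ "{..<q}"]
        sum_distrib_left[of "e / real n" _ "{..<q}"] mult.assoc)
  have "real n * ((1 / real n) * D + e / real n * B - (1 / real n) * C + e / real n * A) = e * A + e * B - C + D" for A B C D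
    using n by (simp add: field_simps)
  then show ?thesis unfolding grad sums noise_corr_def carrier_matD(1)[OF X] by (rule sym)
qed

text \<open>Since \<open>sgn\<close> vanishes only at 0, sign equality off the support says that the
  estimator is zero there, so the equations close on the support and determine the error. Conversely
  the candidate built from the oracle error is stationary, and uniqueness identifies it with
  \<open>gEN\<close>.\<close>

lemma sign_gEN_iff:
  assumes X: "X \<in> carrier_mat n p" and S: "S \<in> carrier_mat p p" and pd: "sym_pos_def_mat S"
    and q: "q \<le> p" and n: "0 < n" and l: "0 < l" and e: "0 < e"
    and b1: "b1 \<in> carrier_vec q" and nz: "\<forall>j<q. b1 $ j \<noteq> 0"
  defines "bs \<equiv> vec p (\<lambda>j. if j < q then b1 $ j else 0)"
  shows "(\<forall>j<p. sgn (gEN X (X *\<^sub>v bs + vec n w) S l e $ j) = sgn (bs $ j)) \<longleftrightarrow> sign_recovery X S q b1 l e w"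
proof -
  define y where "y = X *\<^sub>v bs + vec n w"
  have yc: "y \<in> carrier_vec n" using X by (simp add: y_def bs_def)
  note y' = y_def[unfolded bs_def]
  note gEN = gEN_stationary[OF X yc S pd l e]
  let ?A = "calC11 X S q e"
  have A: "?A \<in> carrier_mat q q" by (rule calC11_carrier)
  have det: "det ?A \<noteq> 0" by (rule sym_pos_def_mat_det[OF A sym_pos_def_calC11[OF X S pd q n e]])
  let ?u = "oracle_error X S q b1 l e w"
  let ?rhs = "\<lambda>m. noise_corr X w m - e / real n * (\<Sum>r<q. S $$ (m, r) * b1 $ r) - l / (2 * real n) * sgn (b1 $ m)"
  have solve: "(\<forall>j<q. (\<Sum>i<q. ?A $$ (j, i) * v i) = ?rhs j) \<longleftrightarrow> (\<forall>i<q. v i = ?u i)" for v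
    using mat_inv_solve[OF A det, of v ?rhs] X by (simp add: oracle_error_def)
  let ?g = "elastic_net_grad n p (\<lambda>k j. X $$ (k, j)) (\<lambda>k. y $ k) (\<lambda>i j. S $$ (i, j)) e"
  have grad1: "?g b j = real n * ((\<Sum>i<q. ?A $$ (j, i) * u i) - noise_corr X w j + e / real n * (\<Sum>i<q. S $$ (j, i) * b1 $ i))"
    if "\<And>i. i < p \<Longrightarrow> b i = (if i < q then b1 $ i + u i else 0)" "j < q" for b u j
    using grad_supported[OF X S q n b1 y', of b u j] that q by (simp add: index_calC11[OF X S q] cong: sum.cong_simp)
  have grad2: "?g b (q + j) = real n * ((\<Sum>i<q. calC21 X S q e $$ (j, i) * u i) - noise_corr X w (q + j)
      + e / real n * (\<Sum>i<q. S $$ (q + j, i) * b1 $ i))"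
    if "\<And>i. i < p \<Longrightarrow> b i = (if i < q then b1 $ i + u i else 0)" "j < p - q" for b u j
    using grad_supported[OF X S q n b1 y', of b u "q + j"] that q by (simp add: index_calC21[OF X S q] cong: sum.cong_simp)
  have dims: "dim_row X = n" "dim_col X = p" using X by auto
  have scale: "\<bar>2 * (real n * t)\<bar> \<le> l \<longleftrightarrow> \<bar>t\<bar> \<le> l / (2 * real n)" for t
    using n by (simp add: abs_mult field_simps)
  show ?thesis unfolding y_def[symmetric]
  proof
    assume L: "\<forall>j<p. sgn (gEN X y S l e $ j) = sgn (bs $ j)"
    define b where "b j = gEN X y S l e $ j" for j
    have st: "elastic_net_stationary n p (\<lambda>k j. X $$ (k, j)) (\<lambda>k. y $ k) (\<lambda>i j. S $$ (i, j)) l e b"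
      using gEN(2) by (simp add: b_def[abs_def])
    define u where "u i = b i - b1 $ i" for i
    have b: "b i = (if i < q then b1 $ i + u i else 0)" if "i < p" for i
      using L that by (auto simp: u_def b_def bs_def sgn_zero_iff)
    have sg: "sgn (b i) = sgn (b1 $ i)" if "i < q" for i using L that q by (auto simp: b_def bs_def)
    have "(\<Sum>i<q. ?A $$ (j, i) * u i) = ?rhs j" if j: "j < q" for j
    proof -
      have "b j \<noteq> 0" using sg[OF j] nz j by (metis sgn_zero_iff)
      moreover have "j < p" using j q by simp
      ultimately have "2 * ?g b j + l * sgn (b j) = 0"
        using st unfolding elastic_net_stationary_def by blast
      then have g0: "2 * ?g b j + l * sgn (b1 $ j) = 0" unfolding sg[OF j] .
      have g1: "?g b j = real n * ((\<Sum>i<q. ?A $$ (j, i) * u i) - noise_corr X w j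
          + e / real n * (\<Sum>i<q. S $$ (j, i) * b1 $ i))"
        by (rule grad1[OF _ j]) (rule b)
      \<comment> \<open>The stationarity equation divided by 2n and solved for the product with
        \<open>calC11\<close>.\<close>
      have g2: "a = c - d - l / (2 * real n) * sg" if "2 * (real n * (a - c + d)) + l * sg = 0" for a c d sg
        using that n by (simp add: field_simps)
      show ?thesis by (rule g2) (use g0 g1 in \<open>simp only:\<close>)
    qed
    then have u: "u i = ?u i" if "i < q" for i using solve[of u] that by blast
    have "sgn (b1 $ i + ?u i) = sgn (b1 $ i)" if "i < q" for i
      using sg[OF that] b[of i] u[OF that] that q by simp
    moreover have "\<bar>(\<Sum>i<q. calC21 X S q e $$ (j, i) * ?u i) - noise_corr X w (q + j)
      + e / real n * (\<Sum>i<q. S $$ (q + j, i) * b1 $ i)\<bar> \<le> l / (2 * real n)" if j: "j < p - q" for j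
    proof -
      have "\<bar>2 * ?g b (q + j)\<bar> \<le> l" using st j by (simp add: elastic_net_stationary_def)
      moreover have "?g b (q + j) = real n * ((\<Sum>i<q. calC21 X S q e $$ (j, i) * u i) - noise_corr X w (q + j)
          + e / real n * (\<Sum>i<q. S $$ (q + j, i) * b1 $ i))"
        by (rule grad2[OF _ j]) (rule b)
      ultimately show ?thesis by (simp add: scale u cong: sum.cong_simp)
    qed
    ultimately show "sign_recovery X S q b1 l e w" by (simp add: sign_recovery_def dims)
  next
    assume R: "sign_recovery X S q b1 l e w"
    define b where "b i = (if i < q then b1 $ i + ?u i else 0)" for i
    have sg: "sgn (b i) = sgn (b1 $ i)" if "i < q" for i
      using R that by (simp add: sign_recovery_def b_def)
    have "elastic_net_stationary n p (\<lambda>k j. X $$ (k, j)) (\<lambda>k. y $ k) (\<lambda>i j. S $$ (i, j)) l e b"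
      unfolding elastic_net_stationary_def
    proof (intro allI impI)
      fix j assume "j < p"
      show "(b j \<noteq> 0 \<longrightarrow> 2 * ?g b j + l * sgn (b j) = 0) \<and> \<bar>2 * ?g b j\<bar> \<le> l"
      proof (cases "j < q")
        case True
        have "(\<Sum>i<q. ?A $$ (j, i) * ?u i) = ?rhs j" using solve[of ?u] True by blast
        then have "?g b j = real n * (- (l / (2 * real n) * sgn (b1 $ j)))"
          using grad1[of b ?u j] True by (simp add: b_def)
        then have *: "2 * ?g b j = - (l * sgn (b1 $ j))" using n by simp
        then show ?thesis using sg[OF True] nz True l by (simp add: abs_mult abs_sgn_eq)
      next
        case False
        then obtain i where i: "j = q + i" "i < p - q" using \<open>j < p\<close> by (metis add_diff_inverse_nat diff_less_mono not_less)
        have "\<bar>2 * ?g b (q + i)\<bar> \<le> l"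
          using R i(2) grad2[of b ?u i] by (simp add: b_def scale[symmetric] sign_recovery_def dims)
        then show ?thesis using False i by (simp add: b_def)
      qed
    qed
    then have st: "elastic_net_stationary n p (\<lambda>k j. X $$ (k, j)) (\<lambda>k. y $ k) (\<lambda>i j. S $$ (i, j)) l e (\<lambda>j. vec p b $ j)"
      by (subst elastic_net_stationary_cong[of p _ b]) auto
    have "gEN X y S l e = vec p b" by (rule gEN(3)[OF vec_carrier st])
    then show "\<forall>j<p. sgn (gEN X y S l e $ j) = sgn (bs $ j)"
      using sg by (auto simp: bs_def b_def)
  qed
qed

section \<open>Noise and bias in the recovery conditions\<close>

lemma scaled_sum_noise:
  assumes n: "dim_row X = n"
  shows "(1 / sqrt (real n)) * (\<Sum>k<n. (1 / sqrt (real n)) * (\<Sum>m<q. a m * X $$ (k, m)) * w k)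
    = (\<Sum>m<q. a m * noise_corr X w m)"
proof -
  have "(1 / sqrt (real n)) * (\<Sum>k<n. (1 / sqrt (real n)) * (\<Sum>m<q. a m * X $$ (k, m)) * w k)
    = (1 / sqrt (real n) * (1 / sqrt (real n))) * (\<Sum>k<n. (\<Sum>m<q. a m * X $$ (k, m)) * w k)"
    by (simp only: sum_distrib_left[of _ _ "{..<n}"] mult.assoc)
  \<comment> \<open>One factor sits inside \<open>H_A\<close> and \<open>H_B\<close>, the other in
    front of them; together they give the 1/n of \<open>noise_corr\<close>.\<close>
  also have "1 / sqrt (real n) * (1 / sqrt (real n)) = 1 / real n" by simp
  also have "(\<Sum>k<n. (\<Sum>m<q. a m * X $$ (k, m)) * w k) = (\<Sum>k<n. \<Sum>m<q. a m * (X $$ (k, m) * w k))"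
    by (simp add: sum_distrib_right mult.assoc)
  also have "\<dots> = (\<Sum>m<q. \<Sum>k<n. a m * (X $$ (k, m) * w k))" by (rule sum.swap)
  finally show ?thesis
    by (simp add: noise_corr_def n sum_distrib_left sum_divide_distrib)
qed

lemma carrier_H_A: "mat_inv (calC11 X S q e) \<in> carrier_mat q q \<Longrightarrow> X \<in> carrier_mat n p \<Longrightarrow> H_A X S q e \<in> carrier_mat q n"
  by (rule carrier_matI) (auto simp: H_A_def cols1_def)

lemma index_H_A:
  assumes X: "X \<in> carrier_mat n p" and I: "mat_inv (calC11 X S q e) \<in> carrier_mat q q"
    and i: "i < q" and k: "k < n"
  shows "H_A X S q e $$ (i, k) = (1 / sqrt (real n)) * (\<Sum>m<q. mat_inv (calC11 X S q e) $$ (i, m) * X $$ (k, m))"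
proof -
  have X1: "transpose_mat (cols1 X q) \<in> carrier_mat q n" using X by (auto simp: cols1_def)
  have prod: "mat_inv (calC11 X S q e) * transpose_mat (cols1 X q) \<in> carrier_mat q n" using I X1 by simp
  have "H_A X S q e $$ (i, k) = (1 / sqrt (real n)) * (mat_inv (calC11 X S q e) * transpose_mat (cols1 X q)) $$ (i, k)"
    unfolding H_A_def using X prod i k by (subst index_smult_mat) auto
  also have "(mat_inv (calC11 X S q e) * transpose_mat (cols1 X q)) $$ (i, k)
      = (\<Sum>m<q. mat_inv (calC11 X S q e) $$ (i, m) * X $$ (k, m))"
    unfolding index_mult_mat_sum[OF I X1 i k] using X k by (intro sum.cong) (auto simp: cols1_def)
  finally show ?thesis .
qed

lemma carrier_H_B:
  assumes "mat_inv (calC11 X S q e) \<in> carrier_mat q q" "X \<in> carrier_mat n p" "S \<in> carrier_mat p p"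
  shows "H_B X S q e \<in> carrier_mat (p - q) n"
  using assms by (intro carrier_matI) (auto simp: H_B_def cols2_def)

definition irrep_mat :: "real mat \<Rightarrow> real mat \<Rightarrow> nat \<Rightarrow> real \<Rightarrow> nat \<Rightarrow> nat \<Rightarrow> real" where
  "irrep_mat X S q e j m = (\<Sum>i<q. calC21 X S q e $$ (j, i) * mat_inv (calC11 X S q e) $$ (i, m))"

lemma index_H_B:
  assumes X: "X \<in> carrier_mat n p" and S: "S \<in> carrier_mat p p" and I: "mat_inv (calC11 X S q e) \<in> carrier_mat q q"
    and q: "q \<le> p" and j: "j < p - q" and k: "k < n"
  shows "H_B X S q e $$ (j, k) = (1 / sqrt (real n)) * ((\<Sum>m<q. irrep_mat X S q e j m * X $$ (k, m)) - X $$ (k, q + j))"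
proof -
  let ?P = "calC21 X S q e * mat_inv (calC11 X S q e)"
  note C = calC21_carrier[OF X S, of q e]
  have P: "?P \<in> carrier_mat (p - q) q" using C I by simp
  have X1: "transpose_mat (cols1 X q) \<in> carrier_mat q n" using X by (auto simp: cols1_def)
  have X2: "transpose_mat (cols2 X q) \<in> carrier_mat (p - q) n" using X by (auto simp: cols2_def)
  have PX: "?P * transpose_mat (cols1 X q) \<in> carrier_mat (p - q) n" using P X1 by simp
  have "H_B X S q e $$ (j, k) = (1 / sqrt (real n)) *
     ((?P * transpose_mat (cols1 X q)) $$ (j, k) - transpose_mat (cols2 X q) $$ (j, k))"
    unfolding H_B_def using X PX X2 j k
    by (subst index_smult_mat, simp, simp, subst index_minus_mat) auto
  also have "(?P * transpose_mat (cols1 X q)) $$ (j, k) = (\<Sum>m<q. irrep_mat X S q e j m * X $$ (k, m))"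
    unfolding index_mult_mat_sum[OF P X1 j k]
  proof (intro sum.cong refl)
    fix m assume "m \<in> {..<q}"
    then have m: "m < q" by simp
    show "?P $$ (j, m) * transpose_mat (cols1 X q) $$ (m, k) = irrep_mat X S q e j m * X $$ (k, m)"
      unfolding index_mult_mat_sum[OF C I j m] irrep_mat_def using m k X by (simp add: cols1_def)
  qed
  also have "transpose_mat (cols2 X q) $$ (j, k) = X $$ (k, q + j)"
    using X j k by (simp add: cols2_def)
  finally show ?thesis .
qed

lemma index_gic_vec:
  assumes X: "X \<in> carrier_mat n p" and S: "S \<in> carrier_mat p p" and I: "mat_inv (calC11 X S q e) \<in> carrier_mat q q"
    and b1: "b1 \<in> carrier_vec q" and q: "q \<le> p" and j: "j < p - q"
  shows "gic_vec X S q b1 l e $ j =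
    (\<Sum>m<q. irrep_mat X S q e j m * (sgn (b1 $ m) + 2 * e / l * (\<Sum>r<q. S $$ (m, r) * b1 $ r)))
      - 2 * e / l * (\<Sum>r<q. S $$ (q + j, r) * b1 $ r)"
proof -
  let ?P = "calC21 X S q e * mat_inv (calC11 X S q e)"
  let ?v = "sgn_vec b1 + (2 * e / l) \<cdot>\<^sub>v (blk11 S q *\<^sub>v b1)"
  note C = calC21_carrier[OF X S, of q e]
  have P: "?P \<in> carrier_mat (p - q) q" using C I by simp
  have B1: "blk11 S q \<in> carrier_mat q q" by (rule carrier_matI) (simp_all add: blk11_def)
  have B2: "blk21 S q \<in> carrier_mat (p - q) q" using S by (intro carrier_matI) (simp_all add: blk21_def)
  have v: "?v \<in> carrier_vec q" using b1 B1 by (auto simp: sgn_vec_def)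
  have vm: "?v $ m = sgn (b1 $ m) + 2 * e / l * (\<Sum>r<q. S $$ (m, r) * b1 $ r)" if m: "m < q" for m
  proof -
    have "?v $ m = sgn (b1 $ m) + 2 * e / l * (blk11 S q *\<^sub>v b1) $ m"
      using m b1 B1 by (simp add: sgn_vec_def)
    then show ?thesis unfolding index_mult_mat_vec_sum[OF B1 b1 m] using m by (simp add: blk11_def)
  qed
  have "gic_vec X S q b1 l e $ j = (?P *\<^sub>v ?v) $ j - 2 * e / l * (blk21 S q *\<^sub>v b1) $ j"
    unfolding gic_vec_def using P B2 j by simp
  also have "(?P *\<^sub>v ?v) $ j = (\<Sum>m<q. irrep_mat X S q e j m * (sgn (b1 $ m) + 2 * e / l * (\<Sum>r<q. S $$ (m, r) * b1 $ r)))"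
    unfolding index_mult_mat_vec_sum[OF P v j]
  proof (intro sum.cong refl)
    fix m assume "m \<in> {..<q}"
    then have m: "m < q" by simp
    show "?P $$ (j, m) * ?v $ m = irrep_mat X S q e j m * (sgn (b1 $ m) + 2 * e / l * (\<Sum>r<q. S $$ (m, r) * b1 $ r))"
      unfolding vm[OF m] index_mult_mat_sum[OF C I j m] irrep_mat_def ..
  qed
  also have "(blk21 S q *\<^sub>v b1) $ j = (\<Sum>r<q. S $$ (q + j, r) * b1 $ r)"
    unfolding index_mult_mat_vec_sum[OF B2 b1 j] using S j by (simp add: blk21_def)
  finally show ?thesis .
qed

lemma oracle_error_eq:
  assumes X: "X \<in> carrier_mat n p" and I: "mat_inv (calC11 X S q e) \<in> carrier_mat q q"
    and i: "i < q"
  shows "oracle_error X S q b1 l e w i = (1 / sqrt (real n)) * (\<Sum>k<n. H_A X S q e $$ (i, k) * w k)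
    - (\<Sum>m<q. mat_inv (calC11 X S q e) $$ (i, m) * (e / real n * (\<Sum>r<q. S $$ (m, r) * b1 $ r)))
    - (\<Sum>m<q. mat_inv (calC11 X S q e) $$ (i, m) * (l / (2 * real n) * sgn (b1 $ m)))"
proof -
  have dim: "dim_row X = n" using X by simp
  have "(1 / sqrt (real n)) * (\<Sum>k<n. H_A X S q e $$ (i, k) * w k)
    = (\<Sum>m<q. mat_inv (calC11 X S q e) $$ (i, m) * noise_corr X w m)"
    unfolding scaled_sum_noise[OF dim, symmetric] using i
    by (intro arg_cong2[of _ _ _ _ "(*)"] sum.cong refl) (simp add: index_H_A[OF X I])
  then show ?thesis
    unfolding oracle_error_def dim by (simp only: right_diff_distrib sum_subtractf)
qed

text \<open>Multiplying the oracle error by \<open>calC21\<close> produces \<open>irrep_mat\<close>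
  applied to noise, ridge and sign terms. The noise part combines with \<open>noise_corr\<close> at
  q + j into \<open>H_B\<close>, the deterministic rest into \<open>gic_vec\<close>.\<close>

lemma dual_error_eq:
  assumes X: "X \<in> carrier_mat n p" and S: "S \<in> carrier_mat p p" and I: "mat_inv (calC11 X S q e) \<in> carrier_mat q q"
    and b1: "b1 \<in> carrier_vec q" and q: "q \<le> p" and j: "j < p - q" and l: "0 < l"
  shows "(\<Sum>i<q. calC21 X S q e $$ (j, i) * oracle_error X S q b1 l e w i)
      - noise_corr X w (q + j) + e / real n * (\<Sum>i<q. S $$ (q + j, i) * b1 $ i)
    = (1 / sqrt (real n)) * (\<Sum>k<n. H_B X S q e $$ (j, k) * w k) - l / (2 * real n) * gic_vec X S q b1 l e $ j"
proof -
  have dim: "dim_row X = n" using X by simp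
  let ?P = "irrep_mat X S q e j"
  let ?s = "\<lambda>m. \<Sum>r<q. S $$ (m, r) * b1 $ r"
  let ?r = "\<lambda>m. noise_corr X w m - e / real n * ?s m - l / (2 * real n) * sgn (b1 $ m)"
  have "(\<Sum>i<q. calC21 X S q e $$ (j, i) * oracle_error X S q b1 l e w i)
    = (\<Sum>i<q. \<Sum>m<q. calC21 X S q e $$ (j, i) * (mat_inv (calC11 X S q e) $$ (i, m) * ?r m))"
    unfolding oracle_error_def dim by (simp only: sum_distrib_left)
  also have "\<dots> = (\<Sum>m<q. \<Sum>i<q. calC21 X S q e $$ (j, i) * (mat_inv (calC11 X S q e) $$ (i, m) * ?r m))"
    by (rule sum.swap)
  also have "\<dots> = (\<Sum>m<q. ?P m * ?r m)"
    unfolding irrep_mat_def by (simp only: sum_distrib_right mult.assoc)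
  also have "\<dots> = (\<Sum>m<q. ?P m * noise_corr X w m) - (\<Sum>m<q. ?P m * (e / real n * ?s m + l / (2 * real n) * sgn (b1 $ m)))"
    by (simp only: sum_subtractf[symmetric] right_diff_distrib distrib_left) (simp add: algebra_simps)
  finally have 1: "(\<Sum>i<q. calC21 X S q e $$ (j, i) * oracle_error X S q b1 l e w i) = \<dots>" .
  have "(1 / sqrt (real n)) * (\<Sum>k<n. H_B X S q e $$ (j, k) * w k)
    = (1 / sqrt (real n)) * (\<Sum>k<n. (1 / sqrt (real n)) * (\<Sum>m<q. ?P m * X $$ (k, m)) * w k)
      - (1 / sqrt (real n)) * (\<Sum>k<n. (1 / sqrt (real n)) * (X $$ (k, q + j) * w k))"
    unfolding right_diff_distrib[symmetric] sum_subtractf[symmetric]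
    by (intro arg_cong2[of _ _ _ _ "(*)"] sum.cong refl) (simp add: index_H_B[OF X S I q j] algebra_simps)
  also have "(1 / sqrt (real n)) * (\<Sum>k<n. (1 / sqrt (real n)) * (X $$ (k, q + j) * w k)) = noise_corr X w (q + j)"
  proof -
    have "(1 / sqrt (real n)) * (\<Sum>k<n. (1 / sqrt (real n)) * (X $$ (k, q + j) * w k))
      = (1 / sqrt (real n) * (1 / sqrt (real n))) * (\<Sum>k<n. X $$ (k, q + j) * w k)"
      by (simp only: sum_distrib_left mult.assoc)
    then show ?thesis by (simp add: noise_corr_def dim)
  qed
  finally have 2: "(1 / sqrt (real n)) * (\<Sum>k<n. H_B X S q e $$ (j, k) * w k)
    = (\<Sum>m<q. ?P m * noise_corr X w m) - noise_corr X w (q + j)"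
    unfolding scaled_sum_noise[OF dim] .
  \<comment> \<open>This is why the irrepresentable vector carries the factor 2 eta / lambda:
    pulling out lambda / (2n) restores eta / n.\<close>
  have sc: "l / (2 * real n) * (2 * e / l) = e / real n" using l by (simp add: field_simps)
  have "l / (2 * real n) * ((\<Sum>m<q. ?P m * (g m + 2 * e / l * s m)) - 2 * e / l * t)
    = (\<Sum>m<q. ?P m * (l / (2 * real n) * g m + (l / (2 * real n) * (2 * e / l)) * s m))
      - (l / (2 * real n) * (2 * e / l)) * t" for g s t
    by (simp add: right_diff_distrib distrib_left sum_distrib_left mult_ac)
  then have "l / (2 * real n) * gic_vec X S q b1 l e $ j
    = (\<Sum>m<q. ?P m * (l / (2 * real n) * sgn (b1 $ m) + (l / (2 * real n) * (2 * e / l)) * ?s m))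
      - (l / (2 * real n) * (2 * e / l)) * ?s (q + j)"
    unfolding index_gic_vec[OF X S I b1 q j] .
  then have 3: "l / (2 * real n) * gic_vec X S q b1 l e $ j
    = (\<Sum>m<q. ?P m * (e / real n * ?s m + l / (2 * real n) * sgn (b1 $ m))) - e / real n * ?s (q + j)"
    unfolding sc by (simp only: add.commute)
  show ?thesis unfolding 1 2 3 by simp
qed

text \<open>The squared row norm is a diagonal entry of HH'. Up to the factor sigma^2 it is the
  conditional variance of the corresponding noise coordinate.\<close>

lemma row_norm_le_lambda_max:
  fixes H :: "real mat"
  assumes H: "H \<in> carrier_mat m n" and i: "i < m"
  shows "(\<Sum>k<n. (H $$ (i, k))\<^sup>2) \<le> lambda_max (H * transpose_mat H)"
proof -
  have HT: "transpose_mat H \<in> carrier_mat n m" using H by simp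
  have "(\<Sum>k<n. (H $$ (i, k))\<^sup>2) = (H * transpose_mat H) $$ (i, i)"
    unfolding index_mult_mat_sum[OF H HT i i] using H i by (intro sum.cong) (auto simp: power2_eq_square)
  also have "\<dots> \<le> lambda_max (H * transpose_mat H)"
    using H HT i transpose_mult[OF H HT] by (intro symmetric_diag_le_lambda_max[of _ m]) auto
  finally show ?thesis .
qed

text \<open>One coordinate of Av is at most its Euclidean norm, which definiteness bounds by the top
  eigenvalue times |v|.\<close>

lemma sym_pos_def_mult_bound:
  assumes A: "A \<in> carrier_mat n n" and pd: "sym_pos_def_mat A" and i: "i < n"
    and L: "lambda_max A \<le> L" and R: "0 \<le> R" "(\<Sum>j<n. (v j)\<^sup>2) \<le> R\<^sup>2"
  shows "\<bar>\<Sum>j<n. A $$ (i, j) * v j\<bar> \<le> L * R"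
proof -
  have n: "0 < n" using i by simp
  note lm = sym_pos_def_mat_lambda_max[OF A pd n]
  have "(\<Sum>j<n. A $$ (i, j) * v j)\<^sup>2 \<le> (\<Sum>i<n. (\<Sum>j<n. A $$ (i, j) * v j)\<^sup>2)"
    using i by (intro member_le_sum) auto
  also have "\<dots> \<le> (lambda_max A)\<^sup>2 * (\<Sum>j<n. (v j)\<^sup>2)" by (rule lm(2))
  also have "\<dots> \<le> L\<^sup>2 * R\<^sup>2"
    using lm(1) L R by (intro mult_mono power_mono sum_nonneg) auto
  finally have "(\<Sum>j<n. A $$ (i, j) * v j)\<^sup>2 \<le> (L * R)\<^sup>2" by (simp add: power_mult_distrib)
  moreover have "0 \<le> L * R" using lm(1) L R by simp
  ultimately show ?thesis by (metis abs_le_square_iff abs_of_nonneg)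
qed

text \<open>The deterministic core, for one sample. On the support the noise takes at most a third
  of \<open>bmin\<close> and the two bias terms strictly less than a third each, so no sign can
  flip. Off the support the budget lambda / (2n) is divided into a share alpha for noise and 1 -
  alpha for \<open>gic_vec\<close>.\<close>

lemma sign_recovery_sufficient:
  assumes X: "X \<in> carrier_mat n p" and S: "S \<in> carrier_mat p p" and pd: "sym_pos_def_mat S"
    and q: "0 < q" "q \<le> p" and n: "0 < n" and l: "0 < l" and e: "0 < e"
    and b1: "b1 \<in> carrier_vec q" and nz: "\<forall>j<q. b1 $ j \<noteq> 0"
    and bmin: "0 < bmin" "\<And>j. j < q \<Longrightarrow> bmin \<le> \<bar>b1 $ j\<bar>"
    and M2: "0 < M2" "lambda_max (mat_inv (calC11 X S q e)) \<le> M2"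
    and lam: "l / real n < 2 * bmin / (3 * M2 * sqrt (real q))"
    and eta: "e / real n < 1 / (3 * M2 * lambda_max (blk11 S q)) * (bmin / sqrt (sq_norm_v b1))"
    and noiseA: "\<And>i. i < q \<Longrightarrow> \<bar>\<Sum>k<n. H_A X S q e $$ (i, k) * w k\<bar> \<le> sqrt (real n) * bmin / 3"
    and noiseB: "\<And>j. j < p - q \<Longrightarrow> \<bar>\<Sum>k<n. H_B X S q e $$ (j, k) * w k\<bar> \<le> alpha * l / (2 * sqrt (real n))"
    and gic: "\<And>j. j < p - q \<Longrightarrow> \<bar>gic_vec X S q b1 l e $ j\<bar> \<le> 1 - alpha"
  shows "sign_recovery X S q b1 l e w"
proof -
  let ?A = "calC11 X S q e"
  note A = calC11_carrier[of X S q e]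
  have pdA: "sym_pos_def_mat ?A" by (rule sym_pos_def_calC11[OF X S pd q(2) n e])
  note I = sym_pos_def_mat_inv(2)[OF A A pdA]
  have pdI: "sym_pos_def_mat (mat_inv ?A)" by (rule sym_pos_def_mat_mat_inv[OF A pdA])
  have B: "blk11 S q \<in> carrier_mat q q" by (rule carrier_matI) (simp_all add: blk11_def)
  have pdB: "sym_pos_def_mat (blk11 S q)" by (rule sym_pos_def_blk11[OF S pd q(2)])
  note lmB = sym_pos_def_mat_lambda_max[OF B pdB q(1)]
  define N where "N = sqrt (sq_norm_v b1)"
  have sq: "sq_norm_v b1 = (\<Sum>j<q. (b1 $ j)\<^sup>2)" using b1 by (simp add: sq_norm_v_def)
  have "0 < sq_norm_v b1" unfolding sq using q nz by (intro sum_pos) auto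
  then have N: "0 < N" "N\<^sup>2 = (\<Sum>j<q. (b1 $ j)\<^sup>2)" by (auto simp: N_def sq)
  have dims: "dim_row X = n" "dim_col X = p" using X by auto
  have small: "\<bar>oracle_error X S q b1 l e w i\<bar> < bmin" if i: "i < q" for i
  proof -
    \<comment> \<open>Bounds the Euclidean norm of (eta/n) Sigma_11 beta_1. The hypothesis on eta
      cancels its factors \<open>lambda_max (blk11 S q)\<close> and \<open>N\<close>, leaving less
      than bmin / (3 M2).\<close>
    define R1 where "R1 = e / real n * (lambda_max (blk11 S q) * N)"
    have "(\<Sum>m<q. (c * s m)\<^sup>2) = c\<^sup>2 * (\<Sum>m<q. (s m)\<^sup>2)" for c :: real and s
      by (simp add: power_mult_distrib sum_distrib_left)
    then have "(\<Sum>m<q. (e / real n * (\<Sum>r<q. S $$ (m, r) * b1 $ r))\<^sup>2)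
      = (e / real n)\<^sup>2 * (\<Sum>m<q. (\<Sum>r<q. blk11 S q $$ (m, r) * b1 $ r)\<^sup>2)"
      by (simp add: blk11_def cong: sum.cong_simp del: times_divide_eq_left)
    also have "\<dots> \<le> (e / real n)\<^sup>2 * ((lambda_max (blk11 S q))\<^sup>2 * (\<Sum>j<q. (b1 $ j)\<^sup>2))"
      by (intro mult_left_mono lmB(2)) auto
    also have "\<dots> = R1\<^sup>2" by (simp only: R1_def power_mult_distrib N(2))
    finally have "\<bar>\<Sum>m<q. mat_inv ?A $$ (i, m) * (e / real n * (\<Sum>r<q. S $$ (m, r) * b1 $ r))\<bar> \<le> M2 * R1"
      using lmB(1) N e n by (intro sym_pos_def_mult_bound[OF I pdI i M2(2)]) (auto simp: R1_def)
    also have "M2 * R1 < bmin / 3"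
    proof -
      have "R1 < 1 / (3 * M2 * lambda_max (blk11 S q)) * (bmin / N) * (lambda_max (blk11 S q) * N)"
        unfolding R1_def using lmB(1) N eta by (intro mult_strict_right_mono) (auto simp: N_def)
      also have "\<dots> = bmin / (3 * M2)" using lmB(1) N by simp
      finally show ?thesis using M2 by (simp add: field_simps)
    qed
    finally have t1: "\<bar>\<Sum>m<q. mat_inv ?A $$ (i, m) * (e / real n * (\<Sum>r<q. S $$ (m, r) * b1 $ r))\<bar> < bmin / 3" .
    \<comment> \<open>The exact Euclidean norm of lambda / (2n) sign(beta_1): all q signs are
      nonzero.\<close>
    define R2 where "R2 = l / (2 * real n) * sqrt (real q)"
    have "(\<Sum>m<q. (l / (2 * real n) * sgn (b1 $ m))\<^sup>2) = (\<Sum>m<q. (l / (2 * real n))\<^sup>2)"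
      using nz by (intro sum.cong) (auto simp: power_mult_distrib sgn_if)
    also have "\<dots> = R2\<^sup>2" by (simp add: R2_def power_mult_distrib power_divide)
    finally have "\<bar>\<Sum>m<q. mat_inv ?A $$ (i, m) * (l / (2 * real n) * sgn (b1 $ m))\<bar> \<le> M2 * R2"
      using l n by (intro sym_pos_def_mult_bound[OF I pdI i M2(2)]) (auto simp: R2_def)
    also have "M2 * R2 < bmin / 3"
    proof -
      have "R2 = l / real n * (sqrt (real q) / 2)" by (simp add: R2_def)
      also have "\<dots> < 2 * bmin / (3 * M2 * sqrt (real q)) * (sqrt (real q) / 2)"
        using lam q by (intro mult_strict_right_mono) auto
      also have "\<dots> = bmin / (3 * M2)" using q by (simp add: field_simps)
      finally show ?thesis using M2 by (simp add: field_simps)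
    qed
    finally have t2: "\<bar>\<Sum>m<q. mat_inv ?A $$ (i, m) * (l / (2 * real n) * sgn (b1 $ m))\<bar> < bmin / 3" .
    have "\<bar>(1 / sqrt (real n)) * (\<Sum>k<n. H_A X S q e $$ (i, k) * w k)\<bar> \<le> (1 / sqrt (real n)) * (sqrt (real n) * bmin / 3)"
      using noiseA[OF i] by (simp only: abs_mult) (intro mult_mono, auto)
    also have "\<dots> = bmin / 3" using n by simp
    finally have t3: "\<bar>(1 / sqrt (real n)) * (\<Sum>k<n. H_A X S q e $$ (i, k) * w k)\<bar> \<le> bmin / 3" .
    show ?thesis unfolding oracle_error_eq[OF X I i] using t1 t2 t3 by linarith
  qed
  show ?thesis unfolding sign_recovery_def dims
  proof (intro conjI allI impI)
    fix i assume i: "i < q"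
    show "sgn (b1 $ i + oracle_error X S q b1 l e w i) = sgn (b1 $ i)"
      using small[OF i] bmin(2)[OF i] by (auto simp: sgn_if)
  next
    fix j assume j: "j < p - q"
    have "\<bar>(1 / sqrt (real n)) * (\<Sum>k<n. H_B X S q e $$ (j, k) * w k)\<bar> \<le> (1 / sqrt (real n)) * (alpha * l / (2 * sqrt (real n)))"
      using noiseB[OF j] by (simp only: abs_mult) (intro mult_mono, auto)
    also have "\<dots> = (1 / sqrt (real n) * (1 / sqrt (real n))) * (alpha * l / 2)" by simp
    also have "\<dots> = l / (2 * real n) * alpha" by (simp add: mult.commute)
    finally have t1: "\<bar>(1 / sqrt (real n)) * (\<Sum>k<n. H_B X S q e $$ (j, k) * w k)\<bar> \<le> l / (2 * real n) * alpha" .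
    have t2: "\<bar>l / (2 * real n) * gic_vec X S q b1 l e $ j\<bar> \<le> l / (2 * real n) * (1 - alpha)"
      using gic[OF j] l by (simp only: abs_mult) (intro mult_mono, auto)
    show "\<bar>(\<Sum>i<q. calC21 X S q e $$ (j, i) * oracle_error X S q b1 l e w i)
      - noise_corr X w (q + j) + e / real n * (\<Sum>i<q. S $$ (q + j, i) * b1 $ i)\<bar> \<le> l / (2 * real n)"
      unfolding dual_error_eq[OF X S I b1 q(2) j l]
      using order_trans[OF abs_triangle_ineq4 add_mono[OF t1 t2]]
      unfolding distrib_left[symmetric] by simp
  qed
qed

section \<open>Gaussian tails\<close>

text \<open>Completing the square: exponential tilting moves the mean to b s^2 and leaves a constant
  factor.\<close>

lemma nn_integral_exp_normal_density:
  fixes b s :: real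
  assumes s: "0 < s"
  shows "(\<integral>\<^sup>+x. ennreal (normal_density 0 s x * exp (b * x)) \<partial>lborel) = ennreal (exp (s\<^sup>2 * b\<^sup>2 / 2))"
proof -
  have shift: "normal_density 0 s x * exp (b * x) = exp (s\<^sup>2 * b\<^sup>2 / 2) * normal_density (b * s\<^sup>2) s x" for x
  proof -
    have "- (x\<^sup>2) / (2 * s\<^sup>2) + b * x = s\<^sup>2 * b\<^sup>2 / 2 + - ((x - b * s\<^sup>2)\<^sup>2) / (2 * s\<^sup>2)"
      using s by (simp add: field_simps power2_eq_square)
    then have "exp (- (x\<^sup>2) / (2 * s\<^sup>2)) * exp (b * x) = exp (s\<^sup>2 * b\<^sup>2 / 2) * exp (- ((x - b * s\<^sup>2)\<^sup>2) / (2 * s\<^sup>2))"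
      by (simp only: exp_add[symmetric])
    then show ?thesis unfolding normal_density_def by (simp add: mult_ac)
  qed
  interpret N: prob_space "density lborel (normal_density (b * s\<^sup>2) s)"
    by (rule prob_space_normal_density[OF s])
  have one: "(\<integral>\<^sup>+x. ennreal (normal_density (b * s\<^sup>2) s x) \<partial>lborel) = 1"
    using N.emeasure_space_1 by (simp add: emeasure_density)
  show ?thesis unfolding shift
    by (subst ennreal_mult) (auto simp: nn_integral_cmult one)
qed

lemma mvn_density_scaled_identity:
  assumes s: "0 < s"
  shows "mvn_density (s\<^sup>2 \<cdot>\<^sub>m 1\<^sub>m n) x = (\<Prod>i<n. normal_density 0 s (x i))"
proof -
  have inv: "mat_inv (s\<^sup>2 \<cdot>\<^sub>m 1\<^sub>m n) = (1 / s\<^sup>2) \<cdot>\<^sub>m 1\<^sub>m n"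
  proof (rule mat_inv_eq)
    show "s\<^sup>2 \<cdot>\<^sub>m 1\<^sub>m n * ((1 / s\<^sup>2) \<cdot>\<^sub>m 1\<^sub>m n) = 1\<^sub>m n"
      using s by (subst mult_smult_assoc_mat[of _ n n]) (auto intro!: eq_matI)
    show "(1 / s\<^sup>2) \<cdot>\<^sub>m 1\<^sub>m n * (s\<^sup>2 \<cdot>\<^sub>m 1\<^sub>m n) = 1\<^sub>m n"
      using s by (subst mult_smult_assoc_mat[of _ n n]) (auto intro!: eq_matI)
  qed auto
  have mv: "((1 / s\<^sup>2) \<cdot>\<^sub>m 1\<^sub>m n) *\<^sub>v vec n x = (1 / s\<^sup>2) \<cdot>\<^sub>v vec n x"
    by (rule eq_vecI) (auto simp: row_smult)
  have quad: "vec n x \<bullet> (((1 / s\<^sup>2) \<cdot>\<^sub>m 1\<^sub>m n) *\<^sub>v vec n x) = (\<Sum>i<n. (x i)\<^sup>2) / s\<^sup>2"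
    unfolding mv by (subst scalar_prod_sum[of _ n]) (auto simp: power2_eq_square sum_divide_distrib)
  have "(\<Prod>i<n. normal_density 0 s (x i)) = (1 / sqrt (2 * pi * s\<^sup>2)) ^ n * exp (\<Sum>i<n. - ((x i)\<^sup>2 / (2 * s\<^sup>2)))"
    by (simp add: normal_density_def prod.distrib exp_sum prod_dividef power_divide)
  also have "(\<Sum>i<n. - ((x i)\<^sup>2 / (2 * s\<^sup>2))) = - ((\<Sum>i<n. (x i)\<^sup>2) / s\<^sup>2) / 2"
    by (simp add: sum_negf sum_divide_distrib mult.commute)
  also have "(1 / sqrt (2 * pi * s\<^sup>2)) ^ n = 1 / sqrt ((2 * pi) ^ n * (s\<^sup>2) ^ n)"
    by (simp only: power_one_over power_mult_distrib[symmetric] real_sqrt_power)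
  finally show ?thesis
    unfolding mvn_density_def by (simp add: inv quad det_smult)
qed

text \<open>The density of the scaled identity covariance factorizes, so the integral is a product
  of one-dimensional ones. Nonnegative integrals keep integrability questions out.\<close>

lemma gaussian_mgf:
  assumes Z: "mvn_distributed M (s\<^sup>2 \<cdot>\<^sub>m 1\<^sub>m n) Z" and s: "0 < s"
  shows "(\<integral>\<^sup>+\<omega>. ennreal (exp (\<Sum>i<n. a i * Z \<omega> i)) \<partial>M) = ennreal (exp (s\<^sup>2 * (\<Sum>i<n. (a i)\<^sup>2) / 2))"
proof -
  let ?P = "PiM {..<n} (\<lambda>_. lborel :: real measure)"
  have d: "distributed M ?P Z (\<lambda>x. ennreal (mvn_density (s\<^sup>2 \<cdot>\<^sub>m 1\<^sub>m n) x))"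
    using Z by (simp add: mvn_distributed_def)
  interpret product_sigma_finite "\<lambda>_. lborel :: real measure" ..
  have "(\<integral>\<^sup>+\<omega>. ennreal (exp (\<Sum>i<n. a i * Z \<omega> i)) \<partial>M) =
    (\<integral>\<^sup>+x. ennreal (mvn_density (s\<^sup>2 \<cdot>\<^sub>m 1\<^sub>m n) x) * ennreal (exp (\<Sum>i<n. a i * x i)) \<partial>?P)"
    by (rule distributed_nn_integral[OF d, symmetric]) measurable
  also have "\<dots> = (\<integral>\<^sup>+x. (\<Prod>i<n. ennreal (normal_density 0 s (x i) * exp (a i * x i))) \<partial>?P)"
    unfolding mvn_density_scaled_identity[OF s]
    by (intro nn_integral_cong)
      (simp add: exp_sum prod_ennreal prod_nonneg ennreal_mult[symmetric] prod.distrib)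
  also have "\<dots> = (\<Prod>i<n. \<integral>\<^sup>+x. ennreal (normal_density 0 s x * exp (a i * x)) \<partial>lborel)"
    by (rule product_nn_integral_prod) auto
  also have "\<dots> = (\<Prod>i<n. ennreal (exp (s\<^sup>2 * (a i)\<^sup>2 / 2)))"
    by (simp add: nn_integral_exp_normal_density[OF s])
  also have "\<dots> = ennreal (exp (s\<^sup>2 * (\<Sum>i<n. (a i)\<^sup>2) / 2))"
    by (simp add: prod_ennreal exp_sum[symmetric] sum_distrib_left sum_divide_distrib)
  finally show ?thesis .
qed

text \<open>Chernoff bound conditionally on \<open>V\<close>: by independence the coefficients may be frozen.\<close>

lemma gaussian_linear_upper_tail:
  fixes V :: "'a \<Rightarrow> 'b"
  assumes M: "prob_space M" and V[measurable]: "V \<in> measurable M T"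
    and joint: "distr M T V \<Otimes>\<^sub>M distr M (PiM {..<n} (\<lambda>_. lborel)) Z
      = distr M (T \<Otimes>\<^sub>M PiM {..<n} (\<lambda>_. lborel)) (\<lambda>\<omega>. (V \<omega>, Z \<omega>))"
    and Z: "mvn_distributed M (s\<^sup>2 \<cdot>\<^sub>m 1\<^sub>m n) Z" and s: "0 < s"
    and a: "\<And>i. i < n \<Longrightarrow> (\<lambda>v. a v i) \<in> borel_measurable T"
    and K: "0 < K" and t: "0 \<le> t"
  shows "emeasure M {\<omega> \<in> space M. (\<Sum>i<n. (a (V \<omega>) i)\<^sup>2) \<le> K \<and> t < (\<Sum>i<n. a (V \<omega>) i * Z \<omega> i)}
    \<le> ennreal (exp (- (t\<^sup>2 / (2 * s\<^sup>2 * K))))"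
proof -
  interpret prob_space M by (rule M)
  let ?P = "PiM {..<n} (\<lambda>_. lborel :: real measure)"
  have Zm[measurable]: "Z \<in> measurable M ?P"
    using Z distributed_measurable by (auto simp: mvn_distributed_def)
  have Zi[measurable]: "(\<lambda>\<omega>. Z \<omega> i) \<in> borel_measurable M" if "i \<in> {..<n}" for i
    using measurable_compose[OF Zm measurable_component_singleton[OF that]] by simp
  \<comment> \<open>The Chernoff parameter minimizing -r t + s^2 r^2 K / 2.\<close>
  define r where "r = t / (s\<^sup>2 * K)"
  have r: "0 \<le> r" using s K t by (simp add: r_def)
  \<comment> \<open>The indicator stays inside the exponential moment, so that integrating out z
    gives a bound uniform in v.\<close>
  define g where "g = (\<lambda>(v, z). indicator {v. (\<Sum>i<n. (a v i)\<^sup>2) \<le> K} v * ennreal (exp (\<Sum>i<n. (r * a v i) * z i)))"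
  note a[measurable]
  have g[measurable]: "g \<in> borel_measurable (T \<Otimes>\<^sub>M ?P)"
    unfolding g_def by measurable
  interpret PZ: prob_space "distr M ?P Z" by (rule prob_space_distr) simp
  interpret PV: prob_space "distr M T V" by (rule prob_space_distr) simp
  have "(\<integral>\<^sup>+\<omega>. g (V \<omega>, Z \<omega>) \<partial>M) = (\<integral>\<^sup>+x. g x \<partial>distr M (T \<Otimes>\<^sub>M ?P) (\<lambda>\<omega>. (V \<omega>, Z \<omega>)))"
    by (rule nn_integral_distr[symmetric]) measurable
  also have "\<dots> = (\<integral>\<^sup>+v. \<integral>\<^sup>+z. g (v, z) \<partial>distr M ?P Z \<partial>distr M T V)"
    \<comment> \<open>Independence enters here: Fubini integrates the noise with v fixed.\<close>
    unfolding joint[symmetric] by (rule PZ.nn_integral_fst[symmetric]) measurable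
  also have "\<dots> \<le> (\<integral>\<^sup>+v. ennreal (exp (s\<^sup>2 * r\<^sup>2 * K / 2)) \<partial>distr M T V)"
  proof (rule nn_integral_mono)
    fix v assume "v \<in> space (distr M T V)"
    then have v[measurable]: "v \<in> space T" by simp
    have "(\<integral>\<^sup>+z. g (v, z) \<partial>distr M ?P Z) = (\<integral>\<^sup>+\<omega>. g (v, Z \<omega>) \<partial>M)"
      by (rule nn_integral_distr) (use v in measurable)
    also have "\<dots> = indicator {v. (\<Sum>i<n. (a v i)\<^sup>2) \<le> K} v * (\<integral>\<^sup>+\<omega>. ennreal (exp (\<Sum>i<n. (r * a v i) * Z \<omega> i)) \<partial>M)"
      unfolding g_def prod.case by (rule nn_integral_cmult) measurable
    also have "\<dots> = indicator {v. (\<Sum>i<n. (a v i)\<^sup>2) \<le> K} v * ennreal (exp (s\<^sup>2 * r\<^sup>2 * (\<Sum>i<n. (a v i)\<^sup>2) / 2))"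
      unfolding gaussian_mgf[OF Z s] by (simp add: power_mult_distrib sum_distrib_left mult_ac)
    also have "\<dots> \<le> ennreal (exp (s\<^sup>2 * r\<^sup>2 * K / 2))"
      by (auto simp: indicator_def intro!: ennreal_leI divide_right_mono mult_left_mono)
    finally show "(\<integral>\<^sup>+z. g (v, z) \<partial>distr M ?P Z) \<le> ennreal (exp (s\<^sup>2 * r\<^sup>2 * K / 2))" .
  qed
  also have "\<dots> = ennreal (exp (s\<^sup>2 * r\<^sup>2 * K / 2))" by (simp add: PV.emeasure_space_1[simplified])
  finally have G: "(\<integral>\<^sup>+\<omega>. g (V \<omega>, Z \<omega>) \<partial>M) \<le> ennreal (exp (s\<^sup>2 * r\<^sup>2 * K / 2))" .
  let ?E = "{\<omega> \<in> space M. (\<Sum>i<n. (a (V \<omega>) i)\<^sup>2) \<le> K \<and> t < (\<Sum>i<n. a (V \<omega>) i * Z \<omega> i)}"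
  have Em: "?E \<in> sets M" by measurable
  have "emeasure M ?E = (\<integral>\<^sup>+\<omega>. indicator ?E \<omega> \<partial>M)" using Em by simp
  also have "\<dots> \<le> (\<integral>\<^sup>+\<omega>. ennreal (exp (- r * t)) * g (V \<omega>, Z \<omega>) \<partial>M)"
  proof (rule nn_integral_mono)
    fix \<omega> assume "\<omega> \<in> space M"
    show "indicator ?E \<omega> \<le> ennreal (exp (- r * t)) * g (V \<omega>, Z \<omega>)"
    proof (cases "\<omega> \<in> ?E")
      case True
      have "r * t \<le> r * (\<Sum>i<n. a (V \<omega>) i * Z \<omega> i)" using True r by (intro mult_left_mono) auto
      then have "1 \<le> exp (- r * t + (\<Sum>i<n. (r * a (V \<omega>) i) * Z \<omega> i))"
        by (simp add: sum_distrib_left mult_ac)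
      then have "1 \<le> exp (- r * t) * exp (\<Sum>i<n. (r * a (V \<omega>) i) * Z \<omega> i)"
        by (simp only: exp_add)
      then have "1 \<le> ennreal (exp (- r * t) * exp (\<Sum>i<n. (r * a (V \<omega>) i) * Z \<omega> i))"
        by (metis ennreal_1 ennreal_leI)
      then show ?thesis using True by (simp add: g_def ennreal_mult)
    qed simp
  qed
  also have "\<dots> = ennreal (exp (- r * t)) * (\<integral>\<^sup>+\<omega>. g (V \<omega>, Z \<omega>) \<partial>M)"
    by (rule nn_integral_cmult) measurable
  also have "\<dots> \<le> ennreal (exp (- r * t)) * ennreal (exp (s\<^sup>2 * r\<^sup>2 * K / 2))"
    by (rule mult_left_mono[OF G]) simp
  also have "\<dots> = ennreal (exp (- r * t + s\<^sup>2 * r\<^sup>2 * K / 2))"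
    by (simp only: exp_add ennreal_mult[symmetric] exp_ge_zero)
  also have "- r * t + s\<^sup>2 * r\<^sup>2 * K / 2 = - (t\<^sup>2 / (2 * s\<^sup>2 * K))"
    using s K by (simp add: r_def field_simps power2_eq_square)
  finally show ?thesis .
qed

text \<open>The one-sided bound is applied to the coefficients and to their negatives, which have
  the same squared norm.\<close>

lemma gaussian_linear_tail:
  fixes V :: "'a \<Rightarrow> 'b"
  assumes M: "prob_space M" and V[measurable]: "V \<in> measurable M T"
    and joint: "distr M T V \<Otimes>\<^sub>M distr M (PiM {..<n} (\<lambda>_. lborel)) Z
      = distr M (T \<Otimes>\<^sub>M PiM {..<n} (\<lambda>_. lborel)) (\<lambda>\<omega>. (V \<omega>, Z \<omega>))"
    and Z: "mvn_distributed M (s\<^sup>2 \<cdot>\<^sub>m 1\<^sub>m n) Z" and s: "0 < s"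
    and a: "\<And>i. i < n \<Longrightarrow> (\<lambda>v. a v i) \<in> borel_measurable T"
    and K: "0 < K" and t: "0 \<le> t"
  shows "measure M {\<omega> \<in> space M. (\<Sum>i<n. (a (V \<omega>) i)\<^sup>2) \<le> K \<and> t < \<bar>\<Sum>i<n. a (V \<omega>) i * Z \<omega> i\<bar>}
    \<le> 2 * exp (- (t\<^sup>2 / (2 * s\<^sup>2 * K)))" (is "measure M ?E \<le> _")
    and "{\<omega> \<in> space M. (\<Sum>i<n. (a (V \<omega>) i)\<^sup>2) \<le> K \<and> t < \<bar>\<Sum>i<n. a (V \<omega>) i * Z \<omega> i\<bar>} \<in> sets M"
proof -
  interpret prob_space M by (rule M)
  let ?P = "PiM {..<n} (\<lambda>_. lborel :: real measure)"
  have Zm[measurable]: "Z \<in> measurable M ?P"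
    using Z distributed_measurable by (auto simp: mvn_distributed_def)
  have Zi[measurable]: "(\<lambda>\<omega>. Z \<omega> i) \<in> borel_measurable M" if "i \<in> {..<n}" for i
    using measurable_compose[OF Zm measurable_component_singleton[OF that]] by simp
  note a[measurable]
  show "?E \<in> sets M" by measurable
  let ?E1 = "{\<omega> \<in> space M. (\<Sum>i<n. (a (V \<omega>) i)\<^sup>2) \<le> K \<and> t < (\<Sum>i<n. a (V \<omega>) i * Z \<omega> i)}"
  let ?E2 = "{\<omega> \<in> space M. (\<Sum>i<n. (- a (V \<omega>) i)\<^sup>2) \<le> K \<and> t < (\<Sum>i<n. - a (V \<omega>) i * Z \<omega> i)}"
  have E12: "?E1 \<in> sets M" "?E2 \<in> sets M" by measurable
  have m1: "measure M ?E1 \<le> exp (- (t\<^sup>2 / (2 * s\<^sup>2 * K)))"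
    using gaussian_linear_upper_tail[OF M V joint Z s a K t] by (simp add: emeasure_eq_measure)
  have m2: "measure M ?E2 \<le> exp (- (t\<^sup>2 / (2 * s\<^sup>2 * K)))"
    using gaussian_linear_upper_tail[OF M V joint Z s _ K t, of "\<lambda>v i. - a v i"] a by (simp add: emeasure_eq_measure)
  have "?E \<subseteq> ?E1 \<union> ?E2" by (auto simp: abs_if sum_negf split: if_splits)
  then have "measure M ?E \<le> measure M (?E1 \<union> ?E2)" using E12 by (intro finite_measure_mono) auto
  also have "\<dots> \<le> measure M ?E1 + measure M ?E2" using E12 by (rule measure_Un_le)
  finally show "measure M ?E \<le> 2 * exp (- (t\<^sup>2 / (2 * s\<^sup>2 * K)))" using m1 m2 by simp
qed

text \<open>The two variables of \<open>indep_var\<close> must have the same type, so the independence of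
  variables of different types is expressed through their joint distribution.\<close>

lemma (in prob_space) indep_var_compose_joint_distr:
  assumes ind: "indep_var T V N W" and f[measurable]: "f \<in> measurable N P"
  shows "distr M T V \<Otimes>\<^sub>M distr M P (\<lambda>\<omega>. f (W \<omega>)) = distr M (T \<Otimes>\<^sub>M P) (\<lambda>\<omega>. (V \<omega>, f (W \<omega>)))"
proof -
  have V[measurable]: "V \<in> measurable M T" and W[measurable]: "W \<in> measurable M N"
    using indep_var_rv1[OF ind] indep_var_rv2[OF ind] .
  have W': "distr M P (\<lambda>\<omega>. f (W \<omega>)) = distr (distr M N W) P f"
    by (simp add: distr_distr comp_def)
  \<comment> \<open>The product rule for image measures expects an image in both factors, so V is
    pushed forward by the identity.\<close>
  have V': "distr M T V = distr (distr M T V) T (\<lambda>v. v)"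
    by (simp add: distr_distr comp_def)
  have fin: "prob_space (distr (distr M N W) P f)"
    by (intro prob_space.prob_space_distr prob_space_distr) auto
  have "distr M T V \<Otimes>\<^sub>M distr M P (\<lambda>\<omega>. f (W \<omega>))
    = distr (distr M T V) T (\<lambda>v. v) \<Otimes>\<^sub>M distr (distr M N W) P f"
    unfolding W' using V' by simp
  also have "\<dots> = distr (distr M T V \<Otimes>\<^sub>M distr M N W) (T \<Otimes>\<^sub>M P) (\<lambda>(x, y). (x, f y))"
    using fin by (intro pair_measure_distr prob_space_imp_sigma_finite) auto
  also have "distr M T V \<Otimes>\<^sub>M distr M N W = distr M (T \<Otimes>\<^sub>M N) (\<lambda>\<omega>. (V \<omega>, W \<omega>))"
    using ind indep_var_distribution_eq by blast
  also have "distr \<dots> (T \<Otimes>\<^sub>M P) (\<lambda>(x, y). (x, f y)) = distr M (T \<Otimes>\<^sub>M P) (\<lambda>\<omega>. (V \<omega>, f (W \<omega>)))"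
    by (subst distr_distr) (auto simp: comp_def)
  finally show ?thesis .
qed

section \<open>Measurability\<close>

text \<open>By the Leibniz formula the determinant is a polynomial in the entries.\<close>

lemma borel_measurable_det:
  fixes A :: "'a \<Rightarrow> real mat"
  assumes A: "\<And>v. A v \<in> carrier_mat n n"
    and m: "\<And>i j. i < n \<Longrightarrow> j < n \<Longrightarrow> (\<lambda>v. A v $$ (i, j)) \<in> borel_measurable T"
  shows "(\<lambda>v. det (A v)) \<in> borel_measurable T"
proof -
  have "(\<lambda>v. \<Sum>p | p permutes {0..<n}. signof p * (\<Prod>i = 0..<n. A v $$ (i, p i))) \<in> borel_measurable T"
    by (intro borel_measurable_sum borel_measurable_times borel_measurable_prod borel_measurable_const m)
      (auto simp: permutes_in_image)
  then show ?thesis by (simp add: det_def'[OF A])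
qed

lemma borel_measurable_mat_inv:
  fixes A :: "'a \<Rightarrow> real mat"
  assumes A: "\<And>v. A v \<in> carrier_mat n n"
    and m: "\<And>i j. i < n \<Longrightarrow> j < n \<Longrightarrow> (\<lambda>v. A v $$ (i, j)) \<in> borel_measurable T"
    and det: "\<And>v. det (A v) \<noteq> 0" and ij: "i < n" "j < n"
  shows "(\<lambda>v. mat_inv (A v) $$ (i, j)) \<in> borel_measurable T"
proof -
  \<comment> \<open>Cramer's rule; the indices of the deleted row and column are swapped by the
    transposition in the adjugate.\<close>
  have eq: "mat_inv (A v) $$ (i, j) = (1 / det (A v)) * ((-1) ^ (j + i) * det (mat_delete (A v) j i))" for v
    unfolding mat_inv_adj_mat(1)[OF A det] using A[of v] adj_mat(1)[OF A, of v] ij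
    by (simp add: adj_mat_def cofactor_def)
  have md: "mat_delete (A v) j i \<in> carrier_mat (n - 1) (n - 1)" for v
    using A[of v] by (auto simp: mat_delete_def)
  have "(\<lambda>v. det (mat_delete (A v) j i)) \<in> borel_measurable T"
  proof (rule borel_measurable_det[OF md])
    fix k l assume kl: "k < n - 1" "l < n - 1"
    have "mat_delete (A v) j i $$ (k, l) = A v $$ (if k < j then k else Suc k, if l < i then l else Suc l)" for v
      using A[of v] kl by (simp add: mat_delete_def)
    then show "(\<lambda>v. mat_delete (A v) j i $$ (k, l)) \<in> borel_measurable T"
      using kl by (simp add: m)
  qed
  then show ?thesis unfolding eq using borel_measurable_det[OF A m] by (intro borel_measurable_times borel_measurable_divide borel_measurable_const)
qed

context
  fixes X :: "'a \<Rightarrow> real mat" and T :: "'a measure" and n p q :: nat and S :: "real mat" and e :: real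
  assumes X: "\<And>v. X v \<in> carrier_mat n p"
    and Xm: "\<And>i j. i < n \<Longrightarrow> j < p \<Longrightarrow> (\<lambda>v. X v $$ (i, j)) \<in> borel_measurable T"
    and S: "S \<in> carrier_mat p p" and pd: "sym_pos_def_mat S"
    and q: "q \<le> p" and n: "0 < n" and e: "0 < e"
begin

text \<open>Valid for every v, also outside \<open>space T\<close>, so the entry formulas for
  \<open>H_A\<close>, \<open>H_B\<close> and \<open>gic_vec\<close> can be rewritten under the
  binder in the measurability proofs.\<close>

lemma calC11_inverse_carrier: "mat_inv (calC11 (X v) S q e) \<in> carrier_mat q q"
  using calC11_carrier sym_pos_def_calC11[OF X S pd q n e] by (intro sym_pos_def_mat_inv(2)) auto

lemma borel_measurable_calC11_inverse:
  assumes "i < q" "j < q"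
  shows "(\<lambda>v. mat_inv (calC11 (X v) S q e) $$ (i, j)) \<in> borel_measurable T"
proof (rule borel_measurable_mat_inv[OF calC11_carrier _ _ assms])
  fix i j assume ij: "i < q" "j < q"
  show "(\<lambda>v. calC11 (X v) S q e $$ (i, j)) \<in> borel_measurable T"
    unfolding index_calC11[OF X S q ij] using ij q
    by (intro borel_measurable_add borel_measurable_times borel_measurable_const borel_measurable_sum Xm) auto
qed (rule sym_pos_def_mat_det[OF calC11_carrier sym_pos_def_calC11[OF X S pd q n e]])

lemma borel_measurable_calC21:
  assumes "i < p - q" "j < q"
  shows "(\<lambda>v. calC21 (X v) S q e $$ (i, j)) \<in> borel_measurable T"
  unfolding index_calC21[OF X S q assms] using assms
  by (intro borel_measurable_add borel_measurable_times borel_measurable_const borel_measurable_sum Xm) auto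

lemma borel_measurable_irrep_mat:
  assumes "j < p - q" "m < q"
  shows "(\<lambda>v. irrep_mat (X v) S q e j m) \<in> borel_measurable T"
  unfolding irrep_mat_def using assms
  by (intro borel_measurable_times borel_measurable_sum borel_measurable_calC21 borel_measurable_calC11_inverse) auto

lemma borel_measurable_H_A:
  assumes "i < q" "k < n"
  shows "(\<lambda>v. H_A (X v) S q e $$ (i, k)) \<in> borel_measurable T"
  unfolding index_H_A[OF X calC11_inverse_carrier assms] using assms q
  by (intro borel_measurable_times borel_measurable_const borel_measurable_sum borel_measurable_calC11_inverse Xm) auto

lemma borel_measurable_H_B:
  assumes "j < p - q" "k < n"
  shows "(\<lambda>v. H_B (X v) S q e $$ (j, k)) \<in> borel_measurable T"
  unfolding index_H_B[OF X S calC11_inverse_carrier q assms] using assms q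
  by (intro borel_measurable_times borel_measurable_const borel_measurable_sum borel_measurable_diff
      borel_measurable_irrep_mat Xm) auto

lemma borel_measurable_gic_vec:
  assumes b1: "b1 \<in> carrier_vec q" and j: "j < p - q"
  shows "(\<lambda>v. gic_vec (X v) S q b1 l e $ j) \<in> borel_measurable T"
  unfolding index_gic_vec[OF X S calC11_inverse_carrier b1 q j] using j
  by (intro borel_measurable_times borel_measurable_const borel_measurable_sum borel_measurable_diff
      borel_measurable_irrep_mat) auto

lemma borel_measurable_noise_corr:
  assumes w: "\<And>k. k < n \<Longrightarrow> (\<lambda>v. w v k) \<in> borel_measurable T" and j: "j < p"
  shows "(\<lambda>v. noise_corr (X v) (w v) j) \<in> borel_measurable T"
proof -
  have "dim_row (X v) = n" for v using X[of v] by simp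
  then show ?thesis
    unfolding noise_corr_def using j
    by (auto intro!: borel_measurable_times borel_measurable_const borel_measurable_sum borel_measurable_divide Xm w)
qed

lemma borel_measurable_oracle_error:
  assumes w: "\<And>k. k < n \<Longrightarrow> (\<lambda>v. w v k) \<in> borel_measurable T" and i: "i < q"
  shows "(\<lambda>v. oracle_error (X v) S q b1 l e (w v) i) \<in> borel_measurable T"
proof -
  have dim: "dim_row (X v) = n" for v using X[of v] by simp
  show ?thesis
    unfolding oracle_error_def dim using i q
    by (intro borel_measurable_times borel_measurable_const borel_measurable_sum borel_measurable_diff
      borel_measurable_noise_corr w borel_measurable_calC11_inverse) auto
qed

text \<open>A finite intersection of conditions on Borel functions. Through the equivalence with
  sign recovery it covers an estimator that is itself defined by a description operator.\<close>

lemma sets_sign_recovery: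
  assumes w: "\<And>k. k < n \<Longrightarrow> (\<lambda>v. w v k) \<in> borel_measurable T"
  shows "{v \<in> space T. sign_recovery (X v) S q b1 l e (w v)} \<in> sets T"
proof -
  have dim: "dim_row (X v) = n" "dim_col (X v) = p" for v using X[of v] by simp_all
  have 1: "{v \<in> space T. sgn (b1 $ i + oracle_error (X v) S q b1 l e (w v) i) = sgn (b1 $ i)} \<in> sets T" if i: "i < q" for i
  proof -
    have m: "(\<lambda>v. b1 $ i + oracle_error (X v) S q b1 l e (w v) i) \<in> borel_measurable T"
      by (intro borel_measurable_add borel_measurable_const borel_measurable_oracle_error w i)
    then have "(\<lambda>v. sgn (b1 $ i + oracle_error (X v) S q b1 l e (w v) i)) \<in> borel_measurable T"
      by measurable
    then show ?thesis by measurable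
  qed
  have 2: "{v \<in> space T. \<bar>(\<Sum>i<q. calC21 (X v) S q e $$ (j, i) * oracle_error (X v) S q b1 l e (w v) i)
      - noise_corr (X v) (w v) (q + j) + e / real n * (\<Sum>i<q. S $$ (q + j, i) * b1 $ i)\<bar>
      \<le> l / (2 * real n)} \<in> sets T" if j: "j < p - q" for j
  proof -
    have "(\<lambda>v. (\<Sum>i<q. calC21 (X v) S q e $$ (j, i) * oracle_error (X v) S q b1 l e (w v) i)
      - noise_corr (X v) (w v) (q + j) + e / real n * (\<Sum>i<q. S $$ (q + j, i) * b1 $ i)) \<in> borel_measurable T"
      using j by (intro borel_measurable_add borel_measurable_const borel_measurable_diff borel_measurable_sum
        borel_measurable_times borel_measurable_calC21 borel_measurable_oracle_error borel_measurable_noise_corr w) auto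
    then show ?thesis by measurable
  qed
  have "{v \<in> space T. sign_recovery (X v) S q b1 l e (w v)} =
    {v \<in> space T. (\<forall>i\<in>{..<q}. sgn (b1 $ i + oracle_error (X v) S q b1 l e (w v) i) = sgn (b1 $ i)) \<and>
     (\<forall>j\<in>{..<p - q}. \<bar>(\<Sum>i<q. calC21 (X v) S q e $$ (j, i) * oracle_error (X v) S q b1 l e (w v) i)
      - noise_corr (X v) (w v) (q + j) + e / real n * (\<Sum>i<q. S $$ (q + j, i) * b1 $ i)\<bar>
      \<le> l / (2 * real n))}"
    by (auto simp: sign_recovery_def dim)
  also have "\<dots> \<in> sets T"
    by (intro sets.sets_Collect_conj sets.sets_Collect_finite_All 1 2) auto
  finally show ?thesis .
qed

end

section \<open>The failure probability\<close>

text \<open>Equality for an event; for a set that is not measurable the right-hand side is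
  1.\<close>

lemma (in prob_space) prob_not_le:
  "prob {\<omega> \<in> space M. \<not> P \<omega>} \<le> 1 - prob {\<omega> \<in> space M. P \<omega>}"
proof (cases "{\<omega> \<in> space M. P \<omega>} \<in> sets M")
  case True
  have "{\<omega> \<in> space M. \<not> P \<omega>} = space M - {\<omega> \<in> space M. P \<omega>}" by auto
  then show ?thesis using prob_compl[OF True] by simp
next
  case False
  then show ?thesis using prob_le_1 by (simp add: measure_notin_sets)
qed

text \<open>The union bound for a single n. V is the design as a random element of T, and F reads
  the matrix from it, so that matrix functionals become Borel functions on T.\<close>

lemma sign_recovery_failure_prob:
  fixes F :: "'b \<Rightarrow> real mat" and W :: "'a \<Rightarrow> nat \<Rightarrow> real"
  assumes M: "prob_space M" and V: "V \<in> measurable M T"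
    and joint: "distr M T V \<Otimes>\<^sub>M distr M (PiM {..<n} (\<lambda>_. lborel)) W
      = distr M (T \<Otimes>\<^sub>M PiM {..<n} (\<lambda>_. lborel)) (\<lambda>\<omega>. (V \<omega>, W \<omega>))"
    and W: "mvn_distributed M (s\<^sup>2 \<cdot>\<^sub>m 1\<^sub>m n) W" and s: "0 < s"
    and F: "\<And>v. F v \<in> carrier_mat n p"
    and Fm: "\<And>i j. i < n \<Longrightarrow> j < p \<Longrightarrow> (\<lambda>v. F v $$ (i, j)) \<in> borel_measurable T"
    and S: "S \<in> carrier_mat p p" and pd: "sym_pos_def_mat S"
    and q: "0 < q" "q \<le> p" and n: "0 < n" and l: "0 < l" and e: "0 < e"
    and b1: "b1 \<in> carrier_vec q" and nz: "\<forall>j<q. b1 $ j \<noteq> 0"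
    and bmin: "0 < bmin" "\<And>j. j < q \<Longrightarrow> bmin \<le> \<bar>b1 $ j\<bar>"
    and Mpos: "0 < M1" "0 < M2" "0 < M3" "0 < alpha"
    and lam: "l / real n < 2 * bmin / (3 * M2 * sqrt (real q))"
    and eta: "e / real n < 1 / (3 * M2 * lambda_max (blk11 S q)) * (bmin / sqrt (sq_norm_v b1))"
    and gic: "\<And>j. j < p - q \<Longrightarrow> measure M {\<omega> \<in> space M. \<bar>gic_vec (F (V \<omega>)) S q b1 l e $ j\<bar> > 1 - alpha} \<le> g"
  defines "bs \<equiv> vec p (\<lambda>j. if j < q then b1 $ j else 0)"
  shows "1 - measure M {\<omega> \<in> space M. \<forall>j<p. sgn (gEN (F (V \<omega>)) (F (V \<omega>) *\<^sub>v bs + vec n (W \<omega>)) S l e $ j) = sgn (bs $ j)}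
    \<le> (1 - measure M {\<omega> \<in> space M. lambda_max (H_A (F (V \<omega>)) S q e * transpose_mat (H_A (F (V \<omega>)) S q e)) \<le> M1})
    + (1 - measure M {\<omega> \<in> space M. lambda_max (mat_inv (calC11 (F (V \<omega>)) S q e)) \<le> M2})
    + (1 - measure M {\<omega> \<in> space M. lambda_max (H_B (F (V \<omega>)) S q e * transpose_mat (H_B (F (V \<omega>)) S q e)) \<le> M3})
    + real (p - q) * g
    + real q * (2 * exp (- ((sqrt (real n) * bmin / 3)\<^sup>2 / (2 * s\<^sup>2 * M1))))
    + real (p - q) * (2 * exp (- ((alpha * l / (2 * sqrt (real n)))\<^sup>2 / (2 * s\<^sup>2 * M3))))"
    (is "1 - measure M ?R \<le> (1 - measure M {\<omega> \<in> space M. ?PA \<omega>}) + (1 - measure M {\<omega> \<in> space M. ?PC \<omega>})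
      + (1 - measure M {\<omega> \<in> space M. ?PB \<omega>}) + real (p - q) * g + real q * ?eA + real (p - q) * ?eB")
proof -
  interpret prob_space M by (rule M)
  let ?X = "\<lambda>\<omega>. F (V \<omega>)"
  have Wm: "W \<in> measurable M (PiM {..<n} (\<lambda>_. lborel))"
    using W distributed_measurable by (auto simp: mvn_distributed_def)
  have Wi: "(\<lambda>\<omega>. W \<omega> k) \<in> borel_measurable M" if "k < n" for k
    using measurable_compose[OF Wm measurable_component_singleton[of k]] that by simp
  have Xm: "(\<lambda>\<omega>. ?X \<omega> $$ (i, j)) \<in> borel_measurable M" if "i < n" "j < p" for i j
    using measurable_compose[OF V Fm[OF that]] .
  have R: "?R = {\<omega> \<in> space M. sign_recovery (?X \<omega>) S q b1 l e (W \<omega>)}"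
    unfolding bs_def using sign_gEN_iff[OF F S pd q(2) n l e b1 nz] by blast
  have Rm: "?R \<in> sets M"
    unfolding R by (rule sets_sign_recovery[OF F Xm S pd q(2) n e Wi])
  let ?tA = "sqrt (real n) * bmin / 3" and ?tB = "alpha * l / (2 * sqrt (real n))"
  define BA where "BA = {\<omega> \<in> space M. \<not> ?PA \<omega>}"
  define BC where "BC = {\<omega> \<in> space M. \<not> ?PC \<omega>}"
  define BB where "BB = {\<omega> \<in> space M. \<not> ?PB \<omega>}"
  define BG where "BG j = {\<omega> \<in> space M. \<bar>gic_vec (?X \<omega>) S q b1 l e $ j\<bar> > 1 - alpha}" for j
  \<comment> \<open>Truncation by the row norm, a measurable function of the design, which the
    eigenvalue bound implies.\<close>
  define TA where "TA i = {\<omega> \<in> space M. (\<Sum>k<n. (H_A (?X \<omega>) S q e $$ (i, k))\<^sup>2) \<le> M1 \<and>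
     ?tA < \<bar>\<Sum>k<n. H_A (?X \<omega>) S q e $$ (i, k) * W \<omega> k\<bar>}" for i
  define TB where "TB j = {\<omega> \<in> space M. (\<Sum>k<n. (H_B (?X \<omega>) S q e $$ (j, k))\<^sup>2) \<le> M3 \<and>
     ?tB < \<bar>\<Sum>k<n. H_B (?X \<omega>) S q e $$ (j, k) * W \<omega> k\<bar>}" for j
  have tA: "0 \<le> ?tA" and tB: "0 \<le> ?tB" using n bmin l Mpos by auto
  have TA: "TA i \<in> sets M" "measure M (TA i) \<le> ?eA" if i: "i < q" for i
    unfolding TA_def
    using gaussian_linear_tail[OF M V joint W s borel_measurable_H_A[OF F Fm S pd q(2) n e i] Mpos(1) tA]
    by auto
  have TB: "TB j \<in> sets M" "measure M (TB j) \<le> ?eB" if j: "j < p - q" for j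
    unfolding TB_def
    using gaussian_linear_tail[OF M V joint W s borel_measurable_H_B[OF F Fm S pd q(2) n e j] Mpos(3) tB]
    by auto
  have BG: "BG j \<in> sets M" if j: "j < p - q" for j
  proof -
    have [measurable]: "(\<lambda>\<omega>. gic_vec (?X \<omega>) S q b1 l e $ j) \<in> borel_measurable M"
      by (rule borel_measurable_gic_vec[OF F Xm S pd q(2) n e b1 j])
    show ?thesis unfolding BG_def by measurable
  qed
  show ?thesis
  \<comment> \<open>Separates the case in which all three eigenvalue events are measurable.\<close>
  proof (cases "{\<omega> \<in> space M. ?PA \<omega>} \<in> sets M \<and> {\<omega> \<in> space M. ?PC \<omega>} \<in> sets M \<and> {\<omega> \<in> space M. ?PB \<omega>} \<in> sets M")
    case True
    have compl: "{\<omega> \<in> space M. \<not> P \<omega>} \<in> sets M" if "{\<omega> \<in> space M. P \<omega>} \<in> sets M" for P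
    proof -
      have "{\<omega> \<in> space M. \<not> P \<omega>} = space M - {\<omega> \<in> space M. P \<omega>}" by auto
      then show ?thesis using sets.compl_sets[OF that] by simp
    qed
    have BABC: "BA \<in> sets M" "BC \<in> sets M" "BB \<in> sets M"
      unfolding BA_def BC_def BB_def using True by (intro compl; blast)+
    define UG where "UG = (\<Union>j\<in>{..<p - q}. BG j)"
    define UA where "UA = (\<Union>i\<in>{..<q}. TA i)"
    define UB where "UB = (\<Union>j\<in>{..<p - q}. TB j)"
    have U: "UG \<in> sets M" "UA \<in> sets M" "UB \<in> sets M"
      unfolding UG_def UA_def UB_def using BG TA TB by auto
    have sub: "space M - ?R \<subseteq> BA \<union> BC \<union> BB \<union> UG \<union> UA \<union> UB"
    proof (rule subsetI, rule ccontr)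
      fix \<omega> assume 1: "\<omega> \<in> space M - ?R" and 2: "\<omega> \<notin> BA \<union> BC \<union> BB \<union> UG \<union> UA \<union> UB"
      have w: "\<omega> \<in> space M" using 1 by simp
      have A: "?PA \<omega>" and C: "?PC \<omega>" and B: "?PB \<omega>" using 2 w by (auto simp: BA_def BC_def BB_def)
      note I = calC11_inverse_carrier[OF F Fm S pd q(2) n e, of "V \<omega>"]
      have "sign_recovery (?X \<omega>) S q b1 l e (W \<omega>)"
      proof (rule sign_recovery_sufficient[OF F S pd q n l e b1 nz bmin Mpos(2) C lam eta])
        fix i assume i: "i < q"
        have "(\<Sum>k<n. (H_A (?X \<omega>) S q e $$ (i, k))\<^sup>2) \<le> M1"
          using row_norm_le_lambda_max[OF carrier_H_A[OF I F] i] A by simp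
        moreover have "\<omega> \<notin> TA i" using 2 i by (auto simp: UA_def)
        ultimately show "\<bar>\<Sum>k<n. H_A (?X \<omega>) S q e $$ (i, k) * W \<omega> k\<bar> \<le> ?tA" using w by (auto simp: TA_def)
      next
        fix j assume j: "j < p - q"
        have "(\<Sum>k<n. (H_B (?X \<omega>) S q e $$ (j, k))\<^sup>2) \<le> M3"
          using row_norm_le_lambda_max[OF carrier_H_B[OF I F S] j] B by simp
        moreover have "\<omega> \<notin> TB j" using 2 j by (auto simp: UB_def)
        ultimately show "\<bar>\<Sum>k<n. H_B (?X \<omega>) S q e $$ (j, k) * W \<omega> k\<bar> \<le> ?tB" using w by (auto simp: TB_def)
        have "\<omega> \<notin> BG j" using 2 j by (auto simp: UG_def)
        then show "\<bar>gic_vec (?X \<omega>) S q b1 l e $ j\<bar> \<le> 1 - alpha" using w by (auto simp: BG_def)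
      qed
      then show False using 1 unfolding R by simp
    qed
    have "1 - measure M ?R = measure M (space M - ?R)" using prob_compl[OF Rm] by simp
    also have "\<dots> \<le> measure M (BA \<union> BC \<union> BB \<union> UG \<union> UA \<union> UB)"
      using sub BABC U by (intro finite_measure_mono) auto
    also have "\<dots> \<le> measure M BA + measure M BC + measure M BB + measure M UG + measure M UA + measure M UB"
      using BABC U by (intro order_trans[OF measure_Un_le] add_mono order_refl) auto
    also have "measure M BA \<le> 1 - measure M {\<omega> \<in> space M. ?PA \<omega>}" unfolding BA_def by (rule prob_not_le)
    also have "measure M BC \<le> 1 - measure M {\<omega> \<in> space M. ?PC \<omega>}" unfolding BC_def by (rule prob_not_le)
    also have "measure M BB \<le> 1 - measure M {\<omega> \<in> space M. ?PB \<omega>}" unfolding BB_def by (rule prob_not_le)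
    also have "measure M UG \<le> (\<Sum>j\<in>{..<p - q}. measure M (BG j))"
      unfolding UG_def using BG by (intro finite_measure_subadditive_finite) auto
    also have "\<dots> \<le> real (p - q) * g"
      using sum_bounded_above[of "{..<p - q}" "\<lambda>j. measure M (BG j)" g] gic by (simp add: BG_def)
    also have "measure M UA \<le> (\<Sum>i\<in>{..<q}. measure M (TA i))"
      unfolding UA_def using TA by (intro finite_measure_subadditive_finite) auto
    also have "\<dots> \<le> real q * ?eA"
      using sum_bounded_above[of "{..<q}" "\<lambda>j. measure M (TA j)" ?eA] TA by simp
    also have "measure M UB \<le> (\<Sum>j\<in>{..<p - q}. measure M (TB j))"
      unfolding UB_def using TB by (intro finite_measure_subadditive_finite) auto
    also have "\<dots> \<le> real (p - q) * ?eB"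
      using sum_bounded_above[of "{..<p - q}" "\<lambda>j. measure M (TB j)" ?eB] TB by simp
    finally show ?thesis by simp
  next
    case False
    \<comment> \<open>A set that is not measurable has \<open>measure\<close> 0, so one summand of
      the bound is 1 and the others are nonnegative.\<close>
    then have "measure M {\<omega> \<in> space M. ?PA \<omega>} = 0 \<or> measure M {\<omega> \<in> space M. ?PC \<omega>} = 0 \<or> measure M {\<omega> \<in> space M. ?PB \<omega>} = 0"
      using measure_notin_sets by blast
    then have "1 \<le> (1 - measure M {\<omega> \<in> space M. ?PA \<omega>}) + (1 - measure M {\<omega> \<in> space M. ?PC \<omega>})
      + (1 - measure M {\<omega> \<in> space M. ?PB \<omega>})"
      using prob_le_1[of "{\<omega> \<in> space M. ?PA \<omega>}"] prob_le_1[of "{\<omega> \<in> space M. ?PC \<omega>}"]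
        prob_le_1[of "{\<omega> \<in> space M. ?PB \<omega>}"] by linarith
    moreover have "0 \<le> real (p - q) * g"
    proof (cases "p - q = 0")
      case False
      \<comment> \<open>The bound g dominates a probability as soon as there is one coordinate off
        the support.\<close>
      then show ?thesis using order_trans[OF measure_nonneg gic[of 0]] by simp
    qed simp
    moreover have "0 \<le> measure M ?R" by simp
    moreover have "0 \<le> real q * ?eA" "0 \<le> real (p - q) * ?eB" by simp_all
    ultimately show ?thesis by linarith
  qed
qed

text \<open>Factor c f as (f / g)(c g). It is applied with c = 1 to the eigenvalue terms and with c
  = p to the irrepresentable term, where the union bound costs a factor p.\<close>

lemma smallo_mult_tendsto_0:
  fixes f g c :: "nat \<Rightarrow> real"
  assumes "f \<in> o(g)" "\<And>n. g n \<noteq> 0" "(\<lambda>n. c n * g n) \<longlonglongrightarrow> 0"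
  shows "(\<lambda>n. c n * f n) \<longlonglongrightarrow> 0"
proof -
  have "(\<lambda>n. (f n / g n) * (c n * g n)) \<longlonglongrightarrow> 0 * 0"
    by (intro tendsto_mult smalloD_tendsto assms)
  moreover have "(f n / g n) * (c n * g n) = c n * f n" for n using assms(2)[of n] by (simp add: field_simps)
  ultimately show ?thesis by simp
qed

theorem theorem1:
  fixes M :: "nat \<Rightarrow> 'a measure"
    and p :: "nat \<Rightarrow> nat" and q :: nat
    and Sigma :: "nat \<Rightarrow> real mat"
    and X :: "nat \<Rightarrow> 'a \<Rightarrow> nat \<Rightarrow> nat \<Rightarrow> real"
    and eps :: "nat \<Rightarrow> 'a \<Rightarrow> nat \<Rightarrow> real"
    and beta1 :: "real vec"
    and sigma M1 M2 M3 alpha :: real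
    and lam eta :: "nat \<Rightarrow> real"
  defines "Xm \<equiv> \<lambda>n \<omega>. mat n (p n) (\<lambda>(i, j). X n \<omega> i j)"
    and "betastar \<equiv> \<lambda>n. vec (p n) (\<lambda>j. if j < q then beta1 $ j else 0)"
    and "beta_min \<equiv> Min ((\<lambda>j. \<bar>beta1 $ j\<bar>) ` {..<q})"
  assumes prob: "\<And>n. prob_space (M n)"
    and q_pos: "0 < q"
    and p_gt: "\<And>n. q < p n"
    and Sigma_dim: "\<And>n. Sigma n \<in> carrier_mat (p n) (p n)"
    and Sigma_pd: "\<And>n. sym_pos_def_mat (Sigma n)"
    and rows_normal: "\<And>n i. i < n \<Longrightarrow>
        mvn_distributed (M n) (Sigma n) (\<lambda>\<omega>. restrict (X n \<omega> i) {..<p n})"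
    and sigma_pos: "0 < sigma"
    and eps_normal: "\<And>n. mvn_distributed (M n) ((sigma\<^sup>2) \<cdot>\<^sub>m 1\<^sub>m n)
        (\<lambda>\<omega>. restrict (eps n \<omega>) {..<n})"
    and indep: "\<And>n. prob_space.indep_vars (M n)
        (\<lambda>k. PiM {..<(case k of None \<Rightarrow> n | Some _ \<Rightarrow> p n)} (\<lambda>_. lborel))
        (\<lambda>k \<omega>. case k of None \<Rightarrow> restrict (eps n \<omega>) {..<n}
                        | Some i \<Rightarrow> restrict (X n \<omega> i) {..<p n})
        (insert None (Some ` {..<n}))"
    and beta1_dim: "beta1 \<in> carrier_vec q"
    and beta1_nz: "\<forall>j<q. beta1 $ j \<noteq> 0"
    and p_growth: "\<And>\<delta>. \<delta> > 0 \<Longrightarrow> (\<lambda>n. real (p n) * exp (- (real n powr \<delta>))) \<longlonglongrightarrow> 0"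
    and M_pos: "0 < M1" "0 < M2" "0 < M3" "0 < alpha"
    and M1_bound: "M1 < beta_min\<^sup>2 / (9 * sigma\<^sup>2)"
    and M3_bound: "sqrt (2 + sqrt 2) * sqrt M3 * sigma / alpha < beta_min / (3 * M2 * sqrt (real q))"
    and lam_pos: "\<And>n. 0 < lam n"
    and eta_pos: "\<And>n. 0 < eta n"
    and lam_upper: "eventually (\<lambda>n. lam n / real n < 2 * beta_min / (3 * M2 * sqrt (real q))) sequentially"
    and lam_lower: "eventually (\<lambda>n. lam n / real n \<ge> 2 * sqrt (2 + sqrt 2) * sqrt M3 * sigma / alpha) sequentially"
    and eta_upper: "eventually (\<lambda>n. eta n / real n <
        1 / (3 * M2 * lambda_max (blk11 (Sigma n) q)) * (beta_min / sqrt (sq_norm_v beta1))) sequentially"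
    and GIC: "\<exists>\<delta>4>0. (\<lambda>n. Max ((\<lambda>j. \<P>(\<omega> in M n.
          \<bar>gic_vec (Xm n \<omega>) (Sigma n) q beta1 (lam n) (eta n) $ j\<bar> > 1 - alpha)) ` {..<p n - q}))
        \<in> o(\<lambda>n. exp (- (real n powr \<delta>4)))"
    and HA: "\<exists>\<delta>1>0. (\<lambda>n. 1 - \<P>(\<omega> in M n.
          lambda_max (H_A (Xm n \<omega>) (Sigma n) q (eta n) * transpose_mat (H_A (Xm n \<omega>) (Sigma n) q (eta n))) \<le> M1))
        \<in> o(\<lambda>n. exp (- (real n powr \<delta>1)))"
    and C11: "\<exists>\<delta>2>0. (\<lambda>n. 1 - \<P>(\<omega> in M n.
          lambda_max (mat_inv (calC11 (Xm n \<omega>) (Sigma n) q (eta n))) \<le> M2))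
        \<in> o(\<lambda>n. exp (- (real n powr \<delta>2)))"
    and HB: "\<exists>\<delta>3>0. (\<lambda>n. 1 - \<P>(\<omega> in M n.
          lambda_max (H_B (Xm n \<omega>) (Sigma n) q (eta n) * transpose_mat (H_B (Xm n \<omega>) (Sigma n) q (eta n))) \<le> M3))
        \<in> o(\<lambda>n. exp (- (real n powr \<delta>3)))"
  shows "(\<lambda>n. \<P>(\<omega> in M n. \<forall>j<p n.
            sgn (gEN (Xm n \<omega>) (Xm n \<omega> *\<^sub>v betastar n + vec n (eps n \<omega>)) (Sigma n) (lam n) (eta n) $ j) = sgn (betastar n $ j)))
         \<longlonglongrightarrow> 1"
proof -
  let ?H = "\<lambda>K n \<omega>. lambda_max (K (Xm n \<omega>) (Sigma n) q (eta n) * transpose_mat (K (Xm n \<omega>) (Sigma n) q (eta n)))"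
  define R where "R n = \<P>(\<omega> in M n. \<forall>j<p n.
      sgn (gEN (Xm n \<omega>) (Xm n \<omega> *\<^sub>v betastar n + vec n (eps n \<omega>)) (Sigma n) (lam n) (eta n) $ j) = sgn (betastar n $ j))" for n
  define pA where "pA n = 1 - \<P>(\<omega> in M n. ?H H_A n \<omega> \<le> M1)" for n
  define pC where "pC n = 1 - \<P>(\<omega> in M n. lambda_max (mat_inv (calC11 (Xm n \<omega>) (Sigma n) q (eta n))) \<le> M2)" for n
  define pB where "pB n = 1 - \<P>(\<omega> in M n. ?H H_B n \<omega> \<le> M3)" for n
  define pG where "pG n = Max ((\<lambda>j. \<P>(\<omega> in M n.
      \<bar>gic_vec (Xm n \<omega>) (Sigma n) q beta1 (lam n) (eta n) $ j\<bar> > 1 - alpha)) ` {..<p n - q})" for n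
  define eA where "eA n = real q * (2 * exp (- ((sqrt (real n) * beta_min / 3)\<^sup>2 / (2 * sigma\<^sup>2 * M1))))" for n
  \<comment> \<open>The exponent is written as a power with exponent 1 to match the growth
    hypothesis.\<close>
  define eB where "eB n = 2 * (real (p n) * exp (- (real n powr 1)))" for n
  have bmin: "0 < beta_min" "\<And>j. j < q \<Longrightarrow> beta_min \<le> \<bar>beta1 $ j\<bar>"
  proof -
    have "{..<q} \<noteq> {}" using q_pos by auto
    then show "0 < beta_min" unfolding beta_min_def using beta1_nz by (subst Min_gr_iff) auto
  qed (simp add: beta_min_def)
  have bound: "1 - R n \<le> pA n + pC n + pB n + real (p n) * pG n + eA n + eB n"
    if n: "0 < n"
      and lam_u: "lam n / real n < 2 * beta_min / (3 * M2 * sqrt (real q))"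
      and lam_l: "lam n / real n \<ge> 2 * sqrt (2 + sqrt 2) * sqrt M3 * sigma / alpha"
      and eta_u: "eta n / real n < 1 / (3 * M2 * lambda_max (blk11 (Sigma n) q)) * (beta_min / sqrt (sq_norm_v beta1))" for n
  proof -
    interpret prob_space "M n" by (rule prob)
    let ?I = "\<lambda>k. PiM {..<(case k of None \<Rightarrow> n | Some (_ :: nat) \<Rightarrow> p n)} (\<lambda>_. lborel :: real measure)"
    let ?Y = "\<lambda>k \<omega>. case k of None \<Rightarrow> restrict (eps n \<omega>) {..<n} | Some i \<Rightarrow> restrict (X n \<omega> i) {..<p n}"
    let ?J = "Some ` {..<n}"
    let ?T = "PiM ?J ?I"
    define V where "V \<omega> = restrict (\<lambda>k. ?Y k \<omega>) ?J" for \<omega>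
    define W where "W \<omega> = restrict (eps n \<omega>) {..<n}" for \<omega>
    \<comment> \<open>The independent family is split into the block of all rows and the block of
      the noise alone. The latter is still a one-element family; evaluation at \<open>None\<close>
      recovers the noise vector.\<close>
    have ind: "indep_var ?T V (PiM {None} ?I) (\<lambda>\<omega>. restrict (\<lambda>k. ?Y k \<omega>) {None})"
      unfolding V_def by (rule indep_var_restrict[OF indep]) auto
    have ev: "(\<lambda>f. f None) \<in> measurable (PiM {None} ?I) (PiM {..<n} (\<lambda>_. lborel))"
      using measurable_component_singleton[of None "{None}" ?I] by simp
    have joint: "distr (M n) ?T V \<Otimes>\<^sub>M distr (M n) (PiM {..<n} (\<lambda>_. lborel)) W
      = distr (M n) (?T \<Otimes>\<^sub>M PiM {..<n} (\<lambda>_. lborel)) (\<lambda>\<omega>. (V \<omega>, W \<omega>))"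
      using indep_var_compose_joint_distr[OF ind ev] by (simp add: W_def[abs_def])
    note Vm = indep_var_rv1[OF ind]
    define F where "F v = mat n (p n) (\<lambda>(i, j). v (Some i) j :: real)" for v :: "nat option \<Rightarrow> nat \<Rightarrow> real"
    have F: "F v \<in> carrier_mat n (p n)" for v by (simp add: F_def)
    have Fm: "(\<lambda>v. F v $$ (i, j)) \<in> borel_measurable ?T" if ij: "i < n" "j < p n" for i j
    proof -
      have "(\<lambda>v. v (Some i)) \<in> measurable ?T (?I (Some i))"
        by (rule measurable_component_singleton) (use ij in auto)
      moreover have "(\<lambda>f. f j) \<in> measurable (?I (Some i)) lborel"
        using ij by (auto intro!: measurable_component_singleton)
      ultimately have "(\<lambda>v. v (Some i) j) \<in> measurable ?T lborel" by (rule measurable_compose)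
      then show ?thesis using ij by (simp add: F_def)
    qed
    have XF: "F (V \<omega>) = Xm n \<omega>" for \<omega>
      unfolding F_def Xm_def V_def by (rule eq_matI) auto
    have vecW: "vec n (W \<omega>) = vec n (eps n \<omega>)" for \<omega> by (auto simp: W_def)
    have pd: "sym_pos_def_mat (Sigma n)" and Sd: "Sigma n \<in> carrier_mat (p n) (p n)" by (fact Sigma_pd Sigma_dim)+
    have gic: "measure (M n) {\<omega> \<in> space (M n). \<bar>gic_vec (F (V \<omega>)) (Sigma n) q beta1 (lam n) (eta n) $ j\<bar> > 1 - alpha} \<le> pG n"
      if "j < p n - q" for j
      \<comment> \<open>The maximum is over finitely many coordinates, so it bounds each of
        them.\<close>
      unfolding XF pG_def using that by (intro Max_ge) auto
    have "1 - R n \<le> pA n + pC n + pB n + real (p n - q) * pG n + eA n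
      + real (p n - q) * (2 * exp (- ((alpha * lam n / (2 * sqrt (real n)))\<^sup>2 / (2 * sigma\<^sup>2 * M3))))"
      using sign_recovery_failure_prob[where F = F and g = "pG n", OF prob_space_axioms Vm joint eps_normal[of n, folded W_def] sigma_pos F Fm Sd pd
          q_pos less_imp_le[OF p_gt[of n]] n lam_pos[of n] eta_pos[of n] beta1_dim beta1_nz bmin M_pos lam_u eta_u gic]
      unfolding XF vecW R_def pA_def pC_def pB_def eA_def betastar_def .
    moreover have "real (p n - q) * pG n \<le> real (p n) * pG n"
    proof (rule mult_right_mono)
      show "0 \<le> pG n" using order_trans[OF measure_nonneg gic[of 0]] p_gt[of n] by simp
    qed simp
    moreover have "real (p n - q) * (2 * exp (- ((alpha * lam n / (2 * sqrt (real n)))\<^sup>2 / (2 * sigma\<^sup>2 * M3)))) \<le> eB n"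
    proof -
      \<comment> \<open>From the lower bound on lambda / n, the threshold alpha lambda / (2 sqrt n)
        is at least sqrt n sqrt(2 + sqrt 2) sqrt(M3) sigma. Squaring and dividing by 2 sigma^2 M3
        leaves n (1 + sqrt 2 / 2), which exceeds n.\<close>
      have "2 * sqrt (2 + sqrt 2) * sqrt M3 * sigma \<le> alpha * (lam n / real n)"
        using lam_l M_pos by (simp add: pos_divide_le_eq mult.commute)
      then have "sqrt (real n) * (sqrt (2 + sqrt 2) * sqrt M3 * sigma) \<le> sqrt (real n) * (alpha * (lam n / real n) / 2)"
        by (intro mult_left_mono) auto
      also have "\<dots> = alpha * lam n / 2 * (sqrt (real n) / real n)" by (simp add: mult_ac)
      also have "sqrt (real n) / real n = 1 / sqrt (real n)" using n by (simp add: field_simps)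
      finally have "sqrt (real n) * (sqrt (2 + sqrt 2) * sqrt M3 * sigma) \<le> alpha * lam n / (2 * sqrt (real n))" by simp
      then have "(sqrt (real n) * (sqrt (2 + sqrt 2) * sqrt M3 * sigma))\<^sup>2 \<le> (alpha * lam n / (2 * sqrt (real n)))\<^sup>2"
        using M_pos sigma_pos by (intro power_mono) auto
      moreover have "(sqrt (real n) * (sqrt (2 + sqrt 2) * sqrt M3 * sigma))\<^sup>2 = real n * (2 + sqrt 2) * M3 * sigma\<^sup>2"
        using M_pos by (simp add: power_mult_distrib)
      ultimately have "real n * (2 + sqrt 2) * M3 * sigma\<^sup>2 / (2 * sigma\<^sup>2 * M3)
          \<le> (alpha * lam n / (2 * sqrt (real n)))\<^sup>2 / (2 * sigma\<^sup>2 * M3)"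
        using M_pos sigma_pos by (intro divide_right_mono) auto
      moreover have "real n * (2 + sqrt 2) * M3 * sigma\<^sup>2 / (2 * sigma\<^sup>2 * M3) = real n + real n * sqrt 2 / 2"
        using M_pos sigma_pos by (simp add: field_simps)
      ultimately have "real n powr 1 \<le> (alpha * lam n / (2 * sqrt (real n)))\<^sup>2 / (2 * sigma\<^sup>2 * M3)"
        using n by (simp add: add_increasing2 order_trans[rotated])
      then have "real (p n - q) * (2 * exp (- ((alpha * lam n / (2 * sqrt (real n)))\<^sup>2 / (2 * sigma\<^sup>2 * M3))))
         \<le> real (p n) * (2 * exp (- (real n powr 1)))"
        by (intro mult_mono) auto
      then show ?thesis by (simp add: eB_def)
    qed
    ultimately show ?thesis by simp
  qed
  \<comment> \<open>The factor 1 is the c of \<open>smallo_mult_tendsto_0\<close>.\<close>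
  have exp0: "(\<lambda>n. 1 * exp (- (real n powr d))) \<longlonglongrightarrow> 0" if "0 < d" for d
    using that by real_asymp
  have lim: "(\<lambda>n. pA n + pC n + pB n + real (p n) * pG n + eA n + eB n) \<longlonglongrightarrow> 0 + 0 + 0 + 0 + 0 + 2 * 0"
  proof (intro tendsto_add)
    obtain d where "0 < d" "pA \<in> o(\<lambda>n. exp (- (real n powr d)))" using HA unfolding pA_def[abs_def] by blast
    then show "pA \<longlonglongrightarrow> 0" using smallo_mult_tendsto_0[OF _ _ exp0[of d], of pA] by simp
    obtain d where "0 < d" "pC \<in> o(\<lambda>n. exp (- (real n powr d)))" using C11 unfolding pC_def[abs_def] by blast
    then show "pC \<longlonglongrightarrow> 0" using smallo_mult_tendsto_0[OF _ _ exp0[of d], of pC] by simp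
    obtain d where "0 < d" "pB \<in> o(\<lambda>n. exp (- (real n powr d)))" using HB unfolding pB_def[abs_def] by blast
    then show "pB \<longlonglongrightarrow> 0" using smallo_mult_tendsto_0[OF _ _ exp0[of d], of pB] by simp
    obtain d where "0 < d" "pG \<in> o(\<lambda>n. exp (- (real n powr d)))" using GIC unfolding pG_def[abs_def] by blast
    then show "(\<lambda>n. real (p n) * pG n) \<longlonglongrightarrow> 0" using smallo_mult_tendsto_0[OF _ _ p_growth[of d], of pG] by simp
    \<comment> \<open>The threshold sqrt n beta_min / 3 contributes the 9 and the Chernoff exponent
      the 2 in 18.\<close>
    define c where "c = beta_min\<^sup>2 / (18 * sigma\<^sup>2 * M1)"
    have c: "0 < c" using bmin M_pos sigma_pos by (simp add: c_def)
    have "eA n = real q * (2 * exp (- (c * real n)))" for n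
      by (simp add: eA_def c_def power_mult_distrib power_divide field_simps)
    moreover have "(\<lambda>n. real q * (2 * exp (- (c * real n)))) \<longlonglongrightarrow> 0" using c by real_asymp
    ultimately show "eA \<longlonglongrightarrow> 0" by presburger
    show "eB \<longlonglongrightarrow> 2 * 0" unfolding eB_def[abs_def] by (intro tendsto_mult tendsto_const p_growth) simp
  qed
  have "(\<lambda>n. 1 - R n) \<longlonglongrightarrow> 0"
  proof (rule tendsto_sandwich[OF _ _ tendsto_const])
    show "eventually (\<lambda>n. 1 - R n \<le> pA n + pC n + pB n + real (p n) * pG n + eA n + eB n) sequentially"
      using eventually_gt_at_top[of 0] lam_upper lam_lower eta_upper
      by eventually_elim (rule bound)
    show "eventually (\<lambda>n. 0 \<le> 1 - R n) sequentially"
      unfolding R_def using prob_space.prob_le_1[OF prob] by simp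
    show "(\<lambda>n. pA n + pC n + pB n + real (p n) * pG n + eA n + eB n) \<longlonglongrightarrow> 0" using lim by simp
  qed
  then have "(\<lambda>n. 1 - (1 - R n)) \<longlonglongrightarrow> 1 - 0" by (intro tendsto_diff tendsto_const)
  then show ?thesis by (simp add: R_def)
qed

end
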